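(* Let $\mathcal T$ be a weakly approximable triangulated category with coproducts. (i) Suppose $G$ is a compact generator, $(\mathcal T^{\le0},\mathcal T^{\ge0})$ is a $t$-structure and $A>0$ is an integer such that conditions (a) and (b) below hold. Then the $t$-structure $(\mathcal T^{\le0},\mathcal T^{\ge0})$ belongs to the preferred equivalence class. (ii) For any compact generator $G$ and any $t$-structure $(\mathcal T^{\le0},\mathcal T^{\ge0})$ in the preferred equivalence class there exists an integer $A>0$, depending on $G$ and on the $t$-structure, such that (a) and (b) below hold. If $\mathcal T$ is approximable, the integer $A$ may be chosen so that (c) holds as well. Here the conditions on the triple $G$, $(\mathcal T^{\le0},\mathcal T^{\ge0})$, $A$ are: (a) $\Sigma^AG\in\mathcal T^{\le0}$ and $\mathrm{Hom}(\Sigma^{-A}G,\mathcal T^{\le0})=0$; (b) every object $F\in\mathcal T^{\le0}$ admits a triangle $E\to F\to D\to\Sigma E$ with $E\in\overline{\langle G\rangle}^{[-A,A]}$ and $D\in\mathcal T^{\le-1}$; (c) in the triangle of (b) one may moreover choose $E\in\overline{\langle G\rangle}_A^{[-A,A]}$.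
   Context: $\Sigma$ is the suspension. Generation. For full subcategories $\mathcal A,\mathcal B$ of $\mathcal T$: $\mathrm{Smd}(\mathcal A)$ is the full subcategory of direct summands of objects of $\mathcal A$; $\mathcal A*\mathcal B$ is the full subcategory of objects $y$ admitting a triangle $a\to y\to b\to\Sigma a$ with $a\in\mathcal A,b\in\mathcal B$. For $G\in\mathcal T$, (possibly infinite) $A\le B$ and $n\ge1$: $\mathrm{Coprod}_1(G[A,B])$ is the full subcategory of all (arbitrary small) coproducts of objects $\Sigma^{-i}G$ with $A\le i\le B$; $\mathrm{Coprod}_{n+1}(G[A,B])=\mathrm{Coprod}_1(G[A,B])*\mathrm{Coprod}_n(G[A,B])$; $\overline{\langle G\rangle}_n^{[A,B]}=\mathrm{Smd}(\mathrm{Coprod}_n(G[A,B]))$. $\mathrm{Coprod}(G[A,B])$ is the smallest full subcategory $\mathcal S$ closed under coproducts, with $\mathcal S*\mathcal S\subset\mathcal S$, and containing $\Sigma^{-i}G$ for $A\le i\le B$; $\overline{\langle G\rangle}^{[A,B]}=\mathrm{Smd}(\mathrm{Coprod}(G[A,B]))$. $t$-structures. $\mathcal T^{\le n}=\Sigma^{-n}\mathcal T^{\le0}$. Two $t$-structures are equivalent if there is $A>0$ with $\mathcal T_1^{\le-A}\subset\mathcal T_2^{\le0}\subset\mathcal T_1^{\le A}$. If $\mathcal T$ has a single compact generator $H$, the preferred equivalence class of $t$-structures is the one containing the $t$-structure generated by $H$, whose aisle is $\mathcal T_H^{\le0}=\overline{\langle H\rangle}^{(-\infty,0]}$; it does not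 depend on the choice of $H$. A triangulated category $\mathcal T$ with coproducts is weakly approximable if there exist a compact generator $G$, a $t$-structure and an integer $A>0$ satisfying (a) and (b) of the claim; it is approximable if these can be chosen to satisfy (a), (b) and (c). *)

theory Defs
  imports Main "HOL-Algebra.Free_Abelian_Groups"
begin

unbundle cardinal_syntax

section \<open>Smallness\<close>

text \<open>A set is small if its cardinality is below a fixed (uncountable strongly) inaccessible cardinal
  \<open>\<kappa>\<close>.  Objects and arrows of a category may form arbitrarily large types; hom-sets and
  the index sets of coproducts are small.  Up to bijection every small set is a subset of the type
  \<open>'u\<close> that carries \<open>\<kappa>\<close>, so families indexed by \<open>'u set\<close> represent all small families.\<close>

definition inaccessible :: "'u rel \<Rightarrow> bool" where
  "inaccessible \<kappa> \<longleftrightarrow>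
     Card_order \<kappa> \<and> natLeq <o \<kappa> \<and> regularCard \<kappa> \<and>
     (\<forall>S. S \<subseteq> Field \<kappa> \<and> |S| <o \<kappa> \<longrightarrow> |Pow S| <o \<kappa>)"

definition small :: "'u rel \<Rightarrow> 'a set \<Rightarrow> bool" where
  "small \<kappa> S \<longleftrightarrow> |S| <o \<kappa>"


section \<open>Triangulated categories\<close>

text \<open>The types \<open>'o\<close> and \<open>'m\<close> consist of the objects and of the arrows.
  \<open>Comp T g f\<close>, written \<open>g \<bullet> f\<close>, is \<open>g\<close> after \<open>f\<close> and is only meaningful if
  \<open>Cod T f = Dom T g\<close>; likewise \<open>Add T f g\<close> is only meaningful for parallel arrows.
  A triple \<open>(f, g, h)\<close> in \<open>Tri T\<close> is a distinguished triangle
  \<open>X \<rightarrow> Y \<rightarrow> Z \<rightarrow> \<Sigma>X\<close>.\<close>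

record ('o, 'm) tricat =
  Dom :: "'m \<Rightarrow> 'o"
  Cod :: "'m \<Rightarrow> 'o"
  Ident :: "'o \<Rightarrow> 'm"
  Comp :: "'m \<Rightarrow> 'm \<Rightarrow> 'm" (infixr \<open>\<bullet>\<index>\<close> 70)
  Add :: "'m \<Rightarrow> 'm \<Rightarrow> 'm"
  Zero :: "'o \<Rightarrow> 'o \<Rightarrow> 'm"
  SuspO :: "'o \<Rightarrow> 'o"
  SuspM :: "'m \<Rightarrow> 'm"
  Tri :: "('m \<times> 'm \<times> 'm) set"

definition Mor :: "('o, 'm, 'z) tricat_scheme \<Rightarrow> 'o \<Rightarrow> 'o \<Rightarrow> 'm set" where
  "Mor T X Y = {f. Dom T f = X \<and> Cod T f = Y}"

text \<open>The abelian group \<open>Hom(X, Y)\<close>, in the multiplicative record of the library.\<close>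

definition Hom :: "('o, 'm, 'z) tricat_scheme \<Rightarrow> 'o \<Rightarrow> 'o \<Rightarrow> 'm monoid" where
  "Hom T X Y = \<lparr>carrier = Mor T X Y, monoid.mult = Add T, one = Zero T X Y\<rparr>"

definition neg :: "('o, 'm, 'z) tricat_scheme \<Rightarrow> 'm \<Rightarrow> 'm" where
  "neg T f = inv\<^bsub>Hom T (Dom T f) (Cod T f)\<^esub> f"

definition iso_arrow :: "('o, 'm, 'z) tricat_scheme \<Rightarrow> 'm \<Rightarrow> bool" where
  "iso_arrow T f \<longleftrightarrow>
     (\<exists>g \<in> Mor T (Cod T f) (Dom T f). g \<bullet>\<^bsub>T\<^esub> f = Ident T (Dom T f) \<and> f \<bullet>\<^bsub>T\<^esub> g = Ident T (Cod T f))"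

definition isomorphic :: "('o, 'm, 'z) tricat_scheme \<Rightarrow> 'o \<Rightarrow> 'o \<Rightarrow> bool" where
  "isomorphic T X Y \<longleftrightarrow> (\<exists>f \<in> Mor T X Y. iso_arrow T f)"

definition zero_object :: "('o, 'm, 'z) tricat_scheme \<Rightarrow> 'o \<Rightarrow> bool" where
  "zero_object T Z \<longleftrightarrow> (\<forall>X. (\<exists>!f. f \<in> Mor T X Z) \<and> (\<exists>!f. f \<in> Mor T Z X))"

definition biproduct ::
  "('o, 'm, 'z) tricat_scheme \<Rightarrow> 'o \<Rightarrow> 'o \<Rightarrow> 'o \<Rightarrow> 'm \<Rightarrow> 'm \<Rightarrow> 'm \<Rightarrow> 'm \<Rightarrow> bool" where
  "biproduct T X Y B i j p q \<longleftrightarrow>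
     i \<in> Mor T X B \<and> j \<in> Mor T Y B \<and> p \<in> Mor T B X \<and> q \<in> Mor T B Y \<and>
     p \<bullet>\<^bsub>T\<^esub> i = Ident T X \<and> q \<bullet>\<^bsub>T\<^esub> j = Ident T Y \<and>
     p \<bullet>\<^bsub>T\<^esub> j = Zero T Y X \<and> q \<bullet>\<^bsub>T\<^esub> i = Zero T X Y \<and>
     Add T (i \<bullet>\<^bsub>T\<^esub> p) (j \<bullet>\<^bsub>T\<^esub> q) = Ident T B"

locale additive_category =
  fixes T :: "('o, 'm, 'z) tricat_scheme" (structure)
  assumes Id_in_Mor: "Ident T X \<in> Mor T X X"
    and Comp_in_Mor: "\<lbrakk>f \<in> Mor T X Y; g \<in> Mor T Y Z\<rbrakk> \<Longrightarrow> g \<bullet> f \<in> Mor T X Z"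
    and Comp_Id_left: "f \<in> Mor T X Y \<Longrightarrow> Ident T Y \<bullet> f = f"
    and Comp_Id_right: "f \<in> Mor T X Y \<Longrightarrow> f \<bullet> Ident T X = f"
    and Comp_assoc:
      "\<lbrakk>f \<in> Mor T W X; g \<in> Mor T X Y; h \<in> Mor T Y Z\<rbrakk> \<Longrightarrow> (h \<bullet> g) \<bullet> f = h \<bullet> (g \<bullet> f)"
    and comm_group_Hom: "comm_group (Hom T X Y)"
    and Comp_Add_left:
      "\<lbrakk>f \<in> Mor T X Y; g \<in> Mor T Y Z; g' \<in> Mor T Y Z\<rbrakk>
        \<Longrightarrow> Add T g g' \<bullet> f = Add T (g \<bullet> f) (g' \<bullet> f)"
    and Comp_Add_right:
      "\<lbrakk>f \<in> Mor T X Y; f' \<in> Mor T X Y; g \<in> Mor T Y Z\<rbrakk>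
        \<Longrightarrow> g \<bullet> Add T f f' = Add T (g \<bullet> f) (g \<bullet> f')"
    and ex_zero_object: "\<exists>Z. zero_object T Z"
    and ex_biproduct: "\<exists>B i j p q. biproduct T X Y B i j p q"

text \<open>The suspension is an additive automorphism, not just an autoequivalence, so that
  \<open>\<Sigma>\<^sup>n\<close> is defined on the nose for every integer \<open>n\<close>.  The axioms below are
  Verdier's; in the octahedral axiom \<open>U\<close>, \<open>V\<close>, \<open>W\<close> are the
  chosen cones of \<open>f\<close>, \<open>g \<bullet> f\<close> and \<open>g\<close>.\<close>

locale triangulated_category = additive_category T
  for T :: "('o, 'm, 'z) tricat_scheme" (structure) +
  assumes SuspM_in_Mor: "f \<in> Mor T X Y \<Longrightarrow> SuspM T f \<in> Mor T (SuspO T X) (SuspO T Y)"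
    and SuspM_Id: "SuspM T (Ident T X) = Ident T (SuspO T X)"
    and SuspM_Comp:
      "\<lbrakk>f \<in> Mor T X Y; g \<in> Mor T Y Z\<rbrakk> \<Longrightarrow> SuspM T (g \<bullet> f) = SuspM T g \<bullet> SuspM T f"
    and SuspM_Add:
      "\<lbrakk>f \<in> Mor T X Y; g \<in> Mor T X Y\<rbrakk>
        \<Longrightarrow> SuspM T (Add T f g) = Add T (SuspM T f) (SuspM T g)"
    and bij_SuspO: "bij (SuspO T)"
    and bij_SuspM: "bij (SuspM T)"
    and Tri_typed:
      "(f, g, h) \<in> Tri T \<Longrightarrow>
        Cod T f = Dom T g \<and> Cod T g = Dom T h \<and> Cod T h = SuspO T (Dom T f)"
    and Tri_iso:
      "\<lbrakk>(f, g, h) \<in> Tri T; f \<in> Mor T X Y; g \<in> Mor T Y Z; h \<in> Mor T Z (SuspO T X);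
        f' \<in> Mor T X' Y'; g' \<in> Mor T Y' Z'; h' \<in> Mor T Z' (SuspO T X');
        a \<in> Mor T X X'; b \<in> Mor T Y Y'; c \<in> Mor T Z Z';
        iso_arrow T a; iso_arrow T b; iso_arrow T c;
        f' \<bullet> a = b \<bullet> f; g' \<bullet> b = c \<bullet> g; h' \<bullet> c = SuspM T a \<bullet> h\<rbrakk>
        \<Longrightarrow> (f', g', h') \<in> Tri T"
    and Tri_Id:
      "zero_object T Z \<Longrightarrow> (Ident T X, Zero T X Z, Zero T Z (SuspO T X)) \<in> Tri T"
    and Tri_ex: "\<exists>g h. (f, g, h) \<in> Tri T"
    and Tri_rotate:
      "\<lbrakk>f \<in> Mor T X Y; g \<in> Mor T Y Z; h \<in> Mor T Z (SuspO T X)\<rbrakk>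
        \<Longrightarrow> (f, g, h) \<in> Tri T \<longleftrightarrow> (g, h, neg T (SuspM T f)) \<in> Tri T"
    and Tri_fill:
      "\<lbrakk>(f, g, h) \<in> Tri T; f \<in> Mor T X Y; g \<in> Mor T Y Z; h \<in> Mor T Z (SuspO T X);
        (f', g', h') \<in> Tri T; f' \<in> Mor T X' Y'; g' \<in> Mor T Y' Z'; h' \<in> Mor T Z' (SuspO T X');
        a \<in> Mor T X X'; b \<in> Mor T Y Y'; f' \<bullet> a = b \<bullet> f\<rbrakk>
        \<Longrightarrow> \<exists>c \<in> Mor T Z Z'. g' \<bullet> b = c \<bullet> g \<and> h' \<bullet> c = SuspM T a \<bullet> h"
    and Tri_octahedral:
      "\<lbrakk>f \<in> Mor T X Y; g \<in> Mor T Y Z;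
        (f, f1, f2) \<in> Tri T; f1 \<in> Mor T Y U; f2 \<in> Mor T U (SuspO T X);
        (g, g1, g2) \<in> Tri T; g1 \<in> Mor T Z W; g2 \<in> Mor T W (SuspO T Y);
        (g \<bullet> f, k1, k2) \<in> Tri T; k1 \<in> Mor T Z V; k2 \<in> Mor T V (SuspO T X)\<rbrakk>
        \<Longrightarrow> \<exists>u \<in> Mor T U V. \<exists>v \<in> Mor T V W.
              (u, v, SuspM T f1 \<bullet> g2) \<in> Tri T \<and>
              u \<bullet> f1 = k1 \<bullet> g \<and> k2 \<bullet> u = f2 \<and>
              v \<bullet> k1 = g1 \<and> g2 \<bullet> v = SuspM T f \<bullet> k2"

definition coproduct ::
  "('o, 'm, 'z) tricat_scheme \<Rightarrow> 'i set \<Rightarrow> ('i \<Rightarrow> 'o) \<Rightarrow> 'o \<Rightarrow> ('i \<Rightarrow> 'm) \<Rightarrow> bool" where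
  "coproduct T I X C \<iota> \<longleftrightarrow>
     (\<forall>i\<in>I. \<iota> i \<in> Mor T (X i) C) \<and>
     (\<forall>Y f. (\<forall>i\<in>I. f i \<in> Mor T (X i) Y) \<longrightarrow>
        (\<exists>!g. g \<in> Mor T C Y \<and> (\<forall>i\<in>I. g \<bullet>\<^bsub>T\<^esub> \<iota> i = f i)))"

locale triangulated_with_coproducts = triangulated_category T
  for \<kappa> :: "'u rel" and T :: "('o, 'm, 'z) tricat_scheme" (structure) +
  assumes inaccessible: "inaccessible \<kappa>"
    and small_Mor: "small \<kappa> (Mor T X Y)"
    and ex_coproduct: "small \<kappa> (I :: 'u set) \<Longrightarrow> \<exists>C \<iota>. coproduct T I F C \<iota>"

text \<open>\<open>shift T n X\<close> is \<open>\<Sigma>\<^sup>n X\<close>.\<close>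

definition shift :: "('o, 'm, 'z) tricat_scheme \<Rightarrow> int \<Rightarrow> 'o \<Rightarrow> 'o" where
  "shift T n = (if 0 \<le> n then SuspO T ^^ nat n else inv_into UNIV (SuspO T) ^^ nat (- n))"

text \<open>\<open>triangle T a y b\<close>: there is a triangle \<open>a \<rightarrow> y \<rightarrow> b \<rightarrow> \<Sigma>a\<close>.\<close>

definition triangle :: "('o, 'm, 'z) tricat_scheme \<Rightarrow> 'o \<Rightarrow> 'o \<Rightarrow> 'o \<Rightarrow> bool" where
  "triangle T a y b \<longleftrightarrow>
     (\<exists>f \<in> Mor T a y. \<exists>g \<in> Mor T y b. \<exists>h \<in> Mor T b (SuspO T a). (f, g, h) \<in> Tri T)"


section \<open>Generation\<close>

text \<open>Full subcategories are given by their sets of objects.\<close>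

definition Smd :: "('o, 'm, 'z) tricat_scheme \<Rightarrow> 'o set \<Rightarrow> 'o set" where
  "Smd T \<A> = {X. \<exists>Y. \<exists>B\<in>\<A>. \<exists>i j p q. biproduct T X Y B i j p q}"

definition star :: "('o, 'm, 'z) tricat_scheme \<Rightarrow> 'o set \<Rightarrow> 'o set \<Rightarrow> 'o set" where
  "star T \<A> \<B> = {y. \<exists>a\<in>\<A>. \<exists>b\<in>\<B>. triangle T a y b}"

text \<open>All small coproducts of families of objects of \<open>\<A>\<close>.\<close>

definition coproducts_of ::
  "'u rel \<Rightarrow> ('o, 'm, 'z) tricat_scheme \<Rightarrow> 'o set \<Rightarrow> 'o set" where
  "coproducts_of \<kappa> T \<A> =
     {C. \<exists>(I :: 'u set) X \<iota>. small \<kappa> I \<and> (\<forall>i\<in>I. X i \<in> \<A>) \<and> coproduct T I X C \<iota>}"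

text \<open>In the following the bounds \<open>[A, B]\<close>, which may be infinite, are an interval
  \<open>J\<close> of integers, for instance \<open>{-A..A}\<close> or \<open>{..0}\<close>.\<close>

definition shifts :: "('o, 'm, 'z) tricat_scheme \<Rightarrow> 'o \<Rightarrow> int set \<Rightarrow> 'o set" where
  "shifts T G J = (\<lambda>i. shift T (- i) G) ` J"

text \<open>Only the values for \<open>n \<ge> 1\<close> matter.\<close>

fun Coprod_n :: "'u rel \<Rightarrow> ('o, 'm, 'z) tricat_scheme \<Rightarrow> nat \<Rightarrow> 'o \<Rightarrow> int set \<Rightarrow> 'o set" where
  "Coprod_n \<kappa> T 0 G J = {}"
| "Coprod_n \<kappa> T (Suc 0) G J = coproducts_of \<kappa> T (shifts T G J)"
| "Coprod_n \<kappa> T (Suc (Suc n)) G J =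
     star T (Coprod_n \<kappa> T (Suc 0) G J) (Coprod_n \<kappa> T (Suc n) G J)"

definition Coprod :: "'u rel \<Rightarrow> ('o, 'm, 'z) tricat_scheme \<Rightarrow> 'o \<Rightarrow> int set \<Rightarrow> 'o set" where
  "Coprod \<kappa> T G J =
     \<Inter> {\<S>. coproducts_of \<kappa> T \<S> \<subseteq> \<S> \<and> star T \<S> \<S> \<subseteq> \<S> \<and> shifts T G J \<subseteq> \<S>}"

definition gen_n :: "'u rel \<Rightarrow> ('o, 'm, 'z) tricat_scheme \<Rightarrow> nat \<Rightarrow> 'o \<Rightarrow> int set \<Rightarrow> 'o set" where
  "gen_n \<kappa> T n G J = Smd T (Coprod_n \<kappa> T n G J)"

definition gen :: "'u rel \<Rightarrow> ('o, 'm, 'z) tricat_scheme \<Rightarrow> 'o \<Rightarrow> int set \<Rightarrow> 'o set" where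
  "gen \<kappa> T G J = Smd T (Coprod \<kappa> T G J)"

text \<open>\<open>G\<close> is compact if \<open>Hom(G, -)\<close> commutes with small coproducts: the
  canonical map from the direct sum of the \<open>Hom(G, X\<^sub>i)\<close> to
  \<open>Hom(G, C)\<close> is an isomorphism whenever \<open>C\<close> is a coproduct of the
  \<open>X\<^sub>i\<close>.  Here \<open>gfinprod\<close> is the sum of a finitely supported family.\<close>

definition compact_object :: "'u rel \<Rightarrow> ('o, 'm, 'z) tricat_scheme \<Rightarrow> 'o \<Rightarrow> bool" where
  "compact_object \<kappa> T G \<longleftrightarrow>
     (\<forall>(I :: 'u set) X C \<iota>. small \<kappa> I \<and> coproduct T I X C \<iota> \<longrightarrow>
        (\<lambda>g. gfinprod (Hom T G C) (\<lambda>i. \<iota> i \<bullet>\<^bsub>T\<^esub> g i) I)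
          \<in> iso (sum_group I (\<lambda>i. Hom T G (X i))) (Hom T G C))"

definition compact_generator :: "'u rel \<Rightarrow> ('o, 'm, 'z) tricat_scheme \<Rightarrow> 'o \<Rightarrow> bool" where
  "compact_generator \<kappa> T G \<longleftrightarrow>
     compact_object \<kappa> T G \<and>
     (\<forall>X. (\<forall>n. Mor T (shift T n G) X = {Zero T (shift T n G) X}) \<longrightarrow> zero_object T X)"


section \<open>t-structures\<close>

text \<open>\<open>trunc T \<D> n\<close> is \<open>\<Sigma>\<^sup>-\<^sup>n\<D>\<close>; for \<open>\<D> = T\<^sup>\<le>\<^sup>0\<close> it is \<open>T\<^sup>\<le>\<^sup>n\<close>, and
  for \<open>\<D> = T\<^sup>\<ge>\<^sup>0\<close> it is \<open>T\<^sup>\<ge>\<^sup>n\<close>.\<close>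

definition trunc :: "('o, 'm, 'z) tricat_scheme \<Rightarrow> 'o set \<Rightarrow> int \<Rightarrow> 'o set" where
  "trunc T \<D> n = shift T (- n) ` \<D>"

definition t_structure :: "('o, 'm, 'z) tricat_scheme \<Rightarrow> 'o set \<times> 'o set \<Rightarrow> bool" where
  "t_structure T = (\<lambda>(L, R).
     (\<forall>X\<in>L. \<forall>Y. isomorphic T X Y \<longrightarrow> Y \<in> L) \<and>
     (\<forall>X\<in>R. \<forall>Y. isomorphic T X Y \<longrightarrow> Y \<in> R) \<and>
     trunc T L (-1) \<subseteq> L \<and> trunc T R 1 \<subseteq> R \<and>
     (\<forall>X\<in>L. \<forall>Y\<in>trunc T R 1. Mor T X Y = {Zero T X Y}) \<and>
     (\<forall>X. \<exists>A\<in>L. \<exists>B\<in>trunc T R 1. triangle T A X B))"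

definition t_equivalent ::
  "('o, 'm, 'z) tricat_scheme \<Rightarrow> 'o set \<times> 'o set \<Rightarrow> 'o set \<times> 'o set \<Rightarrow> bool" where
  "t_equivalent T \<tau> \<tau>' \<longleftrightarrow>
     (\<exists>A>0. trunc T (fst \<tau>) (- A) \<subseteq> fst \<tau>' \<and> fst \<tau>' \<subseteq> trunc T (fst \<tau>) A)"

text \<open>The class of the t-structure generated by the compact generator \<open>H\<close>.\<close>

definition preferred_class ::
  "'u rel \<Rightarrow> ('o, 'm, 'z) tricat_scheme \<Rightarrow> 'o \<Rightarrow> ('o set \<times> 'o set) set" where
  "preferred_class \<kappa> T H =
     {\<tau>. t_structure T \<tau> \<and>
        (\<exists>\<tau>\<^sub>H. t_structure T \<tau>\<^sub>H \<and> fst \<tau>\<^sub>H = gen \<kappa> T H {..0} \<and> t_equivalent T \<tau>\<^sub>H \<tau>)}"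


section \<open>Approximability\<close>

definition cond_a ::
  "('o, 'm, 'z) tricat_scheme \<Rightarrow> 'o \<Rightarrow> 'o set \<times> 'o set \<Rightarrow> nat \<Rightarrow> bool" where
  "cond_a T G \<tau> A \<longleftrightarrow>
     shift T (int A) G \<in> fst \<tau> \<and>
     (\<forall>X \<in> fst \<tau>. Mor T (shift T (- int A) G) X = {Zero T (shift T (- int A) G) X})"

definition cond_b ::
  "'u rel \<Rightarrow> ('o, 'm, 'z) tricat_scheme \<Rightarrow> 'o \<Rightarrow> 'o set \<times> 'o set \<Rightarrow> nat \<Rightarrow> bool" where
  "cond_b \<kappa> T G \<tau> A \<longleftrightarrow>
     (\<forall>F \<in> fst \<tau>. \<exists>E \<in> gen \<kappa> T G {- int A..int A}. \<exists>D \<in> trunc T (fst \<tau>) (-1).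
        triangle T E F D)"

definition cond_c ::
  "'u rel \<Rightarrow> ('o, 'm, 'z) tricat_scheme \<Rightarrow> 'o \<Rightarrow> 'o set \<times> 'o set \<Rightarrow> nat \<Rightarrow> bool" where
  "cond_c \<kappa> T G \<tau> A \<longleftrightarrow>
     (\<forall>F \<in> fst \<tau>. \<exists>E \<in> gen_n \<kappa> T A G {- int A..int A}. \<exists>D \<in> trunc T (fst \<tau>) (-1).
        triangle T E F D)"

definition weakly_approximable :: "'u rel \<Rightarrow> ('o, 'm, 'z) tricat_scheme \<Rightarrow> bool" where
  "weakly_approximable \<kappa> T \<longleftrightarrow>
     (\<exists>G \<tau> A. compact_generator \<kappa> T G \<and> t_structure T \<tau> \<and> 0 < A \<and>
        cond_a T G \<tau> A \<and> cond_b \<kappa> T G \<tau> A)"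

definition approximable :: "'u rel \<Rightarrow> ('o, 'm, 'z) tricat_scheme \<Rightarrow> bool" where
  "approximable \<kappa> T \<longleftrightarrow>
     (\<exists>G \<tau> A. compact_generator \<kappa> T G \<and> t_structure T \<tau> \<and> 0 < A \<and>
        cond_a T G \<tau> A \<and> cond_b \<kappa> T G \<tau> A \<and> cond_c \<kappa> T G \<tau> A)"

end

theory Submission
  imports Defs
begin

text \<open>Resolving \<open>F \<in> T\<^sup>\<le>\<^sup>0\<close> repeatedly by the triangles of (b) gives \<open>F = X\<^sub>0 \<rightarrow> X\<^sub>1 \<rightarrow> \<dots>\<close> with \<open>X\<^sub>n \<in> T\<^sup>\<le>\<^sup>-\<^sup>n\<close>.
  By (a) every \<open>\<Sigma>\<^sup>i G\<close> eventually has no arrows to \<open>X\<^sub>n\<close>, so by compactness the homotopy colimit of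
  the \<open>X\<^sub>n\<close> vanishes.  This has two consequences.

  Compatible families of arrows \<open>X\<^sub>n \<rightarrow> Y\<close> are zero.  An arrow from \<open>F\<close> to the coaisle generated by
  \<open>\<Sigma>\<^sup>-\<^sup>A G\<close> extends to such a family, because it kills the fibres of all \<open>X\<^sub>n \<rightarrow> X\<^sub>n\<^sub>+\<^sub>1\<close>; hence \<open>T\<^sup>\<le>\<^sup>0\<close>
  lies in \<open>T\<^sub>G\<^sup>\<le>\<^sup>A\<close>, the other inclusion being (a).

  If \<open>F\<close> is compact, then already some \<open>F \<rightarrow> X\<^sub>n\<close> is zero, so \<open>F\<close> is a direct summand of the fibre of
  this arrow, an iterated extension of the objects \<open>E\<close> used so far.  Thus every compact \<open>F\<close> lies in
  some \<open>\<langle>G\<rangle>\<^sup>[\<^sup>-\<^sup>B\<^sup>,\<^sup>B\<^sup>]\<close>.  Killing instead all arrows from the shifts of a second compact generator \<open>G'\<close>,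
  and then discarding the shifts of \<open>G'\<close> that are too far from \<open>G\<close> in the t-structure, shows that \<open>G\<close>
  lies in some \<open>\<langle>G'\<rangle>\<^sub>k\<^sup>[\<^sup>-\<^sup>B\<^sup>,\<^sup>B\<^sup>]\<close>.  So \<open>G\<close> may be replaced by \<open>G'\<close> in (a), (b) and (c), and iterating (b)
  finitely often compensates a change to an equivalent t-structure.\<close>

section \<open>Additive categories\<close>

text \<open>Two devissages of compact objects are needed because each controls one thing only.
  Objects of \<open>gen\<close> involve an unlimited number of extensions, so resolving by (b)
  bounds degrees but says nothing about the count that (c) is about. Resolving by coproducts of
  shifts of G' costs one extension per stage, but its terms use arbitrarily high suspensions of G',
  which must be cut off afterwards. The cut needs both halves of (a) for G' relative to the given
  t-structure. This dictates the order in \<open>compare_generators\<close>: truncation bounds G'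
  above, the first devissage places it in a bounded \<open>gen\<close> of G and so yields the lower
  half of (a), and only then can G be built from G' in boundedly many extensions. The preferred
  class refers to an actual t-structure with aisle \<open>gen H {..0}\<close>, so its truncation
  triangles have to be constructed, by attaching cells. Fillers of triangles are not canonical;
  hence splittings, coproducts of triangles and retracts of extensions are obtained by correcting
  fillers by hand.\<close>

context additive_category
begin

abbreviation sub :: "'m \<Rightarrow> 'm \<Rightarrow> 'm" where
  "sub f g \<equiv> Add T f (neg T g)"

lemma in_Mor: "f \<in> Mor T X Y \<longleftrightarrow> Dom T f = X \<and> Cod T f = Y"
  by (simp add: Mor_def)

lemma Dom_Ident [simp]: "Dom T (Ident T X) = X" and Cod_Ident [simp]: "Cod T (Ident T X) = X"
  using Id_in_Mor[of X] by (simp_all add: in_Mor)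

lemma
  assumes "Cod T f = Dom T g"
  shows Dom_Comp [simp]: "Dom T (g \<bullet> f) = Dom T f" and Cod_Comp [simp]: "Cod T (g \<bullet> f) = Cod T g"
  using assms Comp_in_Mor[of f "Dom T f" "Cod T f" g "Cod T g"] by (simp_all add: in_Mor)

lemma Ident_Comp [simp]: "Cod T f = Y \<Longrightarrow> Ident T Y \<bullet> f = f"
  using Comp_Id_left[of f "Dom T f" Y] by (simp add: in_Mor)

lemma Comp_Ident [simp]: "Dom T f = X \<Longrightarrow> f \<bullet> Ident T X = f"
  using Comp_Id_right[of f X "Cod T f"] by (simp add: in_Mor)

lemma assoc: "Cod T f = Dom T g \<Longrightarrow> Cod T g = Dom T h \<Longrightarrow> (h \<bullet> g) \<bullet> f = h \<bullet> (g \<bullet> f)"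
  using Comp_assoc[of f "Dom T f" "Dom T g" g "Dom T h" h "Cod T h"] by (simp add: in_Mor)

lemma assoc_eq:
  assumes "h \<bullet> g = k" "Cod T f = Dom T g" "Cod T g = Dom T h"
  shows "h \<bullet> (g \<bullet> f) = k \<bullet> f"
  using assms assoc by metis

lemma Dom_Zero [simp]: "Dom T (Zero T X Y) = X" and Cod_Zero [simp]: "Cod T (Zero T X Y) = Y"
proof -
  interpret comm_group "Hom T X Y" by (rule comm_group_Hom)
  have "Zero T X Y \<in> Mor T X Y" using one_closed by (simp add: Hom_def)
  then show "Dom T (Zero T X Y) = X" "Cod T (Zero T X Y) = Y" by (simp_all add: in_Mor)
qed

lemma
  assumes "Dom T f = Dom T g" "Cod T f = Cod T g"
  shows Dom_Add [simp]: "Dom T (Add T f g) = Dom T f" and Cod_Add [simp]: "Cod T (Add T f g) = Cod T f"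
    and Add_commute: "Add T f g = Add T g f"
proof -
  interpret comm_group "Hom T (Dom T f) (Cod T f)" by (rule comm_group_Hom)
  have "Add T f g \<in> Mor T (Dom T f) (Cod T f)"
    using m_closed[of f g] assms by (simp add: Hom_def in_Mor)
  then show "Dom T (Add T f g) = Dom T f" "Cod T (Add T f g) = Cod T f" by (simp_all add: in_Mor)
  show "Add T f g = Add T g f" using m_comm[of f g] assms by (simp add: Hom_def in_Mor)
qed

lemma Add_assoc:
  assumes "Dom T f = Dom T g" "Cod T f = Cod T g" "Dom T g = Dom T h" "Cod T g = Cod T h"
  shows "Add T (Add T f g) h = Add T f (Add T g h)"
proof -
  interpret comm_group "Hom T (Dom T f) (Cod T f)" by (rule comm_group_Hom)
  show ?thesis using m_assoc[of f g h] assms by (simp add: Hom_def in_Mor)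
qed

lemma Add_Zero [simp]: "Dom T f = X \<Longrightarrow> Cod T f = Y \<Longrightarrow> Add T f (Zero T X Y) = f"
  and Zero_Add [simp]: "Dom T f = X \<Longrightarrow> Cod T f = Y \<Longrightarrow> Add T (Zero T X Y) f = f"
proof -
  assume *: "Dom T f = X" "Cod T f = Y"
  interpret comm_group "Hom T X Y" by (rule comm_group_Hom)
  show "Add T f (Zero T X Y) = f" using r_one[of f] * by (simp add: Hom_def in_Mor)
  show "Add T (Zero T X Y) f = f" using l_one[of f] * by (simp add: Hom_def in_Mor)
qed

lemma Dom_neg [simp]: "Dom T (neg T f) = Dom T f"
  and Cod_neg [simp]: "Cod T (neg T f) = Cod T f"
  and Add_neg [simp]: "Dom T f = X \<Longrightarrow> Cod T f = Y \<Longrightarrow> Add T f (neg T f) = Zero T X Y"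
  and neg_Add: "Add T (neg T f) f = Zero T (Dom T f) (Cod T f)"
  and neg_neg [simp]: "neg T (neg T f) = f"
proof -
  interpret comm_group "Hom T (Dom T f) (Cod T f)" by (rule comm_group_Hom)
  have f: "f \<in> carrier (Hom T (Dom T f) (Cod T f))" by (simp add: Hom_def in_Mor)
  have "neg T f \<in> Mor T (Dom T f) (Cod T f)"
    using inv_closed[OF f] by (simp add: neg_def) (simp add: Hom_def)
  then show d: "Dom T (neg T f) = Dom T f" "Cod T (neg T f) = Cod T f" by (simp_all add: in_Mor)
  show "neg T (neg T f) = f"
    using inv_inv[OF f] d by (simp add: neg_def)
  show "Add T f (neg T f) = Zero T X Y" if "Dom T f = X" "Cod T f = Y"
    using r_inv[OF f] that unfolding neg_def by (simp add: Hom_def)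
  show "Add T (neg T f) f = Zero T (Dom T f) (Cod T f)"
    using l_inv[OF f] unfolding neg_def by (simp add: Hom_def)
qed

lemma Add_left_cancel:
  assumes "Add T f g = Add T f h" "Dom T f = Dom T g" "Cod T f = Cod T g" "Dom T f = Dom T h" "Cod T f = Cod T h"
  shows "g = h"
proof -
  interpret comm_group "Hom T (Dom T f) (Cod T f)" by (rule comm_group_Hom)
  have "f \<in> Units (Hom T (Dom T f) (Cod T f))" by (simp only: Units_eq) (simp add: Hom_def in_Mor)
  then show ?thesis using Units_l_cancel[of f g h] assms by (simp add: Hom_def in_Mor)
qed

lemma sub_eq_Zero:
  assumes "sub f g = Zero T X Y" "Dom T f = X" "Cod T f = Y" "Dom T g = X" "Cod T g = Y"
  shows "f = g"
proof -
  have "Add T (neg T g) f = Add T (neg T g) g"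
    using assms by (simp add: Add_commute[of "neg T g" f] neg_Add)
  then show ?thesis by (rule Add_left_cancel) (use assms in auto)
qed

lemma sub_eq_iff:
  assumes "Dom T f = Dom T g" "Cod T f = Cod T g" "Dom T k = Dom T g" "Cod T k = Cod T g"
  shows "sub f g = k \<longleftrightarrow> f = Add T k g"
proof -
  have "Add T (sub f g) g = f" using assms by (simp add: Add_assoc neg_Add)
  moreover have "sub (Add T k g) g = k" using assms by (simp add: Add_assoc)
  ultimately show ?thesis by auto
qed

lemma sub_sub:
  assumes "Dom T f = Dom T g" "Cod T f = Cod T g"
  shows "sub f (sub f g) = g"
  using assms sub_eq_iff[of f g "sub f g"] by (subst sub_eq_iff) (auto simp: Add_commute[of g])

lemma neg_unique:
  assumes "Add T f g = Zero T X Y" "Dom T f = X" "Cod T f = Y" "Dom T g = X" "Cod T g = Y"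
  shows "g = neg T f"
  by (rule Add_left_cancel[of f]) (use assms in auto)

lemma Comp_Add: 
  assumes "Dom T f = Dom T f'" "Cod T f = Cod T f'" "Cod T f = Dom T g"
  shows "g \<bullet> Add T f f' = Add T (g \<bullet> f) (g \<bullet> f')"
  using Comp_Add_right[of f "Dom T f" "Cod T f" f' g "Cod T g"] assms by (simp add: in_Mor)

lemma Add_Comp: 
  assumes "Dom T g = Dom T g'" "Cod T g = Cod T g'" "Cod T f = Dom T g"
  shows "Add T g g' \<bullet> f = Add T (g \<bullet> f) (g' \<bullet> f)"
  using Comp_Add_left[of f "Dom T f" "Cod T f" g "Cod T g" g'] assms by (simp add: in_Mor)

lemma Add_self_eq:
  assumes "Add T f f = f" shows "f = Zero T (Dom T f) (Cod T f)"
  by (rule Add_left_cancel[of f]) (use assms in auto)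

lemma Comp_Zero [simp]: "Dom T g = Y \<Longrightarrow> g \<bullet> Zero T X Y = Zero T X (Cod T g)"
  using Add_self_eq[of "g \<bullet> Zero T X Y"] Comp_Add[of "Zero T X Y" "Zero T X Y" g] by simp

lemma Zero_Comp [simp]: "Cod T f = X \<Longrightarrow> Zero T X Y \<bullet> f = Zero T (Dom T f) Y"
  using Add_self_eq[of "Zero T X Y \<bullet> f"] Add_Comp[of "Zero T X Y" "Zero T X Y" f] by simp

lemma Comp_neg [simp]: "Cod T f = Dom T g \<Longrightarrow> g \<bullet> neg T f = neg T (g \<bullet> f)"
  using Comp_Add[of f "neg T f" g] by (intro neg_unique) auto

lemma neg_Comp [simp]: "Cod T f = Dom T g \<Longrightarrow> neg T g \<bullet> f = neg T (g \<bullet> f)"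
  using Add_Comp[of g "neg T g" f] by (intro neg_unique) auto

lemma neg_Zero [simp]: "neg T (Zero T X Y) = Zero T X Y"
  by (rule neg_unique[symmetric]) auto

lemma neg_eq_Zero: "neg T f = Zero T X Y \<longleftrightarrow> f = Zero T X Y"
  by (metis neg_neg neg_Zero)

lemma Mor_eq_Zero_iff: "Mor T X Y = {Zero T X Y} \<longleftrightarrow> (\<forall>f \<in> Mor T X Y. f = Zero T X Y)"
  by (auto simp: in_Mor)

lemma zero_object_to: "zero_object T Z \<Longrightarrow> Cod T f = Z \<Longrightarrow> f = Zero T (Dom T f) Z"
  unfolding zero_object_def in_Mor by (metis Dom_Zero Cod_Zero)

lemma zero_object_from: "zero_object T Z \<Longrightarrow> Dom T f = Z \<Longrightarrow> f = Zero T Z (Cod T f)"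
  unfolding zero_object_def in_Mor by (metis Dom_Zero Cod_Zero)

lemma zero_objectI:
  assumes "Ident T Z = Zero T Z Z" shows "zero_object T Z"
proof -
  have 1: "f = Zero T Z (Cod T f)" if "Dom T f = Z" for f
    using assms Comp_Ident[OF that] that Comp_Zero[OF that, of Z] by simp
  have 2: "f = Zero T (Dom T f) Z" if "Cod T f = Z" for f
    using assms Ident_Comp[OF that] that Zero_Comp[OF that, of Z] by simp
  show ?thesis unfolding zero_object_def in_Mor using 1 2 by (metis Dom_Zero Cod_Zero)
qed

text \<open>\<open>Smd\<close> asks for a complementary summand; \<open>retract_biproduct\<close>
  produces one from the cone of the section, so no complement has to be carried along.\<close>

definition retract :: "'o \<Rightarrow> 'o \<Rightarrow> bool" where
  "retract X B \<longleftrightarrow> (\<exists>i\<in>Mor T X B. \<exists>p\<in>Mor T B X. p \<bullet> i = Ident T X)"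

lemma retractI:
  "\<lbrakk>Dom T i = X; Cod T i = B; Dom T p = B; Cod T p = X; p \<bullet> i = Ident T X\<rbrakk> \<Longrightarrow> retract X B"
  unfolding retract_def in_Mor Bex_def by blast

lemma retractE:
  assumes "retract X B"
  obtains i p where "Dom T i = X" "Cod T i = B" "Dom T p = B" "Cod T p = X" "p \<bullet> i = Ident T X"
  using assms by (auto simp: retract_def in_Mor)

lemma retract_refl: "retract X X"
  by (rule retractI[of "Ident T X" _ _ "Ident T X"]) auto

lemma retract_trans:
  assumes "retract X Y" "retract Y Z" shows "retract X Z"
proof -
  obtain i p where 1: "Dom T i = X" "Cod T i = Y" "Dom T p = Y" "Cod T p = X" "p \<bullet> i = Ident T X"
    using assms(1) by (rule retractE)
  obtain j q where 2: "Dom T j = Y" "Cod T j = Z" "Dom T q = Z" "Cod T q = Y" "q \<bullet> j = Ident T Y"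
    using assms(2) by (rule retractE)
  show ?thesis using 1 2 by (intro retractI[of "j \<bullet> i" _ _ "p \<bullet> q"]) (auto simp: assoc assoc_eq[OF 2(5)])
qed

lemma isomorphicE:
  assumes "isomorphic T X Y"
  obtains f g where "Dom T f = X" "Cod T f = Y" "Dom T g = Y" "Cod T g = X"
    "g \<bullet> f = Ident T X" "f \<bullet> g = Ident T Y"
  using assms by (auto simp: isomorphic_def iso_arrow_def in_Mor)

lemma isomorphic_retract: "isomorphic T X Y \<Longrightarrow> retract Y X"
  by (auto elim!: isomorphicE intro: retractI)

lemma iso_arrowI:
  "\<lbrakk>Dom T g = Cod T f; Cod T g = Dom T f; g \<bullet> f = Ident T (Dom T f); f \<bullet> g = Ident T (Cod T f)\<rbrakk>
    \<Longrightarrow> iso_arrow T f"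
  by (auto simp: iso_arrow_def in_Mor)

lemma iso_arrow_Ident: "iso_arrow T (Ident T X)"
  by (rule iso_arrowI[of "Ident T X"]) auto

lemma iso_arrow_linv_rinv:
  assumes "Dom T g = Cod T f" "Cod T g = Dom T f" "g \<bullet> f = Ident T (Dom T f)"
    "Dom T g' = Cod T f" "Cod T g' = Dom T f" "f \<bullet> g' = Ident T (Cod T f)"
  shows "iso_arrow T f"
proof -
  have "(g \<bullet> f) \<bullet> g' = g \<bullet> (f \<bullet> g')" using assms by (intro assoc) auto
  then have "g' = g" using assms by simp
  then show ?thesis using assms by (intro iso_arrowI[of g]) auto
qed

end

section \<open>Triangulated categories\<close>

context triangulated_category
begin

abbreviation S :: "'o \<Rightarrow> 'o" where "S \<equiv> SuspO T"
abbreviation SM :: "'m \<Rightarrow> 'm" where "SM \<equiv> SuspM T"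

lemma Dom_SM [simp]: "Dom T (SM f) = S (Dom T f)" and Cod_SM [simp]: "Cod T (SM f) = S (Cod T f)"
  using SuspM_in_Mor[of f "Dom T f" "Cod T f"] by (simp_all add: in_Mor)

lemma SM_Ident [simp]: "SM (Ident T X) = Ident T (S X)"
  by (rule SuspM_Id)

lemma SM_Comp [simp]: "Cod T f = Dom T g \<Longrightarrow> SM (g \<bullet> f) = SM g \<bullet> SM f"
  by (rule SuspM_Comp[of f "Dom T f" "Cod T f" g "Cod T g"]) (auto simp: in_Mor)

lemma SM_Add: "Dom T f = Dom T g \<Longrightarrow> Cod T f = Cod T g \<Longrightarrow> SM (Add T f g) = Add T (SM f) (SM g)"
  by (rule SuspM_Add[of f "Dom T f" "Cod T f" g]) (auto simp: in_Mor)

lemma SM_Zero [simp]: "SM (Zero T X Y) = Zero T (S X) (S Y)"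
  using Add_self_eq[of "SM (Zero T X Y)"] SM_Add[of "Zero T X Y" "Zero T X Y"] by simp

lemma SM_neg [simp]: "SM (neg T f) = neg T (SM f)"
  using SM_Add[of f "neg T f"] by (intro neg_unique) auto

lemma SM_eq_iff [simp]: "SM f = SM g \<longleftrightarrow> f = g"
  using bij_SuspM by (auto simp: bij_def inj_def)

lemma S_eq_iff [simp]: "S X = S Y \<longleftrightarrow> X = Y"
  using bij_SuspO by (auto simp: bij_def inj_def)

lemma SM_cases:
  obtains f' where "f = SM f'" 
  using bij_SuspM by (auto simp: bij_def surj_def)

lemma S_cases:
  obtains X' where "X = S X'" 
  using bij_SuspO by (auto simp: bij_def surj_def)

lemma SM_eq_Zero_iff: "SM f = Zero T (S X) (S Y) \<longleftrightarrow> f = Zero T X Y"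
  by (metis SM_Zero SM_eq_iff)

subsection \<open>Shifts\<close>

lemma shift_0 [simp]: "shift T 0 X = X"
  by (simp add: shift_def)

lemma shift_1 [simp]: "shift T 1 X = S X"
  by (simp add: shift_def)

lemma S_shift: "S (shift T n X) = shift T (n + 1) X"
proof (cases "0 \<le> n")
  case True
  then have "nat (n + 1) = Suc (nat n)" by simp
  then show ?thesis using True by (simp add: shift_def)
next
  case False
  then have "nat (- n) = Suc (nat (- (n + 1)))" by simp
  then have "shift T n X = inv_into UNIV S (shift T (n + 1) X)"
    using False by (cases "n = -1") (simp_all add: shift_def)
  then show ?thesis using bij_SuspO by (simp add: bij_def surj_f_inv_f)
qed

lemma shift_Suc_cancel:
  assumes "S X = shift T (n + 1) Y" shows "X = shift T n Y"
  using assms S_shift[of n Y] by (metis S_eq_iff)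

lemma shift_shift [simp]: "shift T m (shift T n X) = shift T (m + n) X"
proof (induction m rule: int_induct[where k = 0])
  case base show ?case by simp
next
  case (step1 i)
  then show ?case by (metis S_shift add.commute add.left_commute)
next
  case (step2 i)
  have "S (shift T (i - 1) (shift T n X)) = shift T (i - 1 + n + 1) X"
    using step2 S_shift[of "i - 1" "shift T n X"] by (simp add: algebra_simps)
  then show ?case by (metis shift_Suc_cancel)
qed

lemma shift_S [simp]: "shift T n (S X) = shift T (n + 1) X"
  using shift_shift[of n 1 X] by simp

text \<open>Integer induction in both directions passes from \<Sigma> to all its powers. Three slots
  suffice for triangles; predicates of fewer objects ignore the rest.\<close>

lemma shift_invariant:
  assumes "\<And>X Y Z. P (S X) (S Y) (S Z) \<longleftrightarrow> P X Y Z"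
  shows "P (shift T n X) (shift T n Y) (shift T n Z) \<longleftrightarrow> P X Y Z"
proof (induction n rule: int_induct[where k = 0])
  case base show ?case by simp
next
  case (step1 i)
  then show ?case using assms[of "shift T i X" "shift T i Y" "shift T i Z"] by (simp add: S_shift)
next
  case (step2 i)
  then show ?case
    using assms[of "shift T (i - 1) X" "shift T (i - 1) Y" "shift T (i - 1) Z"] by (simp add: S_shift)
qed

section \<open>Orthogonality\<close>

definition orth :: "'o \<Rightarrow> 'o \<Rightarrow> bool" where
  "orth X Y \<longleftrightarrow> (\<forall>f. Dom T f = X \<and> Cod T f = Y \<longrightarrow> f = Zero T X Y)"

lemma orth_iff: "orth X Y \<longleftrightarrow> Mor T X Y = {Zero T X Y}"
  by (auto simp: orth_def Mor_eq_Zero_iff in_Mor)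

lemma orthD: "orth X Y \<Longrightarrow> Dom T f = X \<Longrightarrow> Cod T f = Y \<Longrightarrow> f = Zero T X Y"
  by (simp add: orth_def)

lemma orth_S: "orth (S X) (S Y) \<longleftrightarrow> orth X Y"
proof
  assume *: "orth X Y"
  have "f = Zero T (S X) (S Y)" if "Dom T f = S X" "Cod T f = S Y" for f
  proof -
    obtain f' where f': "f = SM f'" by (rule SM_cases)
    with that have "Dom T f' = X" "Cod T f' = Y" by auto
    then show ?thesis using orthD[OF *] f' by (metis SM_Zero)
  qed
  then show "orth (S X) (S Y)" by (auto simp: orth_def)
next
  assume "orth (S X) (S Y)"
  then have "f = Zero T X Y" if "Dom T f = X" "Cod T f = Y" for f
    using that orthD[of "S X" "S Y" "SM f"] by (simp add: SM_eq_Zero_iff)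
  then show "orth X Y" by (auto simp: orth_def)
qed

lemma orth_shift: "orth (shift T n X) (shift T n Y) \<longleftrightarrow> orth X Y"
  by (rule shift_invariant[of "\<lambda>X Y _. orth X Y"]) (rule orth_S)

lemma orth_shift_left: "orth (shift T n X) Y \<longleftrightarrow> orth X (shift T (- n) Y)"
  using orth_shift[of n X "shift T (- n) Y"] by simp

lemma orth_retract_left:
  assumes "retract X X'" "orth X' Y" shows "orth X Y"
  unfolding orth_def
proof (intro allI impI, elim conjE)
  fix f assume f: "Dom T f = X" "Cod T f = Y"
  obtain i p where 1: "Dom T i = X" "Cod T i = X'" "Dom T p = X'" "Cod T p = X" "p \<bullet> i = Ident T X"
    using assms(1) by (rule retractE)
  have "f = (f \<bullet> p) \<bullet> i" using 1 f by (simp add: assoc)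
  also have "f \<bullet> p = Zero T X' Y" using orthD[OF assms(2)] 1 f by simp
  finally show "f = Zero T X Y" using 1 f by simp
qed

lemma orth_retract_right:
  assumes "retract Y Y'" "orth X Y'" shows "orth X Y"
  unfolding orth_def
proof (intro allI impI, elim conjE)
  fix f assume f: "Dom T f = X" "Cod T f = Y"
  obtain i p where 1: "Dom T i = Y" "Cod T i = Y'" "Dom T p = Y'" "Cod T p = Y" "p \<bullet> i = Ident T Y"
    using assms(1) by (rule retractE)
  have "f = p \<bullet> (i \<bullet> f)" using 1 f by (simp add: assoc_eq[OF 1(5)])
  also have "i \<bullet> f = Zero T X Y'" using orthD[OF assms(2)] 1 f by simp
  finally show "f = Zero T X Y" using 1 f by simp
qed

lemma zero_object_S: "zero_object T Z \<Longrightarrow> zero_object T (S Z)"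
  using zero_object_to[of Z "Ident T Z"] SM_Ident[of Z] by (intro zero_objectI) simp

subsection \<open>Exactness\<close>

definition tri :: "'o \<Rightarrow> 'o \<Rightarrow> 'o \<Rightarrow> 'm \<Rightarrow> 'm \<Rightarrow> 'm \<Rightarrow> bool" where
  "tri X Y Z f g h \<longleftrightarrow> Dom T f = X \<and> Cod T f = Y \<and> Dom T g = Y \<and> Cod T g = Z \<and>
     Dom T h = Z \<and> Cod T h = S X \<and> (f, g, h) \<in> Tri T"

lemma triangle_iff_tri: "triangle T X Y Z \<longleftrightarrow> (\<exists>f g h. tri X Y Z f g h)"
  by (simp add: triangle_def tri_def Bex_def in_Mor)

lemma tri_types:
  assumes "tri X Y Z f g h"
  shows "Dom T f = X" "Cod T f = Y" "Dom T g = Y" "Cod T g = Z" "Dom T h = Z" "Cod T h = S X"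
  using assms by (auto simp: tri_def)

lemma tri_rotate_iff:
  assumes "Dom T f = X" "Cod T f = Y" "Dom T g = Y" "Cod T g = Z" "Dom T h = Z" "Cod T h = S X"
  shows "tri X Y Z f g h \<longleftrightarrow> tri Y Z (S X) g h (neg T (SM f))"
  using Tri_rotate[of f X Y g Z h] assms by (auto simp: tri_def in_Mor)

lemma tri_rotate:
  assumes "tri X Y Z f g h" shows "tri Y Z (S X) g h (neg T (SM f))"
  using assms tri_rotate_iff tri_types[OF assms] by blast

text \<open>Bijectivity of \<Sigma> on arrows desuspends the last arrow, the sign being absorbed
  into \<open>h'\<close>. As every object is a suspension, any triangle can be rotated back.\<close>

lemma tri_rotate_back:
  assumes "tri X Y (S Z) f g h"
  obtains h' where "tri Z X Y h' f g" "h = neg T (SM h')"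
proof -
  note t = tri_types[OF assms]
  obtain k where k: "neg T h = SM k" by (rule SM_cases)
  have "Dom T (neg T h) = S (Dom T k)" "Cod T (neg T h) = S (Cod T k)"
    unfolding k by simp_all
  then have k': "Dom T k = Z" "Cod T k = X" using t by simp_all
  moreover have "h = neg T (SM k)" using k by (metis neg_neg)
  moreover have "tri Z X Y k f g"
    using assms t k' calculation by (subst tri_rotate_iff) auto
  ultimately show ?thesis using that by blast
qed

lemma tri_cone: obtains Z g h where "tri (Dom T f) (Cod T f) Z f g h"
proof -
  obtain g h where *: "(f, g, h) \<in> Tri T" using Tri_ex by blast
  from Tri_typed[OF this] have "tri (Dom T f) (Cod T f) (Cod T g) f g h"
    using * by (simp add: tri_def)
  then show ?thesis using that by blast
qed

lemma tri_fibre: obtains F e h where "tri F (Dom T f) (Cod T f) e f h"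
proof -
  obtain Z g h where *: "tri (Dom T f) (Cod T f) Z f g h" by (rule tri_cone)
  obtain F where "Z = S F" by (rule S_cases)
  then show ?thesis using * that by (metis tri_rotate_back)
qed

lemma tri_Ident: "zero_object T Z \<Longrightarrow> tri X X Z (Ident T X) (Zero T X Z) (Zero T Z (S X))"
  using Tri_Id[of Z X] by (simp add: tri_def)

lemma tri_Ident': "zero_object T Z \<Longrightarrow> tri Z X X (Zero T Z X) (Ident T X) (Zero T X (S Z))"
  using tri_Ident[OF zero_object_S, of Z X] 
  by (subst tri_rotate_iff) (auto simp: SM_Zero dest: zero_object_S zero_object_from)

lemma tri_fill:
  assumes "tri X Y Z f g h" "tri X' Y' Z' f' g' h'"
    and "Dom T a = X" "Cod T a = X'" "Dom T b = Y" "Cod T b = Y'" "f' \<bullet> a = b \<bullet> f"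
  obtains c where "Dom T c = Z" "Cod T c = Z'" "g' \<bullet> b = c \<bullet> g" "h' \<bullet> c = SM a \<bullet> h"
proof -
  have "\<exists>c\<in>Mor T Z Z'. g' \<bullet> b = c \<bullet> g \<and> h' \<bullet> c = SM a \<bullet> h"
    by (rule Tri_fill[of f g h X Y Z f' g' h' X' Y' Z' a b])
      (use assms in \<open>simp_all add: tri_def in_Mor\<close>)
  then show ?thesis using that by (auto simp: in_Mor)
qed

text \<open>Exactness of Hom(W, -). Fillers exist only in the third place, so both W = W
  \<rightarrow> 0 and the given triangle are rotated first; the filler is then \<Sigma>v, and the
  two signs cancel.\<close>

lemma tri_lift:
  assumes "tri X Y Z f g h" "Dom T u = W" "Cod T u = Y" "g \<bullet> u = Zero T W Z"
  shows "\<exists>v. Dom T v = W \<and> Cod T v = X \<and> u = f \<bullet> v"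
proof -
  note t = tri_types[OF assms(1)]
  obtain N where N: "zero_object T N" using ex_zero_object by blast
  note 1 = tri_rotate[OF tri_Ident[OF N, of W]] and 2 = tri_rotate[OF assms(1)]
  have "Zero T N Z \<bullet> Zero T W N = g \<bullet> u" using assms by simp
  then obtain c where c: "Dom T c = S W" "Cod T c = S X" "neg T (SM f) \<bullet> c = SM u \<bullet> neg T (SM (Ident T W))"
    using tri_fill[OF 1 2, of u "Zero T N Z"] assms t by (metis Dom_Zero Cod_Zero)
  obtain v where v: "c = SM v" by (rule SM_cases)
  have "Dom T v = W" "Cod T v = X" using c(1,2) v by auto
  moreover have "neg T (SM (f \<bullet> v)) = neg T (SM u)" using c(3) v calculation t assms(2) by simp
  then have "SM (f \<bullet> v) = SM u" by (metis neg_neg)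
  ultimately show ?thesis by (metis SM_eq_iff)
qed

text \<open>The dual exactness, read off from a filler into 0 \<rightarrow> W = W.\<close>

lemma tri_extend:
  assumes "tri X Y Z f g h" "Dom T u = Y" "Cod T u = W" "u \<bullet> f = Zero T X W"
  shows "\<exists>v. Dom T v = Z \<and> Cod T v = W \<and> u = v \<bullet> g"
proof -
  note t = tri_types[OF assms(1)]
  obtain N where N: "zero_object T N" using ex_zero_object by blast
  show ?thesis
    using tri_fill[OF assms(1) tri_Ident'[OF N, of W], of "Zero T X N" u] assms t by simp metis
qed

lemma tri_comp:
  assumes "tri X Y Z f g h" shows "g \<bullet> f = Zero T X Z"
proof -
  note t = tri_types[OF assms(1)]
  obtain N where N: "zero_object T N" using ex_zero_object by blast
  show ?thesis
    by (rule tri_fill[OF tri_Ident[OF N, of X] assms, of "Ident T X" f]) (use t in auto)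
qed

lemma tri_comp2: assumes "tri X Y Z f g h" shows "h \<bullet> g = Zero T Y (S X)"
  using tri_comp[OF tri_rotate[OF assms]] .

lemma tri_comp3: assumes "tri X Y Z f g h" shows "SM f \<bullet> h = Zero T Z (S Y)"
  using tri_comp[OF tri_rotate[OF tri_rotate[OF assms]]] tri_types[OF assms] by (simp add: neg_eq_Zero)

lemma tri_lift2:
  assumes "tri X Y Z f g h" "Dom T u = W" "Cod T u = Z" "h \<bullet> u = Zero T W (S X)"
  shows "\<exists>v. Dom T v = W \<and> Cod T v = Y \<and> u = g \<bullet> v"
  by (rule tri_lift[OF tri_rotate[OF assms(1)] assms(2-)])

lemma tri_lift3:
  assumes "tri X Y Z f g h" "Dom T u = W" "Cod T u = S X" "SM f \<bullet> u = Zero T W (S Y)"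
  shows "\<exists>v. Dom T v = W \<and> Cod T v = Z \<and> u = h \<bullet> v"
  by (rule tri_lift[OF tri_rotate[OF tri_rotate[OF assms(1)]] assms(2,3)])
    (use assms tri_types[OF assms(1)] in simp)

lemma tri_extend2:
  assumes "tri X Y Z f g h" "Dom T u = Z" "Cod T u = W" "u \<bullet> g = Zero T Y W"
  shows "\<exists>v. Dom T v = S X \<and> Cod T v = W \<and> u = v \<bullet> h"
  by (rule tri_extend[OF tri_rotate[OF assms(1)] assms(2-)])

lemma tri_extend3:
  assumes "tri X Y Z f g h" "Dom T u = S X" "Cod T u = W" "u \<bullet> h = Zero T Z W"
  shows "\<exists>v. Dom T v = S Y \<and> Cod T v = W \<and> u = v \<bullet> SM f"
proof -
  note t = tri_types[OF assms(1)]
  obtain v where "Dom T v = S Y" "Cod T v = W" "u = v \<bullet> neg T (SM f)"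
    using tri_extend[OF tri_rotate[OF tri_rotate[OF assms(1)]] assms(2-)] by blast
  then have "u = neg T v \<bullet> SM f" "Dom T (neg T v) = S Y" "Cod T (neg T v) = W" using t by auto
  then show ?thesis by blast
qed

lemma triangle_S: "triangle T (S X) (S Y) (S Z) \<longleftrightarrow> triangle T X Y Z"
proof
  assume "triangle T X Y Z"
  then obtain f g h where "tri X Y Z f g h" by (auto simp: triangle_iff_tri)
  from tri_rotate[OF tri_rotate[OF tri_rotate[OF this]]] show "triangle T (S X) (S Y) (S Z)"
    by (auto simp: triangle_iff_tri)
next
  assume "triangle T (S X) (S Y) (S Z)"
  then obtain f g h where "tri (S X) (S Y) (S Z) f g h" by (auto simp: triangle_iff_tri)
  then show "triangle T X Y Z" unfolding triangle_iff_tri by (metis tri_rotate_back)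
qed

lemma triangle_shift: "triangle T (shift T n X) (shift T n Y) (shift T n Z) \<longleftrightarrow> triangle T X Y Z"
  by (rule shift_invariant) (rule triangle_S)

lemma triangle_rotate: "triangle T X Y Z \<Longrightarrow> triangle T Y Z (S X)"
  by (auto simp: triangle_iff_tri dest: tri_rotate)

lemma triangle_Ident: "zero_object T Z \<Longrightarrow> triangle T X X Z"
  by (auto simp: triangle_iff_tri dest: tri_Ident)

lemma triangle_Ident': "zero_object T Z \<Longrightarrow> triangle T Z X X"
  by (auto simp: triangle_iff_tri dest: tri_Ident')

section \<open>The octahedral axiom and fibres\<close>

lemma octahedral:
  assumes 1: "tri X Y U f f1 f2" and 2: "tri Y Z W g g1 g2" and 3: "tri X Z V k k1 k2"
    and k: "k = g \<bullet> f"
  shows "triangle T U V W"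
proof -
  have "\<exists>u\<in>Mor T U V. \<exists>v\<in>Mor T V W. (u, v, SM f1 \<bullet> g2) \<in> Tri T \<and>
              u \<bullet> f1 = k1 \<bullet> g \<and> k2 \<bullet> u = f2 \<and> v \<bullet> k1 = g1 \<and> g2 \<bullet> v = SM f \<bullet> k2"
    by (rule Tri_octahedral[of f X Y g Z f1 f2 U g1 g2 W k1 k2 V]) (use assms in \<open>auto simp: tri_def in_Mor\<close>)
  then obtain u v where "u \<in> Mor T U V" "v \<in> Mor T V W" "(u, v, SM f1 \<bullet> g2) \<in> Tri T" by blast
  moreover have "SM f1 \<bullet> g2 \<in> Mor T W (S U)" using tri_types[OF 1] tri_types[OF 2] by (auto simp: in_Mor)
  ultimately show ?thesis unfolding triangle_def by blast
qed

text \<open>A relation rather than a function, as the fibre of \<open>f\<close> is determined only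
  up to a noncanonical isomorphism.\<close>

definition fib :: "'o \<Rightarrow> 'm \<Rightarrow> bool" where
  "fib F f \<longleftrightarrow> (\<exists>e h. tri F (Dom T f) (Cod T f) e f h)"

lemma fib_ex: obtains F where "fib F f"
  by (metis tri_fibre fib_def)

lemma triangle_iff_fib: "triangle T F X Y \<longleftrightarrow> (\<exists>f. fib F f \<and> Dom T f = X \<and> Cod T f = Y)"
  unfolding triangle_iff_tri fib_def by (metis tri_types(3,4))

text \<open>The octahedral axiom speaks of cones. In the triangles rotated once, the cones are the
  suspended fibres, so the claim appears after desuspension.\<close>

lemma fib_Comp:
  assumes "fib F f" "fib E g" "Cod T f = Dom T g"
  obtains F' where "fib F' (g \<bullet> f)" "triangle T F F' E"
proof -
  obtain a b where 1: "tri F (Dom T f) (Cod T f) a f b" using assms by (auto simp: fib_def)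
  obtain c d where 2: "tri E (Dom T g) (Cod T g) c g d" using assms by (auto simp: fib_def)
  obtain F' p q where 3: "tri F' (Dom T (g \<bullet> f)) (Cod T (g \<bullet> f)) p (g \<bullet> f) q" by (rule tri_fibre)
  have "triangle T (S F) (S F') (S E)"
    using octahedral[OF tri_rotate[OF 1] _ _ refl] tri_rotate[OF 2] tri_rotate[OF 3] assms(3) by simp
  then show ?thesis using 3 that unfolding triangle_S fib_def by blast
qed

text \<open>Together with \<open>triangle_assoc'\<close> this is the associativity of
  \<open>star\<close>: here X \<rightarrow> V \<rightarrow> C are composed and fibres compared,
  there A \<rightarrow> Y \<rightarrow> X are composed and cones compared.\<close>

lemma triangle_assoc:
  assumes "triangle T A X V" "triangle T B V C"
  obtains Y where "triangle T Y X C" "triangle T A Y B"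
  using assms fib_Comp unfolding triangle_iff_fib by (metis Cod_Comp Dom_Comp)

lemma triangle_assoc':
  assumes "triangle T A Y B" "triangle T Y X C"
  obtains V where "triangle T A X V" "triangle T B V C"
proof -
  obtain f f1 f2 where 1: "tri A Y B f f1 f2" using assms by (auto simp: triangle_iff_tri)
  obtain g g1 g2 where 2: "tri Y X C g g1 g2" using assms by (auto simp: triangle_iff_tri)
  obtain V k1 k2 where "tri (Dom T (g \<bullet> f)) (Cod T (g \<bullet> f)) V (g \<bullet> f) k1 k2" by (rule tri_cone)
  then have 3: "tri A X V (g \<bullet> f) k1 k2" using tri_types[OF 1] tri_types[OF 2] by simp
  from octahedral[OF 1 2 3 refl] 3 show ?thesis using that by (auto simp: triangle_iff_tri)
qed

lemma fib_lift:
  assumes "fib F f" "Dom T u = W" "Cod T u = Dom T f" "f \<bullet> u = Zero T W (Cod T f)"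
  obtains e v where "Dom T e = F" "Cod T e = Dom T f" "Dom T v = W" "Cod T v = F" "u = e \<bullet> v"
proof -
  obtain e h where e: "tri F (Dom T f) (Cod T f) e f h" using assms by (auto simp: fib_def)
  from tri_lift[OF e assms(2-)] tri_types[OF e] show ?thesis using that by blast
qed

lemma fib_extend:
  assumes "fib F f" "Dom T u = Dom T f" "Cod T u = W" "orth F W"
  obtains v where "Dom T v = Cod T f" "Cod T v = W" "u = v \<bullet> f"
proof -
  obtain e h where e: "tri F (Dom T f) (Cod T f) e f h" using assms by (auto simp: fib_def)
  have "u \<bullet> e = Zero T F W" using orthD[OF assms(4), of "u \<bullet> e"] assms tri_types[OF e] by simp
  from tri_extend[OF e assms(2,3) this] show ?thesis using that by blast
qed

lemma fib_Zero_retract: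
  assumes "fib F (Zero T X Y)" shows "retract X F"
proof -
  obtain e v where "Dom T e = F" "Cod T e = X" "Dom T v = X" "Cod T v = F" "Ident T X = e \<bullet> v"
    using fib_lift[OF assms, of "Ident T X" X] by auto
  then show ?thesis by (intro retractI[of v X F e]) auto
qed

text \<open>Since g = 0, the identity of Y lifts along f; since the arrow into X of the rotated
  triangle is zero, the identity of X extends along f.\<close>

lemma tri_zero_iso:
  assumes "tri X Y Z f g h" "zero_object T Z" shows "iso_arrow T f"
proof -
  note t = tri_types[OF assms(1)]
  obtain Z' where Z': "Z = S Z'" by (rule S_cases)
  obtain h' where h': "tri Z' X Y h' f g" using assms(1) unfolding Z' by (rule tri_rotate_back)
  have "h = Zero T Z (S X)" using zero_object_from[OF assms(2), of h] t by simp
  have "zero_object T Z'" 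
    using zero_object_to[OF assms(2), of "Ident T Z"] SM_eq_iff[of "Ident T Z'" "Zero T Z' Z'"]
    by (intro zero_objectI) (simp add: Z')
  then have h'0: "h' = Zero T Z' X" using zero_object_from[of Z' h'] tri_types[OF h'] by simp
  have "\<exists>v. Dom T v = Y \<and> Cod T v = X \<and> Ident T Y = f \<bullet> v"
    by (rule tri_lift[OF assms(1)]) (use t zero_object_to[OF assms(2), of g] in auto)
  then obtain v where v: "Dom T v = Y" "Cod T v = X" "Ident T Y = f \<bullet> v" by blast
  have "\<exists>u. Dom T u = Y \<and> Cod T u = X \<and> Ident T X = u \<bullet> f"
    by (rule tri_extend[OF h']) (use h'0 in auto)
  then obtain u where u: "Dom T u = Y" "Cod T u = X" "Ident T X = u \<bullet> f" by blast
  show ?thesis by (rule iso_arrow_linv_rinv[of u _ v]) (use u v t in auto)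
qed

subsection \<open>Extensions and retracts\<close>

lemma star_assoc: "star T (star T A B) C = star T A (star T B C)"
proof (intro equalityI subsetI)
  fix x assume "x \<in> star T (star T A B) C"
  then obtain a b c y where *: "a \<in> A" "b \<in> B" "c \<in> C" "triangle T a y b" "triangle T y x c"
    unfolding star_def by blast
  from *(4,5) obtain V where "triangle T a x V" "triangle T b V c" by (rule triangle_assoc')
  with * show "x \<in> star T A (star T B C)" unfolding star_def by blast
next
  fix x assume "x \<in> star T A (star T B C)"
  then obtain a b c y where *: "a \<in> A" "b \<in> B" "c \<in> C" "triangle T a x y" "triangle T b y c"
    unfolding star_def by blast
  from *(4,5) obtain V where "triangle T V x c" "triangle T a V b" by (rule triangle_assoc)
  with * show "x \<in> star T (star T A B) C" unfolding star_def by blast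
qed

lemma star_mono: "A \<subseteq> A' \<Longrightarrow> B \<subseteq> B' \<Longrightarrow> star T A B \<subseteq> star T A' B'"
  unfolding star_def by blast

lemma starI: "triangle T a y b \<Longrightarrow> a \<in> A \<Longrightarrow> b \<in> B \<Longrightarrow> y \<in> star T A B"
  unfolding star_def by blast

text \<open>The extension is classified by its connecting arrow h, so Y' is taken as the fibre of h
  transported along q : Z' \<rightarrow> Z and i : X \<rightarrow> X'. Both (i, j) and (p, q)
  respect the connecting arrows and yield fillers c and d. Their composite need not be the identity,
  but it is invertible.\<close>

lemma triangle_retract:
  assumes "triangle T X Y Z" "retract X X'" "retract Z Z'"
  obtains Y' where "triangle T X' Y' Z'" "retract Y Y'"
proof -
  obtain f g h where 1: "tri X Y Z f g h" using assms by (auto simp: triangle_iff_tri)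
  note t = tri_types[OF 1]
  obtain i p where ip: "Dom T i = X" "Cod T i = X'" "Dom T p = X'" "Cod T p = X" "p \<bullet> i = Ident T X"
    using assms(2) by (rule retractE)
  obtain j q where jq: "Dom T j = Z" "Cod T j = Z'" "Dom T q = Z'" "Cod T q = Z" "q \<bullet> j = Ident T Z"
    using assms(3) by (rule retractE)
  have Y'': "tri Z (S X) (S Y) h (neg T (SM f)) (neg T (SM g))"
    using tri_rotate[OF tri_rotate[OF 1]] by blast
  define h' where "h' = SM i \<bullet> (h \<bullet> q)"
  have h': "Dom T h' = Z'" "Cod T h' = S X'" using ip jq t by (auto simp: h'_def)
  obtain W u v where 2: "tri Z' (S X') W h' u v" using tri_cone[of h'] h' by metis
  obtain Y' where W: "W = S Y'" by (rule S_cases)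
  have Spi: "SM p \<bullet> SM i = Ident T (S X)" using ip by (simp flip: SM_Comp)
  have hj: "h' \<bullet> j = SM i \<bullet> h" using ip jq t by (simp add: h'_def assoc)
  have hq: "h \<bullet> q = SM p \<bullet> h'" using ip jq t by (simp add: h'_def assoc_eq[OF Spi])
  obtain c where c: "Dom T c = S Y" "Cod T c = W" "u \<bullet> SM i = c \<bullet> neg T (SM f)"
      "v \<bullet> c = SM j \<bullet> neg T (SM g)"
    by (rule tri_fill[OF Y'' 2, of j "SM i"]) (use ip jq hj in auto)
  obtain d where d: "Dom T d = W" "Cod T d = S Y" "neg T (SM f) \<bullet> SM p = d \<bullet> u"
      "neg T (SM g) \<bullet> d = SM q \<bullet> v"
    by (rule tri_fill[OF 2 Y'', of q "SM p"]) (use ip jq hq in auto)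
  note t2 = tri_types[OF 2]
  have Sqj: "SM q \<bullet> SM j = Ident T (S Z)" using jq by (simp flip: SM_Comp)
  have ef: "(d \<bullet> c) \<bullet> neg T (SM f) = neg T (SM f)"
  proof -
    have "(d \<bullet> c) \<bullet> neg T (SM f) = d \<bullet> (u \<bullet> SM i)" using c d t ip by (simp add: assoc)
    also have "\<dots> = (neg T (SM f) \<bullet> SM p) \<bullet> SM i" unfolding d(3) using c d t t2 ip by (simp add: assoc)
    also have "\<dots> = neg T (SM f)" using ip t by (simp add: assoc Spi)
    finally show ?thesis .
  qed
  have ge: "neg T (SM g) \<bullet> (d \<bullet> c) = neg T (SM g)"
  proof -
    have "neg T (SM g) \<bullet> (d \<bullet> c) = (neg T (SM g) \<bullet> d) \<bullet> c"
      by (rule assoc[symmetric]) (use c d t in auto)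
    also have "\<dots> = SM q \<bullet> (SM j \<bullet> neg T (SM g))"
      unfolding d(4) c(4)[symmetric] using c d t t2 jq by (simp add: assoc)
    also have "\<dots> = neg T (SM g)" using jq t by (simp add: assoc_eq[OF Sqj])
    finally show ?thesis .
  qed
  \<comment> \<open>\<open>e = d \<bullet> c\<close> is the identity on \<open>X\<close> and on \<open>Z\<close>, so \<open>(e - 1)\<^sup>2 = 0\<close> and \<open>2 - e\<close> is inverse to \<open>e\<close>.\<close>
  define n where "n = sub (d \<bullet> c) (Ident T (S Y))"
  define r where "r = sub (Ident T (S Y)) n"
  have n: "Dom T n = S Y" "Cod T n = S Y" using c d by (auto simp: n_def)
  have "n \<bullet> neg T (SM f) = Zero T (S X) (S Y)"
    using c d t ef unfolding n_def by (simp only: Add_Comp neg_Comp Dom_Comp Cod_Comp Dom_neg Cod_neg Dom_SM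
        Cod_SM Dom_Ident Cod_Ident Ident_Comp Add_neg)
  from tri_extend2[OF Y'' n this] obtain w where w: "Dom T w = S Z" "Cod T w = S Y"
      "n = w \<bullet> neg T (SM g)" by blast
  have "n \<bullet> (d \<bullet> c) = n"
    unfolding w(3) using assoc[of "d \<bullet> c" "neg T (SM g)" w] ge w(1,2) c d t by simp
  then have "r \<bullet> (d \<bullet> c) = sub (d \<bullet> c) (sub (d \<bullet> c) (Ident T (S Y)))"
    using n c d unfolding r_def by (simp add: Add_Comp n_def)
  also have "\<dots> = Ident T (S Y)" using c d by (intro sub_sub) auto
  finally have r: "Dom T r = S Y" "Cod T r = S Y" "r \<bullet> (d \<bullet> c) = Ident T (S Y)"
    using n by (auto simp: r_def)
  obtain c' where c': "c = SM c'" by (rule SM_cases)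
  obtain d' where d': "d = SM d'" by (rule SM_cases)
  obtain r' where r': "r = SM r'" by (rule SM_cases)
  have ty: "Dom T c' = Y" "Cod T c' = Y'" "Dom T d' = Y'" "Cod T d' = Y" "Dom T r' = Y" "Cod T r' = Y"
    using c d r unfolding c' d' r' W by auto
  then have "SM (r' \<bullet> (d' \<bullet> c')) = SM (Ident T Y)" using r(3) unfolding c' d' r' by simp
  then have "r' \<bullet> (d' \<bullet> c') = Ident T Y" by (simp only: SM_eq_iff)
  then have "retract Y Y'" using ty by (intro retractI[of c' _ _ "r' \<bullet> d'"]) (auto simp: assoc)
  moreover have "triangle T X' Y' Z'"
    using 2 unfolding W by (metis tri_rotate_back triangle_iff_tri)
  ultimately show ?thesis using that by blast
qed

text \<open>The complement is the cone of the section i: as \<Sigma>i is a split monomorphism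
  killing h, the connecting arrow h vanishes and g acquires a section.\<close>

lemma retract_biproduct:
  assumes "retract X B" shows "\<exists>Y i j p q. biproduct T X Y B i j p q"
proof -
  obtain i p where ip: "Dom T i = X" "Cod T i = B" "Dom T p = B" "Cod T p = X" "p \<bullet> i = Ident T X"
    using assms by (rule retractE)
  obtain Y g h where 1: "tri X B Y i g h" using tri_cone[of i] ip by metis
  note t = tri_types[OF 1]
  have "SM p \<bullet> SM i = Ident T (S X)" using ip by (simp flip: SM_Comp)
  then have "h = SM p \<bullet> (SM i \<bullet> h)" using assoc_eq[of "SM p" "SM i" _ h] t ip by simp
  then have h0: "h = Zero T Y (S X)" using tri_comp3[OF 1] ip by simp
  have "\<exists>v. Dom T v = Y \<and> Cod T v = B \<and> Ident T Y = g \<bullet> v"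
    by (rule tri_lift2[OF 1]) (auto simp: h0)
  then obtain v where v: "Dom T v = Y" "Cod T v = B" "Ident T Y = g \<bullet> v" by blast
  \<comment> \<open>An arbitrary section v of g is corrected so that p kills it; g is unaffected
    because g i = 0.\<close>
  define j where "j = sub v (i \<bullet> (p \<bullet> v))"
  have j: "Dom T j = Y" "Cod T j = B" using v ip by (auto simp: j_def)
  have pj: "p \<bullet> j = Zero T Y X"
    using v ip by (simp add: j_def Comp_Add assoc_eq[OF ip(5)])
  have gj: "g \<bullet> j = Ident T Y"
    using v ip t by (simp add: j_def Comp_Add assoc_eq[OF tri_comp[OF 1]])
  \<comment> \<open>The defect of the biproduct equation. It kills i, so it factors through g as w,
    and e j = 0 recovers w = 0.\<close>
  define e where "e = sub (sub (Ident T B) (i \<bullet> p)) (j \<bullet> g)"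
  have e: "Dom T e = B" "Cod T e = B" using ip j t by (auto simp: e_def)
  have "e \<bullet> i = Zero T X B" using ip j t tri_comp[OF 1] by (simp add: e_def Add_Comp assoc)
  then have "\<exists>w. Dom T w = Y \<and> Cod T w = B \<and> e = w \<bullet> g"
    by (intro tri_extend[OF 1]) (use e in auto)
  then obtain w where w: "Dom T w = Y" "Cod T w = B" "e = w \<bullet> g" by blast
  have "e \<bullet> j = Zero T Y B" using ip j t pj gj by (simp add: e_def Add_Comp assoc)
  moreover have "e \<bullet> j = w" using w j t gj by (simp add: assoc)
  ultimately have "w = Zero T Y B" by simp
  then have "e = Zero T B B" using w(3) t by simp
  then have "sub (Ident T B) (i \<bullet> p) = j \<bullet> g"
    unfolding e_def by (rule sub_eq_Zero) (use ip j t in auto)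
  then have "Ident T B = Add T (j \<bullet> g) (i \<bullet> p)"
    by (subst (asm) sub_eq_iff) (use ip j t in auto)
  then have "Add T (i \<bullet> p) (j \<bullet> g) = Ident T B" using Add_commute[of "i \<bullet> p" "j \<bullet> g"] ip j t by simp
  then have "biproduct T X Y B i j p g"
    unfolding biproduct_def in_Mor using ip j t pj gj tri_comp[OF 1] by simp
  then show ?thesis by blast
qed

lemma Smd_eq: "Smd T A = {X. \<exists>B\<in>A. retract X B}"
proof (intro equalityI subsetI CollectI)
  fix X assume "X \<in> Smd T A"
  then show "\<exists>B\<in>A. retract X B" unfolding Smd_def biproduct_def retract_def by blast
next
  fix X assume "X \<in> {X. \<exists>B\<in>A. retract X B}"
  then show "X \<in> Smd T A" unfolding Smd_def using retract_biproduct by blast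
qed

lemma SmdI: "retract X B \<Longrightarrow> B \<in> A \<Longrightarrow> X \<in> Smd T A"
  by (auto simp: Smd_eq)

lemma Smd_mono: "A \<subseteq> B \<Longrightarrow> Smd T A \<subseteq> Smd T B"
  by (auto simp: Smd_eq)

lemma Smd_superset: "A \<subseteq> Smd T A"
  by (auto simp: Smd_eq intro: retract_refl)

lemma Smd_Smd: "Smd T (Smd T A) = Smd T A"
  using Smd_superset[of "Smd T A"] by (auto simp: Smd_eq intro: retract_trans)

lemma star_Smd: "star T (Smd T A) (Smd T B) \<subseteq> Smd T (star T A B)"
proof
  fix Y assume "Y \<in> star T (Smd T A) (Smd T B)"
  then obtain X Z X' Z' where *: "triangle T X Y Z" "retract X X'" "retract Z Z'" "X' \<in> A" "Z' \<in> B"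
    unfolding star_def Smd_eq by blast
  then obtain Y' where "triangle T X' Y' Z'" "retract Y Y'" by (rule_tac triangle_retract)
  with * show "Y \<in> Smd T (star T A B)" by (blast intro: SmdI starI)
qed

lemma retract_S: "retract (S X) (S Y) \<longleftrightarrow> retract X Y"
proof
  assume "retract X Y"
  then obtain i p where "Dom T i = X" "Cod T i = Y" "Dom T p = Y" "Cod T p = X" "p \<bullet> i = Ident T X"
    by (rule retractE)
  then show "retract (S X) (S Y)" by (intro retractI[of "SM i" _ _ "SM p"]) (auto simp flip: SM_Comp)
next
  assume "retract (S X) (S Y)"
  then obtain i p where *: "Dom T i = S X" "Cod T i = S Y" "Dom T p = S Y" "Cod T p = S X"
    "p \<bullet> i = Ident T (S X)" by (rule retractE)
  obtain i' where i': "i = SM i'" by (rule SM_cases)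
  obtain p' where p': "p = SM p'" by (rule SM_cases)
  have ty: "Dom T i' = X" "Cod T i' = Y" "Dom T p' = Y" "Cod T p' = X" using * i' p' by auto
  then have "SM (p' \<bullet> i') = SM (Ident T X)" using * i' p' by simp
  then have "p' \<bullet> i' = Ident T X" by (simp only: SM_eq_iff)
  with ty show "retract X Y" by (rule retractI)
qed

lemma retract_shift: "retract (shift T n X) (shift T n Y) \<longleftrightarrow> retract X Y"
  by (rule shift_invariant[of "\<lambda>X Y _. retract X Y"]) (rule retract_S)

lemma triangle_isomorphic:
  assumes "triangle T X Y Z" "isomorphic T X X'" "isomorphic T Y Y'" "isomorphic T Z Z'"
  shows "triangle T X' Y' Z'"
proof -
  obtain f g h where 1: "tri X Y Z f g h" using assms by (auto simp: triangle_iff_tri)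
  note t = tri_types[OF 1]
  obtain a a' where a: "Dom T a = X" "Cod T a = X'" "Dom T a' = X'" "Cod T a' = X"
    "a' \<bullet> a = Ident T X" "a \<bullet> a' = Ident T X'" using assms(2) by (rule isomorphicE)
  obtain b b' where b: "Dom T b = Y" "Cod T b = Y'" "Dom T b' = Y'" "Cod T b' = Y"
    "b' \<bullet> b = Ident T Y" "b \<bullet> b' = Ident T Y'" using assms(3) by (rule isomorphicE)
  obtain c c' where c: "Dom T c = Z" "Cod T c = Z'" "Dom T c' = Z'" "Cod T c' = Z"
    "c' \<bullet> c = Ident T Z" "c \<bullet> c' = Ident T Z'" using assms(4) by (rule isomorphicE)
  have "(b \<bullet> (f \<bullet> a'), c \<bullet> (g \<bullet> b'), SM a \<bullet> (h \<bullet> c')) \<in> Tri T"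
    by (rule Tri_iso[of f g h X Y Z _ X' Y' _ Z' _ a b c])
      (use 1 t a b c in \<open>auto simp: tri_def in_Mor assoc intro: iso_arrowI\<close>)
  then have "tri X' Y' Z' (b \<bullet> (f \<bullet> a')) (c \<bullet> (g \<bullet> b')) (SM a \<bullet> (h \<bullet> c'))"
    unfolding tri_def using t a b c by simp
  then show ?thesis by (auto simp: triangle_iff_tri)
qed

lemma isomorphic_refl: "isomorphic T X X"
  unfolding isomorphic_def in_Mor Bex_def using iso_arrow_Ident by (metis Dom_Ident Cod_Ident)

lemma isomorphic_sym: "isomorphic T X Y \<Longrightarrow> isomorphic T Y X"
  unfolding isomorphic_def iso_arrow_def in_Mor Bex_def by metis

section \<open>Coproducts\<close>

lemma coproduct_types:
  "coproduct T I X C \<iota> \<Longrightarrow> i \<in> I \<Longrightarrow> Dom T (\<iota> i) = X i"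
  "coproduct T I X C \<iota> \<Longrightarrow> i \<in> I \<Longrightarrow> Cod T (\<iota> i) = C"
  by (auto simp: coproduct_def in_Mor)

lemma coproduct_map:
  assumes "coproduct T I X C \<iota>" "\<And>i. i \<in> I \<Longrightarrow> Dom T (f i) = X i" "\<And>i. i \<in> I \<Longrightarrow> Cod T (f i) = Y"
  obtains g where "Dom T g = C" "Cod T g = Y" "\<And>i. i \<in> I \<Longrightarrow> g \<bullet> \<iota> i = f i"
  using assms unfolding coproduct_def in_Mor by (metis (no_types, lifting))

lemma coproduct_eqI:
  assumes "coproduct T I X C \<iota>" "Dom T g = C" "Dom T g' = C" "Cod T g = Cod T g'"
    "\<And>i. i \<in> I \<Longrightarrow> g \<bullet> \<iota> i = g' \<bullet> \<iota> i"
  shows "g = g'"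
proof -
  have ty: "\<forall>i\<in>I. g \<bullet> \<iota> i \<in> Mor T (X i) (Cod T g)"
    using assms(2-4) coproduct_types[OF assms(1)] by (auto simp: in_Mor)
  then have "\<exists>!h. h \<in> Mor T C (Cod T g) \<and> (\<forall>i\<in>I. h \<bullet> \<iota> i = g \<bullet> \<iota> i)"
    using assms(1)[unfolded coproduct_def, THEN conjunct2, THEN spec, of "Cod T g",
        THEN spec, of "\<lambda>i. g \<bullet> \<iota> i"] by blast
  then show ?thesis using assms(2-5) by (metis in_Mor)
qed

lemma coproductI:
  assumes "\<And>i. i \<in> I \<Longrightarrow> Dom T (\<iota> i) = X i" "\<And>i. i \<in> I \<Longrightarrow> Cod T (\<iota> i) = C"
    and "\<And>Y f. (\<And>i. i \<in> I \<Longrightarrow> Dom T (f i) = X i \<and> Cod T (f i) = Y) \<Longrightarrow>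
      \<exists>g. Dom T g = C \<and> Cod T g = Y \<and> (\<forall>i\<in>I. g \<bullet> \<iota> i = f i)"
    and "\<And>g g'. \<lbrakk>Dom T g = C; Dom T g' = C; Cod T g = Cod T g'; \<forall>i\<in>I. g \<bullet> \<iota> i = g' \<bullet> \<iota> i\<rbrakk> \<Longrightarrow> g = g'"
  shows "coproduct T I X C \<iota>"
  unfolding coproduct_def
proof (intro conjI ballI allI impI)
  fix i assume "i \<in> I" then show "\<iota> i \<in> Mor T (X i) C" using assms(1,2) by (simp add: in_Mor)
next
  fix Y f assume *: "\<forall>i\<in>I. f i \<in> Mor T (X i) Y"
  then obtain g where g: "Dom T g = C" "Cod T g = Y" "\<forall>i\<in>I. g \<bullet> \<iota> i = f i"
    using assms(3)[of f Y] by (auto simp: in_Mor)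
  show "\<exists>!g. g \<in> Mor T C Y \<and> (\<forall>i\<in>I. g \<bullet> \<iota> i = f i)"
  proof (rule ex1I[of _ g])
    fix h assume "h \<in> Mor T C Y \<and> (\<forall>i\<in>I. h \<bullet> \<iota> i = f i)"
    then show "h = g" using g by (intro assms(4)) (auto simp: in_Mor)
  qed (use g in \<open>auto simp: in_Mor\<close>)
qed

lemma coproduct_reindex:
  assumes C: "coproduct T I X C \<iota>" and b: "bij_betw \<phi> J I"
  shows "coproduct T J (X \<circ> \<phi>) C (\<iota> \<circ> \<phi>)"
proof (rule coproductI)
  have *: "\<phi> j \<in> I" if "j \<in> J" for j using b that by (auto simp: bij_betw_def)
  show "Dom T ((\<iota> \<circ> \<phi>) j) = (X \<circ> \<phi>) j" "Cod T ((\<iota> \<circ> \<phi>) j) = C" if "j \<in> J" for j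
    using coproduct_types[OF C *[OF that]] by simp_all
  fix Y f assume f: "\<And>j. j \<in> J \<Longrightarrow> Dom T (f j) = (X \<circ> \<phi>) j \<and> Cod T (f j) = Y"
  define f' where "f' i = f (inv_into J \<phi> i)" for i
  have inv: "inv_into J \<phi> i \<in> J" "\<phi> (inv_into J \<phi> i) = i" if "i \<in> I" for i
    using b that by (auto simp: bij_betw_def inv_into_into f_inv_into_f)
  have "Dom T (f' i) = X i" "Cod T (f' i) = Y" if "i \<in> I" for i
    using f inv[OF that] by (auto simp: f'_def)
  then obtain g where g: "Dom T g = C" "Cod T g = Y" "\<And>i. i \<in> I \<Longrightarrow> g \<bullet> \<iota> i = f' i"
    using coproduct_map[OF C, of f' Y] by blast
  have "g \<bullet> (\<iota> \<circ> \<phi>) j = f j" if "j \<in> J" for j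
    using g(3)[OF *[OF that]] b that by (simp add: f'_def bij_betw_def)
  with g show "\<exists>g. Dom T g = C \<and> Cod T g = Y \<and> (\<forall>j\<in>J. g \<bullet> (\<iota> \<circ> \<phi>) j = f j)" by blast
next
  fix g g' assume *: "Dom T g = C" "Dom T g' = C" "Cod T g = Cod T g'" "\<forall>j\<in>J. g \<bullet> (\<iota> \<circ> \<phi>) j = g' \<bullet> (\<iota> \<circ> \<phi>) j"
  show "g = g'"
  proof (rule coproduct_eqI[OF C *(1-3)])
    fix i assume "i \<in> I"
    then obtain j where "j \<in> J" "i = \<phi> j" using b by (auto simp: bij_betw_def)
    then show "g \<bullet> \<iota> i = g' \<bullet> \<iota> i" using * by auto
  qed
qed

lemma coproduct_cong:
  assumes "coproduct T I X C \<iota>" "\<And>i. i \<in> I \<Longrightarrow> X i = X' i" "\<And>i. i \<in> I \<Longrightarrow> \<iota> i = \<iota>' i"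
  shows "coproduct T I X' C \<iota>'"
  using assms unfolding coproduct_def by (simp cong: ball_cong)

lemma coproduct_S:
  "coproduct T I X C \<iota> \<longleftrightarrow> coproduct T I (\<lambda>i. S (X i)) (S C) (\<lambda>i. SM (\<iota> i))"
proof
  assume C: "coproduct T I X C \<iota>"
  show "coproduct T I (\<lambda>i. S (X i)) (S C) (\<lambda>i. SM (\<iota> i))"
  proof (rule coproductI)
    fix Y f assume f: "\<And>i. i \<in> I \<Longrightarrow> Dom T (f i) = S (X i) \<and> Cod T (f i) = Y"
    obtain Y' where Y: "Y = S Y'" by (rule S_cases)
    obtain f' where f': "\<And>i. f i = SM (f' i)" by (meson SM_cases)
    have "Dom T (f' i) = X i" "Cod T (f' i) = Y'" if "i \<in> I" for i
      using f[OF that] by (auto simp: f' Y)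
    then obtain g where g: "Dom T g = C" "Cod T g = Y'" "\<And>i. i \<in> I \<Longrightarrow> g \<bullet> \<iota> i = f' i"
      using coproduct_map[OF C, of f' Y'] by blast
    have "SM g \<bullet> SM (\<iota> i) = f i" if "i \<in> I" for i
      using g that coproduct_types[OF C that] by (simp add: f' flip: SM_Comp)
    then show "\<exists>g. Dom T g = S C \<and> Cod T g = Y \<and> (\<forall>i\<in>I. g \<bullet> SM (\<iota> i) = f i)"
      using g Y by (intro exI[of _ "SM g"]) auto
  next
    fix g g' assume *: "Dom T g = S C" "Dom T g' = S C" "Cod T g = Cod T g'"
      "\<forall>i\<in>I. g \<bullet> SM (\<iota> i) = g' \<bullet> SM (\<iota> i)"
    obtain h h' where h: "g = SM h" "g' = SM h'" by (meson SM_cases)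
    have ty: "Dom T h = C" "Dom T h' = C" "Cod T h = Cod T h'" using * h by auto
    have "h = h'"
    proof (rule coproduct_eqI[OF C ty])
      fix i assume i: "i \<in> I"
      then have "SM (h \<bullet> \<iota> i) = SM (h' \<bullet> \<iota> i)" using * h ty coproduct_types[OF C i] by simp
      then show "h \<bullet> \<iota> i = h' \<bullet> \<iota> i" by (simp only: SM_eq_iff)
    qed
    then show "g = g'" using h by simp
  qed (use coproduct_types[OF C] in auto)
next
  assume C: "coproduct T I (\<lambda>i. S (X i)) (S C) (\<lambda>i. SM (\<iota> i))"
  have t: "Dom T (\<iota> i) = X i" "Cod T (\<iota> i) = C" if "i \<in> I" for i
    using coproduct_types[OF C that] by auto
  show "coproduct T I X C \<iota>"
  proof (rule coproductI)
    fix Y f assume f: "\<And>i. i \<in> I \<Longrightarrow> Dom T (f i) = X i \<and> Cod T (f i) = Y"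
    then obtain g where g: "Dom T g = S C" "Cod T g = S Y" "\<And>i. i \<in> I \<Longrightarrow> g \<bullet> SM (\<iota> i) = SM (f i)"
      using coproduct_map[OF C, of "\<lambda>i. SM (f i)" "S Y"] by auto
    obtain g' where g': "g = SM g'" by (rule SM_cases)
    have ty: "Dom T g' = C" "Cod T g' = Y" using g g' by auto
    have "g' \<bullet> \<iota> i = f i" if "i \<in> I" for i
    proof -
      have "SM (g' \<bullet> \<iota> i) = SM (f i)" using g(3)[OF that] g' ty t[OF that] by simp
      then show ?thesis by (simp only: SM_eq_iff)
    qed
    then show "\<exists>g. Dom T g = C \<and> Cod T g = Y \<and> (\<forall>i\<in>I. g \<bullet> \<iota> i = f i)" using ty by blast
  next
    fix g g' assume *: "Dom T g = C" "Dom T g' = C" "Cod T g = Cod T g'" "\<forall>i\<in>I. g \<bullet> \<iota> i = g' \<bullet> \<iota> i"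
    have "SM g = SM g'"
      by (rule coproduct_eqI[OF C]) (use * t in \<open>auto simp flip: SM_Comp\<close>)
    then show "g = g'" by simp
  qed (use t in auto)
qed

lemma coproduct_transport:
  assumes C: "coproduct T I X C \<iota>" and "isomorphic T C D"
  shows "\<exists>\<kappa>'. coproduct T I X D \<kappa>'"
proof -
  note c = coproduct_types[OF C]
  obtain f g where fg: "Dom T f = C" "Cod T f = D" "Dom T g = D" "Cod T g = C"
    "g \<bullet> f = Ident T C" "f \<bullet> g = Ident T D" using assms(2) by (rule isomorphicE)
  have "coproduct T I X D (\<lambda>i. f \<bullet> \<iota> i)"
  proof (rule coproductI)
    fix Y h assume h: "\<And>i. i \<in> I \<Longrightarrow> Dom T (h i) = X i \<and> Cod T (h i) = Y"
    obtain k where k: "Dom T k = C" "Cod T k = Y" "\<And>i. i \<in> I \<Longrightarrow> k \<bullet> \<iota> i = h i"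
      using coproduct_map[OF C, of h Y] h by blast
    then show "\<exists>k. Dom T k = D \<and> Cod T k = Y \<and> (\<forall>i\<in>I. k \<bullet> (f \<bullet> \<iota> i) = h i)"
      using fg c by (intro exI[of _ "k \<bullet> g"]) (auto simp: assoc assoc_eq[OF fg(5)])
  next
    fix h h' assume *: "Dom T h = D" "Dom T h' = D" "Cod T h = Cod T h'"
      "\<forall>i\<in>I. h \<bullet> (f \<bullet> \<iota> i) = h' \<bullet> (f \<bullet> \<iota> i)"
    have "h \<bullet> f = h' \<bullet> f" by (rule coproduct_eqI[OF C]) (use * fg c in \<open>auto simp: assoc\<close>)
    then have "(h \<bullet> f) \<bullet> g = (h' \<bullet> f) \<bullet> g" by simp
    then show "h = h'" using * fg by (simp add: assoc)
  qed (use fg c in auto)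
  then show ?thesis by blast
qed

lemma coproduct_Sigma:
  assumes C: "coproduct T K Y C \<iota>" and D: "\<And>k. k \<in> K \<Longrightarrow> coproduct T (I k) (X k) (Y k) (\<kappa>' k)"
  shows "coproduct T (Sigma K I) (\<lambda>(k, i). X k i) C (\<lambda>(k, i). \<iota> k \<bullet> \<kappa>' k i)"
proof (rule coproductI)
  note c = coproduct_types[OF C] and d = coproduct_types[OF D]
  fix Z f assume f: "\<And>x. x \<in> Sigma K I \<Longrightarrow> Dom T (f x) = (case x of (k, i) \<Rightarrow> X k i) \<and> Cod T (f x) = Z"
  have "\<exists>g. Dom T g = Y k \<and> Cod T g = Z \<and> (\<forall>i\<in>I k. g \<bullet> \<kappa>' k i = f (k, i))" if "k \<in> K" for k
    using coproduct_map[OF D[OF that], of "\<lambda>i. f (k, i)" Z] f that by (metis (no_types, lifting) SigmaI case_prod_conv)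
  then obtain g where g: "\<And>k. k \<in> K \<Longrightarrow> Dom T (g k) = Y k" "\<And>k. k \<in> K \<Longrightarrow> Cod T (g k) = Z"
    "\<And>k i. k \<in> K \<Longrightarrow> i \<in> I k \<Longrightarrow> g k \<bullet> \<kappa>' k i = f (k, i)" by metis
  obtain h where h: "Dom T h = C" "Cod T h = Z" "\<And>k. k \<in> K \<Longrightarrow> h \<bullet> \<iota> k = g k"
    using coproduct_map[OF C, of g Z] g by blast
  show "\<exists>h. Dom T h = C \<and> Cod T h = Z \<and> (\<forall>x\<in>Sigma K I. h \<bullet> (case x of (k, i) \<Rightarrow> \<iota> k \<bullet> \<kappa>' k i) = f x)"
    using h g c d by (intro exI[of _ h]) (auto simp: assoc_eq[OF h(3)])
next
  note c = coproduct_types[OF C] and d = coproduct_types[OF D]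
  fix g g' assume *: "Dom T g = C" "Dom T g' = C" "Cod T g = Cod T g'"
    "\<forall>x\<in>Sigma K I. g \<bullet> (case x of (k, i) \<Rightarrow> \<iota> k \<bullet> \<kappa>' k i) = g' \<bullet> (case x of (k, i) \<Rightarrow> \<iota> k \<bullet> \<kappa>' k i)"
  show "g = g'"
  proof (rule coproduct_eqI[OF C *(1-3)])
    fix k assume k: "k \<in> K"
    show "g \<bullet> \<iota> k = g' \<bullet> \<iota> k"
      by (rule coproduct_eqI[OF D[OF k]]) (use k c d * in \<open>auto simp: assoc\<close>)
  qed
qed (use coproduct_types[OF C] coproduct_types[OF D] in auto)

lemma coproduct_empty: "coproduct T {} X C \<iota> \<longleftrightarrow> zero_object T C"
proof
  assume "coproduct T {} X C \<iota>"
  then show "zero_object T C"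
    by (intro zero_objectI) (rule coproduct_eqI, auto)
next
  assume Z: "zero_object T C"
  show "coproduct T {} X C \<iota>"
  proof (rule coproductI)
    show "g = g'" if "Dom T g = C" "Dom T g' = C" "Cod T g = Cod T g'" for g g'
      using zero_object_from[OF Z, of g] zero_object_from[OF Z, of g'] that by simp
    show "\<exists>g. Dom T g = C \<and> Cod T g = Y \<and> (\<forall>i\<in>{}. g \<bullet> \<iota> i = f i)" for Y f
      by (intro exI[of _ "Zero T C Y"]) auto
  qed auto
qed

lemma coproduct_singleton: "coproduct T {i} X (X i) (\<lambda>_. Ident T (X i))"
  by (rule coproductI) auto

lemma coproduct_retract:
  assumes C: "coproduct T I X C \<iota>" and D: "coproduct T I Y D \<kappa>'"
    and r: "\<And>i. i \<in> I \<Longrightarrow> retract (X i) (Y i)"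
  shows "retract C D"
proof -
  note c = coproduct_types[OF C] and d = coproduct_types[OF D]
  obtain j p where j: "\<And>i. i \<in> I \<Longrightarrow> Dom T (j i) = X i" "\<And>i. i \<in> I \<Longrightarrow> Cod T (j i) = Y i"
      "\<And>i. i \<in> I \<Longrightarrow> Dom T (p i) = Y i" "\<And>i. i \<in> I \<Longrightarrow> Cod T (p i) = X i"
      "\<And>i. i \<in> I \<Longrightarrow> p i \<bullet> j i = Ident T (X i)"
    using r unfolding retract_def in_Mor Bex_def by metis
  obtain f where f: "Dom T f = C" "Cod T f = D" "\<And>i. i \<in> I \<Longrightarrow> f \<bullet> \<iota> i = \<kappa>' i \<bullet> j i"
    by (rule coproduct_map[OF C, of "\<lambda>i. \<kappa>' i \<bullet> j i" D]) (use j d in auto)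
  obtain g where g: "Dom T g = D" "Cod T g = C" "\<And>i. i \<in> I \<Longrightarrow> g \<bullet> \<kappa>' i = \<iota> i \<bullet> p i"
    by (rule coproduct_map[OF D, of "\<lambda>i. \<iota> i \<bullet> p i" C]) (use j c in auto)
  have "g \<bullet> f = Ident T C"
    by (rule coproduct_eqI[OF C]) (use f g c d j in \<open>auto simp: assoc assoc_eq[OF g(3)]\<close>)
  then show ?thesis using f g by (intro retractI[of f _ _ g]) auto
qed

lemma coproduct_orth:
  assumes C: "coproduct T I X C \<iota>" and "\<And>i. i \<in> I \<Longrightarrow> orth (X i) Y"
  shows "orth C Y"
  unfolding orth_def
proof (intro allI impI, elim conjE)
  fix f assume f: "Dom T f = C" "Cod T f = Y"
  show "f = Zero T C Y"
    by (rule coproduct_eqI[OF C]) (use f assms orthD coproduct_types[OF C] in auto)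
qed

text \<open>The fillers into the cone \<open>c\<close> of F assemble to \<Phi> : b \<rightarrow> c.
  Its invertibility is the five lemma for Hom(-, W), which turns coproducts into products and thus
  preserves exactness; both halves are done by explicit arrows because no triangle on a, y, b is
  available yet.\<close>

lemma coproduct_triangle:
  assumes A: "coproduct T I A a \<alpha>" and Y: "coproduct T I Y y \<eta>" and B: "coproduct T I B b \<beta>"
    and t: "\<And>i. i \<in> I \<Longrightarrow> triangle T (A i) (Y i) (B i)"
  shows "triangle T a y b"
proof -
  note at = coproduct_types[OF A] and yt = coproduct_types[OF Y] and bt = coproduct_types[OF B]
  obtain f g h where t: "\<And>i. i \<in> I \<Longrightarrow> tri (A i) (Y i) (B i) (f i) (g i) (h i)"
    using t unfolding triangle_iff_tri by metis
  note tt = tri_types[OF t]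
  obtain F where F: "Dom T F = a" "Cod T F = y" "\<And>i. i \<in> I \<Longrightarrow> F \<bullet> \<alpha> i = \<eta> i \<bullet> f i"
    by (rule coproduct_map[OF A, of "\<lambda>i. \<eta> i \<bullet> f i" y]) (use yt tt in auto)
  obtain c G H where c: "tri a y c F G H" using tri_cone[of F] F by metis
  note ct = tri_types[OF c]
  have "\<exists>\<phi>. Dom T \<phi> = B i \<and> Cod T \<phi> = c \<and> G \<bullet> \<eta> i = \<phi> \<bullet> g i \<and> H \<bullet> \<phi> = SM (\<alpha> i) \<bullet> h i" if "i \<in> I" for i
    using tri_fill[OF t[OF that] c, of "\<alpha> i" "\<eta> i"] F(3)[OF that] at[OF that] yt[OF that] by metis
  then obtain \<phi> where \<phi>: "\<And>i. i \<in> I \<Longrightarrow> Dom T (\<phi> i) = B i" "\<And>i. i \<in> I \<Longrightarrow> Cod T (\<phi> i) = c"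
    "\<And>i. i \<in> I \<Longrightarrow> G \<bullet> \<eta> i = \<phi> i \<bullet> g i" "\<And>i. i \<in> I \<Longrightarrow> H \<bullet> \<phi> i = SM (\<alpha> i) \<bullet> h i"
    by metis
  obtain \<Phi> where \<Phi>: "Dom T \<Phi> = b" "Cod T \<Phi> = c" "\<And>i. i \<in> I \<Longrightarrow> \<Phi> \<bullet> \<beta> i = \<phi> i"
    using coproduct_map[OF B, of \<phi> c] \<phi> by metis
  have SA: "coproduct T I (\<lambda>i. S (A i)) (S a) (\<lambda>i. SM (\<alpha> i))" using A coproduct_S by blast
  have SY: "coproduct T I (\<lambda>i. S (Y i)) (S y) (\<lambda>i. SM (\<eta> i))" using Y coproduct_S by blast
  \<comment> \<open>Injectivity half: w vanishes on y, hence is s h for the connecting arrow; each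
    component of s then comes from \<Sigma>(Y i), and the assembled R shows that w passes through
    two consecutive arrows.\<close>
  have inj: "w = Zero T c W" if w: "Dom T w = c" "Cod T w = W" "w \<bullet> \<Phi> = Zero T b W" for w W
  proof -
    have 0: "w \<bullet> \<phi> i = Zero T (B i) W" if "i \<in> I" for i
      using \<Phi>(3)[OF that, symmetric] assoc_eq[OF w(3), of "\<beta> i"] w \<Phi> bt that by simp
    have "w \<bullet> G = Zero T y W"
    proof (rule coproduct_eqI[OF Y])
      fix i assume i: "i \<in> I"
      have "(w \<bullet> G) \<bullet> \<eta> i = (w \<bullet> \<phi> i) \<bullet> g i" using i w ct yt \<phi> tt by (simp add: assoc)
      then show "(w \<bullet> G) \<bullet> \<eta> i = Zero T y W \<bullet> \<eta> i" using i 0 tt yt by simp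
    qed (use w ct in auto)
    from tri_extend2[OF c w(1,2) this] obtain s where s: "Dom T s = S a" "Cod T s = W" "w = s \<bullet> H" by blast
    have "\<exists>r. Dom T r = S (Y i) \<and> Cod T r = W \<and> s \<bullet> SM (\<alpha> i) = r \<bullet> SM (f i)" if i: "i \<in> I" for i
    proof (rule tri_extend3[OF t[OF i]])
      have "(s \<bullet> SM (\<alpha> i)) \<bullet> h i = (s \<bullet> H) \<bullet> \<phi> i" using i s ct at tt \<phi> by (simp add: assoc)
      then show "(s \<bullet> SM (\<alpha> i)) \<bullet> h i = Zero T (B i) W" using 0[OF i] s by simp
    qed (use i s at tt in auto)
    then obtain r where r: "\<And>i. i \<in> I \<Longrightarrow> Dom T (r i) = S (Y i)" "\<And>i. i \<in> I \<Longrightarrow> Cod T (r i) = W"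
      "\<And>i. i \<in> I \<Longrightarrow> s \<bullet> SM (\<alpha> i) = r i \<bullet> SM (f i)" by metis
    obtain R where R: "Dom T R = S y" "Cod T R = W" "\<And>i. i \<in> I \<Longrightarrow> R \<bullet> SM (\<eta> i) = r i"
      using coproduct_map[OF SY, of r W] r by metis
    have "s = R \<bullet> SM F"
    proof (rule coproduct_eqI[OF SA])
      fix i assume i: "i \<in> I"
      have "(R \<bullet> SM F) \<bullet> SM (\<alpha> i) = R \<bullet> SM (F \<bullet> \<alpha> i)"
        using R(1,2) F(1,2) at i by (simp add: assoc)
      also have "\<dots> = r i \<bullet> SM (f i)" unfolding F(3)[OF i] R(3)[OF i, symmetric] using R(1,2) yt tt i by (simp add: assoc)
      finally show "s \<bullet> SM (\<alpha> i) = (R \<bullet> SM F) \<bullet> SM (\<alpha> i)" using r i by simp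
    qed (use s R F in auto)
    then have "w = R \<bullet> (SM F \<bullet> H)" using s R F ct by (simp add: assoc)
    then show ?thesis using R ct tri_comp3[OF c] by simp
  qed
  have "\<exists>v. Dom T v = y \<and> Cod T v = b \<and> (\<forall>i\<in>I. v \<bullet> \<eta> i = \<beta> i \<bullet> g i)"
    by (rule coproduct_map[OF Y, of "\<lambda>i. \<beta> i \<bullet> g i" b]) (use bt tt in auto)
  then obtain v where v: "Dom T v = y" "Cod T v = b" "\<And>i. i \<in> I \<Longrightarrow> v \<bullet> \<eta> i = \<beta> i \<bullet> g i" by blast
  have "v \<bullet> F = Zero T a b"
  proof (rule coproduct_eqI[OF A])
    fix i assume i: "i \<in> I"
    have "(v \<bullet> F) \<bullet> \<alpha> i = \<beta> i \<bullet> (g i \<bullet> f i)"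
      using i v F at yt bt tt by (simp add: assoc assoc_eq[OF v(3)])
    then show "(v \<bullet> F) \<bullet> \<alpha> i = Zero T a b \<bullet> \<alpha> i" using i tri_comp[OF t[OF i]] at bt by simp
  qed (use v F in auto)
  from tri_extend[OF c v(1,2) this] obtain w where w: "Dom T w = c" "Cod T w = b" "v = w \<bullet> G" by blast
  \<comment> \<open>The extension w of v need not restrict to \<beta> i along \<phi> i, but the
    difference dies on Y i and so factors through h i; the assembled R is the correction subtracted
    in \<open>w'\<close>.\<close>
  have "\<exists>r. Dom T r = S (A i) \<and> Cod T r = b \<and> sub (w \<bullet> \<phi> i) (\<beta> i) = r \<bullet> h i" if i: "i \<in> I" for i
  proof (rule tri_extend2[OF t[OF i]])
    have "(w \<bullet> \<phi> i) \<bullet> g i = w \<bullet> (G \<bullet> \<eta> i)" using i w \<phi> tt by (simp add: assoc)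
    also have "\<dots> = v \<bullet> \<eta> i" using i w ct yt by (simp add: assoc)
    finally have "(w \<bullet> \<phi> i) \<bullet> g i = \<beta> i \<bullet> g i" using v(3)[OF i] by simp
    then show "sub (w \<bullet> \<phi> i) (\<beta> i) \<bullet> g i = Zero T (Y i) b" using i w \<phi> bt tt by (simp add: Add_Comp)
  qed (use i w \<phi> bt in auto)
  then obtain r where r: "\<And>i. i \<in> I \<Longrightarrow> Dom T (r i) = S (A i)" "\<And>i. i \<in> I \<Longrightarrow> Cod T (r i) = b"
      "\<And>i. i \<in> I \<Longrightarrow> sub (w \<bullet> \<phi> i) (\<beta> i) = r i \<bullet> h i" by metis
  obtain R where R: "Dom T R = S a" "Cod T R = b" "\<And>i. i \<in> I \<Longrightarrow> R \<bullet> SM (\<alpha> i) = r i"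
    using coproduct_map[OF SA, of r b] r by metis
  define w' where "w' = sub w (R \<bullet> H)"
  have w': "Dom T w' = c" "Cod T w' = b" using w R ct by (auto simp: w'_def)
  have 1: "w' \<bullet> \<Phi> = Ident T b"
  proof (rule coproduct_eqI[OF B])
    fix i assume i: "i \<in> I"
    have "R \<bullet> (H \<bullet> \<phi> i) = r i \<bullet> h i"
      unfolding \<phi>(4)[OF i] R(3)[OF i, symmetric] using R(1,2) i at tt by (simp add: assoc)
    then have "w' \<bullet> \<phi> i = sub (w \<bullet> \<phi> i) (sub (w \<bullet> \<phi> i) (\<beta> i))"
      using i w R ct \<phi> r(3)[OF i] by (simp add: w'_def Add_Comp assoc)
    also have "\<dots> = \<beta> i" using i w \<phi> bt by (simp add: sub_sub)
    finally show "(w' \<bullet> \<Phi>) \<bullet> \<beta> i = Ident T b \<bullet> \<beta> i" using i w' \<Phi> bt by (simp add: assoc)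
  qed (use w' \<Phi> in auto)
  \<comment> \<open>A left inverse becomes two-sided because \<Phi> can be cancelled on the right by
    \<open>inj\<close>.\<close>
  have "sub (\<Phi> \<bullet> w') (Ident T c) \<bullet> \<Phi> = Zero T b c"
    using \<Phi> w' by (simp add: Add_Comp assoc 1)
  from inj[OF _ _ this] have "sub (\<Phi> \<bullet> w') (Ident T c) = Zero T c c" using \<Phi> w' by simp
  then have "\<Phi> \<bullet> w' = Ident T c" by (rule sub_eq_Zero) (use \<Phi> w' in auto)
  with 1 have "iso_arrow T w'" using \<Phi> w' by (intro iso_arrowI[of \<Phi>]) auto
  then have "isomorphic T c b" using w' by (auto simp: isomorphic_def in_Mor)
  then show ?thesis
    using c isomorphic_refl triangle_isomorphic by (meson triangle_iff_tri)
qed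

lemma coproduct_add_zeros:
  assumes C: "coproduct T I X C \<iota>" and "I \<subseteq> J" and Z: "\<And>j. j \<in> J - I \<Longrightarrow> zero_object T (X j)"
  shows "coproduct T J X C (\<lambda>j. if j \<in> I then \<iota> j else Zero T (X j) C)"
proof (rule coproductI)
  note c = coproduct_types[OF C]
  fix Y f assume f: "\<And>j. j \<in> J \<Longrightarrow> Dom T (f j) = X j \<and> Cod T (f j) = Y"
  then obtain g where g: "Dom T g = C" "Cod T g = Y" "\<And>i. i \<in> I \<Longrightarrow> g \<bullet> \<iota> i = f i"
    using coproduct_map[OF C, of f Y] assms(2) by blast
  then show "\<exists>g. Dom T g = C \<and> Cod T g = Y \<and> (\<forall>j\<in>J. g \<bullet> (if j \<in> I then \<iota> j else Zero T (X j) C) = f j)"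
    using f by (intro exI[of _ g]) (auto, metis Z Diff_iff zero_object_from)
next
  fix g g' assume *: "Dom T g = C" "Dom T g' = C" "Cod T g = Cod T g'"
   "\<forall>j\<in>J. g \<bullet> (if j \<in> I then \<iota> j else Zero T (X j) C) = g' \<bullet> (if j \<in> I then \<iota> j else Zero T (X j) C)"
  show "g = g'"
  proof (rule coproduct_eqI[OF C *(1-3)])
    fix i assume "i \<in> I"
    then show "g \<bullet> \<iota> i = g' \<bullet> \<iota> i" using bspec[OF *(4), of i] assms(2) by auto
  qed
qed (use coproduct_types[OF C] in auto)

text \<open>The coproduct of the triangles X = X \<rightarrow> 0 over I and 0 \<rightarrow> X = X
  over J; padding by zeros gives all three vertices the same index set.\<close>

lemma coproduct_split:
  assumes C: "coproduct T (I \<union> J) X C \<iota>" and D: "coproduct T I X D \<delta>" and E: "coproduct T J X E \<epsilon>"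
    and "I \<inter> J = {}"
  shows "triangle T D C E"
proof -
  obtain Z where Z: "zero_object T Z" using ex_zero_object by blast
  have D': "coproduct T (I \<union> J) (\<lambda>i. if i \<in> I then X i else Z) D
      (\<lambda>j. if j \<in> I then \<delta> j else Zero T (if j \<in> I then X j else Z) D)"
    by (rule coproduct_add_zeros[OF coproduct_cong[OF D]]) (use Z in auto)
  have E': "coproduct T (I \<union> J) (\<lambda>i. if i \<in> J then X i else Z) E
      (\<lambda>j. if j \<in> J then \<epsilon> j else Zero T (if j \<in> J then X j else Z) E)"
    by (rule coproduct_add_zeros[OF coproduct_cong[OF E]]) (use Z in auto)
  show ?thesis
    by (rule coproduct_triangle[OF D' C E'])
      (use assms(4) triangle_Ident[OF Z] triangle_Ident'[OF Z] in auto)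
qed

section \<open>Compactness and sequential colimits\<close>

text \<open>The only consequence of compactness that matters below: an arrow from \<open>K\<close> to a countable
  coproduct lives on finitely many summands.  Stating this through the arrows that kill these
  summands avoids finite sums of arrows.\<close>

definition supported :: "(nat \<Rightarrow> 'o) \<Rightarrow> 'o \<Rightarrow> (nat \<Rightarrow> 'm) \<Rightarrow> nat \<Rightarrow> 'm \<Rightarrow> bool" where
  "supported X C \<iota> N g \<longleftrightarrow>
     (\<forall>u. Dom T u = C \<and> (\<forall>n<N. u \<bullet> \<iota> n = Zero T (X n) (Cod T u)) \<longrightarrow> u \<bullet> g = Zero T (Dom T g) (Cod T u))"

definition seq_compact :: "'o \<Rightarrow> bool" where
  "seq_compact K \<longleftrightarrow>
     (\<forall>X C \<iota> g. coproduct T (UNIV :: nat set) X C \<iota> \<and> Dom T g = K \<and> Cod T g = C \<longrightarrow>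
        (\<exists>N. supported X C \<iota> N g))"

text \<open>Subtracting the component at N removes that summand from the support: if u kills the
  summands below N, then v = u - u \<iota> N p also kills summand N, and u applied to the corrected
  arrow equals v g.\<close>

lemma supported_Suc:
  assumes C: "coproduct T (UNIV :: nat set) X C \<iota>"
    and p: "Dom T p = C" "Cod T p = X N" "p \<bullet> \<iota> N = Ident T (X N)" "\<And>n. n < N \<Longrightarrow> p \<bullet> \<iota> n = Zero T (X n) (X N)"
    and g: "supported X C \<iota> (Suc N) g" "Cod T g = C"
  shows "supported X C \<iota> N (sub g (\<iota> N \<bullet> (p \<bullet> g)))"
  unfolding supported_def
proof (intro allI impI, elim conjE)
  note c = coproduct_types[OF C UNIV_I]
  fix u assume u: "Dom T u = C" "\<forall>n<N. u \<bullet> \<iota> n = Zero T (X n) (Cod T u)"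
  define v where "v = sub u (u \<bullet> (\<iota> N \<bullet> p))"
  have v: "Dom T v = C" "Cod T v = Cod T u" using u p c by (auto simp: v_def)
  have "v \<bullet> \<iota> n = Zero T (X n) (Cod T u)" if "n < Suc N" for n
  proof (cases "n = N")
    case True
    then show ?thesis using u p c by (simp add: v_def Add_Comp assoc)
  next
    case False
    then show ?thesis using u p c that by (simp add: v_def Add_Comp assoc)
  qed
  then have "v \<bullet> g = Zero T (Dom T g) (Cod T u)" using g(1) v unfolding supported_def by metis
  moreover have "u \<bullet> sub g (\<iota> N \<bullet> (p \<bullet> g)) = v \<bullet> g"
    using u p c g by (simp add: v_def Add_Comp Comp_Add assoc)
  ultimately show "u \<bullet> sub g (\<iota> N \<bullet> (p \<bullet> g)) = Zero T (Dom T (sub g (\<iota> N \<bullet> (p \<bullet> g)))) (Cod T u)"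
    using g p c by simp
qed

lemma coproduct_projection:
  assumes C: "coproduct T I X C \<iota>" and "j \<in> I"
  obtains p where "Dom T p = C" "Cod T p = X j" "p \<bullet> \<iota> j = Ident T (X j)"
    "\<And>i. i \<in> I \<Longrightarrow> i \<noteq> j \<Longrightarrow> p \<bullet> \<iota> i = Zero T (X i) (X j)"
proof -
  obtain p where "Dom T p = C" "Cod T p = X j"
      "\<And>i. i \<in> I \<Longrightarrow> p \<bullet> \<iota> i = (if i = j then Ident T (X j) else Zero T (X i) (X j))"
    by (rule coproduct_map[OF C, of "\<lambda>i. if i = j then Ident T (X j) else Zero T (X i) (X j)" "X j"]) auto
  then show ?thesis using that[of p] assms(2) by simp
qed

lemma supported_0: "supported X C \<iota> 0 g \<Longrightarrow> Cod T g = C \<Longrightarrow> g = Zero T (Dom T g) C"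
  unfolding supported_def by (drule spec[of _ "Ident T C"]) simp

lemma seq_compact_S: "seq_compact (S K) \<longleftrightarrow> seq_compact K"
proof -
  have supp: "supported (\<lambda>n. S (X n)) (S C) (\<lambda>n. SM (\<iota> n)) N (SM g) \<longleftrightarrow> supported X C \<iota> N g"
    if C: "coproduct T (UNIV :: nat set) X C \<iota>" "Cod T g = C" for X C \<iota> N g
  proof
    note c = coproduct_types[OF C(1) UNIV_I]
    assume *: "supported (\<lambda>n. S (X n)) (S C) (\<lambda>n. SM (\<iota> n)) N (SM g)"
    show "supported X C \<iota> N g" unfolding supported_def
    proof (intro allI impI, elim conjE)
      fix u assume u: "Dom T u = C" "\<forall>n<N. u \<bullet> \<iota> n = Zero T (X n) (Cod T u)"
      then have "SM u \<bullet> SM (\<iota> n) = Zero T (S (X n)) (S (Cod T u))" if "n < N" for n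
        using that c by (simp flip: SM_Comp)
      then have "SM u \<bullet> SM g = Zero T (S (Dom T g)) (S (Cod T u))"
        using * u unfolding supported_def by (metis Dom_SM Cod_SM)
      then have "SM (u \<bullet> g) = SM (Zero T (Dom T g) (Cod T u))" using u C(2) by simp
      then show "u \<bullet> g = Zero T (Dom T g) (Cod T u)" by (simp only: SM_eq_iff)
    qed
  next
    note c = coproduct_types[OF C(1) UNIV_I]
    assume *: "supported X C \<iota> N g"
    show "supported (\<lambda>n. S (X n)) (S C) (\<lambda>n. SM (\<iota> n)) N (SM g)" unfolding supported_def
    proof (intro allI impI, elim conjE)
      fix u assume u: "Dom T u = S C" "\<forall>n<N. u \<bullet> SM (\<iota> n) = Zero T (S (X n)) (Cod T u)"
      obtain v where v: "u = SM v" by (rule SM_cases)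
      then have D: "Dom T v = C" using u by simp
      have "v \<bullet> \<iota> n = Zero T (X n) (Cod T v)" if "n < N" for n
      proof -
        have "SM (v \<bullet> \<iota> n) = SM (Zero T (X n) (Cod T v))" using u that v D c by simp
        then show ?thesis by (simp only: SM_eq_iff)
      qed
      then have "v \<bullet> g = Zero T (Dom T g) (Cod T v)" using * D unfolding supported_def by metis
      then have "SM (v \<bullet> g) = Zero T (S (Dom T g)) (S (Cod T v))" by simp
      then show "u \<bullet> SM g = Zero T (Dom T (SM g)) (Cod T u)" using v D C(2) by simp
    qed
  qed
  show ?thesis
  proof
    assume *: "seq_compact K"
    show "seq_compact (S K)" unfolding seq_compact_def
    proof (intro allI impI, elim conjE)
      fix X' C' \<iota>' g' assume C': "coproduct T (UNIV :: nat set) X' C' \<iota>'" "Dom T g' = S K" "Cod T g' = C'"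
      have "\<forall>n. \<exists>x. X' n = S x" using S_cases by blast
      then obtain X where "\<And>n. X' n = S (X n)" by metis
      then have X: "X' = (\<lambda>n. S (X n))" by blast
      obtain C where Ceq: "C' = S C" by (rule S_cases)
      have "\<forall>n. \<exists>x. \<iota>' n = SM x" using SM_cases by blast
      then obtain \<iota> where "\<And>n. \<iota>' n = SM (\<iota> n)" by metis
      then have \<iota>: "\<iota>' = (\<lambda>n. SM (\<iota> n))" by blast
      obtain g where g: "g' = SM g" by (rule SM_cases)
      have C: "coproduct T (UNIV :: nat set) X C \<iota>"
        using C'(1) unfolding X Ceq \<iota> by (subst coproduct_S)
      have "Dom T g = K" "Cod T g = C" using C' g Ceq by auto
      with * C obtain N where "supported X C \<iota> N g" unfolding seq_compact_def by blast
      then show "\<exists>N. supported X' C' \<iota>' N g'"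
        using supp[OF C \<open>Cod T g = C\<close>] unfolding X Ceq \<iota> g by blast
    qed
  next
    assume *: "seq_compact (S K)"
    show "seq_compact K" unfolding seq_compact_def
    proof (intro allI impI, elim conjE)
      fix X C \<iota> g assume C: "coproduct T (UNIV :: nat set) X C \<iota>" "Dom T g = K" "Cod T g = C"
      then have "coproduct T (UNIV :: nat set) (\<lambda>n. S (X n)) (S C) (\<lambda>n. SM (\<iota> n))" using coproduct_S by blast
      with * C obtain N where "supported (\<lambda>n. S (X n)) (S C) (\<lambda>n. SM (\<iota> n)) N (SM g)"
        unfolding seq_compact_def by (metis Dom_SM Cod_SM)
      then show "\<exists>N. supported X C \<iota> N g" using supp[OF C(1,3)] by blast
    qed
  qed
qed

lemma seq_compact_shift: "seq_compact (shift T n K) \<longleftrightarrow> seq_compact K"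
  by (rule shift_invariant[of "\<lambda>X _ _. seq_compact X"]) (rule seq_compact_S)

text \<open>The homotopy colimit \<open>Y\<close> of \<open>X 0 \<rightarrow> X 1 \<rightarrow> \<dots>\<close>; \<open>s\<close> moves each summand of \<open>C\<close> to the next one.\<close>

definition hocolim ::
  "(nat \<Rightarrow> 'o) \<Rightarrow> (nat \<Rightarrow> 'm) \<Rightarrow> 'o \<Rightarrow> (nat \<Rightarrow> 'm) \<Rightarrow> 'm \<Rightarrow> 'o \<Rightarrow> 'm \<Rightarrow> 'm \<Rightarrow> bool" where
  "hocolim X d C \<iota> s Y \<pi> h \<longleftrightarrow> coproduct T UNIV X C \<iota> \<and>
     (\<forall>n. Dom T (d n) = X n \<and> Cod T (d n) = X (Suc n)) \<and>
     Dom T s = C \<and> Cod T s = C \<and> (\<forall>n. s \<bullet> \<iota> n = \<iota> (Suc n) \<bullet> d n) \<and>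
     tri C C Y (sub (Ident T C) s) \<pi> h"

context
  fixes X d C \<iota> s Y \<pi> h
  assumes hocolim: "hocolim X d C \<iota> s Y \<pi> h"
begin

lemma hocolim_coproduct: "coproduct T UNIV X C \<iota>"
  and hocolim_tri: "tri C C Y (sub (Ident T C) s) \<pi> h"
  and hocolim_types: "Dom T (d n) = X n" "Cod T (d n) = X (Suc n)" "Dom T s = C" "Cod T s = C"
    "Dom T (\<iota> n) = X n" "Cod T (\<iota> n) = C" "Dom T \<pi> = C" "Cod T \<pi> = Y" "Dom T h = Y" "Cod T h = S C"
  and hocolim_s: "s \<bullet> \<iota> n = \<iota> (Suc n) \<bullet> d n"
proof -
  show C: "coproduct T UNIV X C \<iota>" and t: "tri C C Y (sub (Ident T C) s) \<pi> h"
    using hocolim by (auto simp: hocolim_def)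
  show "Dom T (d n) = X n" "Cod T (d n) = X (Suc n)" "Dom T s = C" "Cod T s = C"
    "Dom T (\<iota> n) = X n" "Cod T (\<iota> n) = C" "Dom T \<pi> = C" "Cod T \<pi> = Y" "Dom T h = Y" "Cod T h = S C"
    "s \<bullet> \<iota> n = \<iota> (Suc n) \<bullet> d n"
    using hocolim coproduct_types[OF C UNIV_I] tri_types[OF t] by (auto simp: hocolim_def)
qed

lemma hocolim_stage: "\<pi> \<bullet> \<iota> n = \<pi> \<bullet> (\<iota> (Suc n) \<bullet> d n)"
proof -
  have "\<pi> \<bullet> (sub (Ident T C) s \<bullet> \<iota> n) = Zero T (X n) Y"
    using assoc_eq[OF tri_comp[OF hocolim_tri], of "\<iota> n"] hocolim_types by simp
  then have "sub (\<pi> \<bullet> \<iota> n) (\<pi> \<bullet> (\<iota> (Suc n) \<bullet> d n)) = Zero T (X n) Y"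
    using hocolim_types by (simp add: Add_Comp Comp_Add hocolim_s)
  then show ?thesis by (rule sub_eq_Zero) (use hocolim_types in auto)
qed

text \<open>The last two facts express the shift s in components: component 0 receives nothing,
  component n + 1 receives component n through d n. They turn equations in C into
  recursions.\<close>

lemma hocolim_projections:
  obtains p where "\<forall>n. Dom T (p n) = C" "\<forall>n. Cod T (p n) = X n" "\<forall>n. p n \<bullet> \<iota> n = Ident T (X n)"
    "\<forall>n m. m \<noteq> n \<longrightarrow> p n \<bullet> \<iota> m = Zero T (X m) (X n)"
    "p 0 \<bullet> s = Zero T C (X 0)" "\<forall>n. p (Suc n) \<bullet> s = d n \<bullet> p n"
proof -
  note t = hocolim_types
  have "\<forall>n. \<exists>p. Dom T p = C \<and> Cod T p = X n \<and> p \<bullet> \<iota> n = Ident T (X n) \<and>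
      (\<forall>m. m \<noteq> n \<longrightarrow> p \<bullet> \<iota> m = Zero T (X m) (X n))"
    by (rule allI, rule coproduct_projection[OF hocolim_coproduct UNIV_I]) blast
  then obtain p where p: "\<And>n. Dom T (p n) = C" "\<And>n. Cod T (p n) = X n" "\<And>n. p n \<bullet> \<iota> n = Ident T (X n)"
    "\<And>n m. m \<noteq> n \<Longrightarrow> p n \<bullet> \<iota> m = Zero T (X m) (X n)"
    by metis
  have "p 0 \<bullet> s = Zero T C (X 0)"
    by (rule coproduct_eqI[OF hocolim_coproduct])
      (use p t in \<open>auto simp: assoc hocolim_s assoc_eq[OF p(4)]\<close>)
  moreover have "p (Suc n) \<bullet> s = d n \<bullet> p n" for n
  proof (rule coproduct_eqI[OF hocolim_coproduct])
    fix m
    show "(p (Suc n) \<bullet> s) \<bullet> \<iota> m = (d n \<bullet> p n) \<bullet> \<iota> m"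
      using p t by (cases "m = n") (auto simp: assoc hocolim_s assoc_eq[OF p(3)] assoc_eq[OF p(4)])
  qed (use p t in auto)
  ultimately show ?thesis using p by (intro that[of p]) blast+
qed

text \<open>Comparing components of \<open>g = s g\<close> shows inductively that they all vanish.\<close>

lemma seq_compact_fixed_by_s:
  assumes K: "seq_compact K" and g: "Dom T g = K" "Cod T g = C" "sub (Ident T C) s \<bullet> g = Zero T K C"
  shows "g = Zero T K C"
proof -
  note t = hocolim_types
  obtain p where p': "\<forall>n. Dom T (p n) = C" "\<forall>n. Cod T (p n) = X n" "\<forall>n. p n \<bullet> \<iota> n = Ident T (X n)"
    "\<forall>n m. m \<noteq> n \<longrightarrow> p n \<bullet> \<iota> m = Zero T (X m) (X n)"
    and p0: "p 0 \<bullet> s = Zero T C (X 0)" and pS': "\<forall>n. p (Suc n) \<bullet> s = d n \<bullet> p n"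
    by (rule hocolim_projections)
  note p = p'[rule_format] and pS = pS'[rule_format]
  have "sub g (s \<bullet> g) = Zero T K C" using g t by (simp add: Add_Comp)
  then have gs: "g = s \<bullet> g" by (rule sub_eq_Zero) (use g t in auto)
  have pg: "p n \<bullet> g = Zero T K (X n)" for n
  proof (induction n)
    case 0
    have "p 0 \<bullet> g = (p 0 \<bullet> s) \<bullet> g" using gs g p t by (simp add: assoc)
    then show ?case using p0 g by simp
  next
    case (Suc n)
    have "p (Suc n) \<bullet> g = (p (Suc n) \<bullet> s) \<bullet> g" using gs g p t by (simp add: assoc)
    also have "\<dots> = d n \<bullet> (p n \<bullet> g)" unfolding pS using g p t by (simp add: assoc)
    finally show ?case using Suc t by simp
  qed
  obtain N where "supported X C \<iota> N g"
    using K hocolim_coproduct g unfolding seq_compact_def by blast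
  then have "supported X C \<iota> 0 g"
  proof (induction N)
    case (Suc N)
    from supported_Suc[OF hocolim_coproduct _ _ _ _ Suc.prems, of "p N"]
    have "supported X C \<iota> N (sub g (\<iota> N \<bullet> (p N \<bullet> g)))" using p g by auto
    then show ?case using Suc.IH pg t g by simp
  qed simp
  then show ?thesis using supported_0 g by metis
qed

text \<open>The surjective half of Hom(K, hocolim) = colim Hom(K, X n). By
  \<open>seq_compact_fixed_by_s\<close> the map 1 - s is injective on arrows from compact objects,
  which forces h g = 0; so g lifts to C, and finite support lets all components be pushed into one
  stage.\<close>

lemma seq_compact_factor:
  assumes K: "seq_compact K" and g: "Dom T g = K" "Cod T g = Y"
  shows "\<exists>N. \<forall>n\<ge>N. \<exists>k. Dom T k = K \<and> Cod T k = X n \<and> g = \<pi> \<bullet> (\<iota> n \<bullet> k)"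
proof -
  note t = hocolim_types
  obtain K' where K': "K = S K'" by (rule S_cases)
  obtain q where q: "h \<bullet> g = SM q" by (rule SM_cases)
  have "Dom T (h \<bullet> g) = S K'" "Cod T (h \<bullet> g) = S C" using g t K' by auto
  then have qt: "Dom T q = K'" "Cod T q = C" using q by auto
  have "SM (sub (Ident T C) s) \<bullet> (h \<bullet> g) = Zero T K (S C)"
    using assoc_eq[OF tri_comp3[OF hocolim_tri], of g] g t by simp
  then have "SM (sub (Ident T C) s \<bullet> q) = SM (Zero T K' C)" using q qt K' t by simp
  then have "sub (Ident T C) s \<bullet> q = Zero T K' C" by (simp only: SM_eq_iff)
  then have "q = Zero T K' C"
    using seq_compact_fixed_by_s[of K' q] K qt unfolding K' seq_compact_S by blast
  then have "h \<bullet> g = Zero T K (S C)" using q K' by simp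
  from tri_lift2[OF hocolim_tri g this] obtain f where f: "Dom T f = K" "Cod T f = C" "g = \<pi> \<bullet> f" by blast
  obtain N where "supported X C \<iota> N f"
    using K hocolim_coproduct f unfolding seq_compact_def by blast
  then have "\<exists>k. Dom T k = K \<and> Cod T k = X N \<and> \<pi> \<bullet> f = \<pi> \<bullet> (\<iota> N \<bullet> k)"
    using f(1,2)
  proof (induction N arbitrary: f)
    case 0
    then have "f = Zero T K C" using supported_0 by metis
    then show ?case using t by (intro exI[of _ "Zero T K (X 0)"]) simp
  next
    case (Suc N)
    obtain p where p: "Dom T p = C" "Cod T p = X N" "p \<bullet> \<iota> N = Ident T (X N)"
      "\<And>m. m \<noteq> N \<Longrightarrow> p \<bullet> \<iota> m = Zero T (X m) (X N)"
      by (rule coproduct_projection[OF hocolim_coproduct UNIV_I, of N]) blast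
    \<comment> \<open>The component at N is split off; it and the arrow supplied by the induction
      both live at stage N, where they are added and moved on to stage N + 1.\<close>
    have "supported X C \<iota> N (sub f (\<iota> N \<bullet> (p \<bullet> f)))"
      by (rule supported_Suc[OF hocolim_coproduct p(1-3) _ Suc.prems(1,3)]) (use p in auto)
    from Suc.IH[OF this] obtain k where k: "Dom T k = K" "Cod T k = X N"
      "\<pi> \<bullet> sub f (\<iota> N \<bullet> (p \<bullet> f)) = \<pi> \<bullet> (\<iota> N \<bullet> k)" using Suc.prems p t by auto
    then have "sub (\<pi> \<bullet> f) (\<pi> \<bullet> (\<iota> N \<bullet> (p \<bullet> f))) = \<pi> \<bullet> (\<iota> N \<bullet> k)"
      using Suc.prems p t by (simp add: Comp_Add)
    then have "\<pi> \<bullet> f = Add T (\<pi> \<bullet> (\<iota> N \<bullet> k)) (\<pi> \<bullet> (\<iota> N \<bullet> (p \<bullet> f)))"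
      by (subst (asm) sub_eq_iff) (use Suc.prems p t k in auto)
    also have "\<dots> = (\<pi> \<bullet> \<iota> N) \<bullet> Add T k (p \<bullet> f)"
      using Suc.prems p t k by (simp add: Comp_Add assoc)
    also have "\<dots> = \<pi> \<bullet> (\<iota> (Suc N) \<bullet> (d N \<bullet> Add T k (p \<bullet> f)))"
      unfolding hocolim_stage using Suc.prems p t k by (simp add: assoc)
    finally show ?case
      using Suc.prems p t k by (intro exI[of _ "d N \<bullet> Add T k (p \<bullet> f)"]) auto
  qed
  then have N: "\<exists>k. Dom T k = K \<and> Cod T k = X N \<and> g = \<pi> \<bullet> (\<iota> N \<bullet> k)" using f by simp
  have "\<exists>k. Dom T k = K \<and> Cod T k = X n \<and> g = \<pi> \<bullet> (\<iota> n \<bullet> k)" if "N \<le> n" for n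
    using that
  proof (induction n rule: dec_induct)
    case base then show ?case by (rule N)
  next
    case (step n)
    then obtain k where k: "Dom T k = K" "Cod T k = X n" "g = \<pi> \<bullet> (\<iota> n \<bullet> k)" by blast
    have "g = (\<pi> \<bullet> \<iota> n) \<bullet> k" using k t by (simp add: assoc)
    also have "\<dots> = \<pi> \<bullet> (\<iota> (Suc n) \<bullet> (d n \<bullet> k))" unfolding hocolim_stage using k t by (simp add: assoc)
    finally show ?case using k t by (intro exI[of _ "d n \<bullet> k"]) auto
  qed
  then show ?thesis by blast
qed

text \<open>The weak universal property of a cone: the arrow on C given by the family kills 1 - s
  and therefore extends. Uniqueness is not claimed.\<close>

lemma hocolim_map:
  assumes "\<And>n. Dom T (\<phi> n) = X n" "\<And>n. Cod T (\<phi> n) = Z" "\<And>n. \<phi> (Suc n) \<bullet> d n = \<phi> n"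
  obtains \<Phi> where "Dom T \<Phi> = Y" "Cod T \<Phi> = Z" "\<forall>n. \<Phi> \<bullet> (\<pi> \<bullet> \<iota> n) = \<phi> n"
proof -
  note t = hocolim_types
  obtain f where f: "Dom T f = C" "Cod T f = Z" "\<And>n. f \<bullet> \<iota> n = \<phi> n"
    using coproduct_map[OF hocolim_coproduct, of \<phi> Z] assms by auto
  have "f \<bullet> sub (Ident T C) s = Zero T C Z"
    by (rule coproduct_eqI[OF hocolim_coproduct])
      (use f t assms in \<open>auto simp: assoc Add_Comp Comp_Add hocolim_s assoc_eq[OF f(3)]\<close>)
  from tri_extend[OF hocolim_tri f(1,2) this] obtain v where v: "Dom T v = Y" "Cod T v = Z" "f = v \<bullet> \<pi>"
    by blast
  have "v \<bullet> (\<pi> \<bullet> \<iota> n) = \<phi> n" for n using v t f(3)[of n] by (simp add: assoc)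
  with v show ?thesis using that by blast
qed

text \<open>As Y = 0, \<iota> 0 f is (1 - s) q for some q. Its components satisfy p 0 q = f and p (n
  + 1) q = d n (p n q), so q behaves like the infinite sum of all c n f; compactness makes it
  finite.\<close>

lemma seq_compact_dies:
  assumes Y: "zero_object T Y" and K: "seq_compact K" and f: "Dom T f = K" "Cod T f = X 0"
    and c: "\<And>n. Dom T (c n) = X 0" "\<And>n. Cod T (c n) = X n" "c 0 = Ident T (X 0)" "\<And>n. c (Suc n) = d n \<bullet> c n"
  shows "\<exists>n. c n \<bullet> f = Zero T K (X n)"
proof -
  note t = hocolim_types
  obtain p where p': "\<forall>n. Dom T (p n) = C" "\<forall>n. Cod T (p n) = X n" "\<forall>n. p n \<bullet> \<iota> n = Ident T (X n)"
    "\<forall>n m. m \<noteq> n \<longrightarrow> p n \<bullet> \<iota> m = Zero T (X m) (X n)"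
    and p0: "p 0 \<bullet> s = Zero T C (X 0)" and pS': "\<forall>n. p (Suc n) \<bullet> s = d n \<bullet> p n"
    by (rule hocolim_projections)
  note p = p'[rule_format] and pS = pS'[rule_format]
  have "\<exists>q. Dom T q = K \<and> Cod T q = C \<and> \<iota> 0 \<bullet> f = sub (Ident T C) s \<bullet> q"
    by (rule tri_lift[OF hocolim_tri]) (use f t zero_object_to[OF Y, of "\<pi> \<bullet> (\<iota> 0 \<bullet> f)"] in auto)
  then obtain q where q: "Dom T q = K" "Cod T q = C" "\<iota> 0 \<bullet> f = sub (Ident T C) s \<bullet> q" by blast
  then have qs: "\<iota> 0 \<bullet> f = sub q (s \<bullet> q)" using t by (simp add: Add_Comp)
  have pq: "p n \<bullet> q = c n \<bullet> f" for n
  proof (induction n)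
    case 0
    have "p 0 \<bullet> (\<iota> 0 \<bullet> f) = p 0 \<bullet> q"
      unfolding qs using p t q by (simp add: Comp_Add assoc_eq[OF p0])
    then show ?case using p t f c by (simp add: assoc_eq[OF p(3)])
  next
    case (Suc n)
    have 1: "p (Suc n) \<bullet> (\<iota> 0 \<bullet> f) = sub (p (Suc n) \<bullet> q) (d n \<bullet> (p n \<bullet> q))"
      unfolding qs using p(1,2) t q(1,2) by (simp add: Comp_Add assoc_eq[OF pS] assoc)
    have "p (Suc n) \<bullet> (\<iota> 0 \<bullet> f) = (p (Suc n) \<bullet> \<iota> 0) \<bullet> f" using p(1) t f by (simp add: assoc)
    also have "\<dots> = Zero T K (X (Suc n))" using p(4)[of 0 "Suc n"] f by simp
    finally have "sub (p (Suc n) \<bullet> q) (d n \<bullet> (p n \<bullet> q)) = Zero T K (X (Suc n))" using 1 by simp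
    then have "p (Suc n) \<bullet> q = d n \<bullet> (p n \<bullet> q)"
      by (rule sub_eq_Zero) (use p(1,2) t q(1,2) in auto)
    then show ?case using Suc c f t by (simp add: assoc)
  qed
  obtain N where "supported X C \<iota> N q"
    using K hocolim_coproduct q unfolding seq_compact_def by blast
  \<comment> \<open>p N kills exactly the kind of summands, those below N, on which q is
    supported.\<close>
  then have "p N \<bullet> q = Zero T K (X N)"
    unfolding supported_def using p q by (metis less_irrefl)
  with pq show ?thesis by metis
qed

end

end

context triangulated_with_coproducts
begin

section \<open>Small coproducts\<close>

lemma Cinfinite: "Cinfinite \<kappa>" and regular: "regularCard \<kappa>"
  and natLeq_less: "natLeq <o \<kappa>"
  using inaccessible ordLess_imp_ordLeq[of natLeq \<kappa>] cinfinite_mono[OF _ natLeq_cinfinite]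
  by (auto simp: inaccessible_def)

lemma small_mono: "A \<subseteq> B \<Longrightarrow> small \<kappa> B \<Longrightarrow> small \<kappa> A"
  unfolding small_def using card_of_mono1 ordLeq_ordLess_trans by blast

lemma small_UN: "small \<kappa> I \<Longrightarrow> (\<And>i. i \<in> I \<Longrightarrow> small \<kappa> (A i)) \<Longrightarrow> small \<kappa> (\<Union>i\<in>I. A i)"
  unfolding small_def using regularCard_UNION_bound Cinfinite regular by blast

lemma small_Sigma: "small \<kappa> I \<Longrightarrow> (\<And>i. i \<in> I \<Longrightarrow> small \<kappa> (A i)) \<Longrightarrow> small \<kappa> (Sigma I A)"
  unfolding small_def using stable_elim regularCard_stable Cinfinite regular
  by (metis cinfinite_def)

lemma small_countable: "countable A \<Longrightarrow> small \<kappa> A"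
proof -
  assume "countable A"
  then have "|A| \<le>o |UNIV :: nat set|" using card_of_ordLeq unfolding countable_def by blast
  also have "|UNIV :: nat set| =o natLeq" by (rule card_of_nat)
  finally show ?thesis unfolding small_def using natLeq_less ordLeq_ordLess_trans by blast
qed

text \<open>The definitions index coproducts by subsets of 'u, whereas the constructions index them
  by numbers, pairs or arrows.\<close>

lemma small_embed:
  assumes "small \<kappa> A" obtains J :: "'u set" and \<phi> where "small \<kappa> J" "bij_betw \<phi> J A"
proof -
  obtain J :: "'u set" where J: "|A| =o |J|" "|J| <o \<kappa>"
    using assms unfolding small_def internalize_card_of_ordLess[of A \<kappa>] by (elim bexE exE conjE) 
  then obtain f where "bij_betw f A J" unfolding card_of_ordIso[symmetric] by blast
  then have "bij_betw (inv_into A f) J A" by (rule bij_betw_inv_into)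
  then show ?thesis using that J(2) unfolding small_def by blast
qed

lemma coproduct_exists:
  assumes "small \<kappa> I" obtains C \<iota> where "coproduct T I X C \<iota>"
proof -
  obtain J :: "'u set" and \<phi> where J: "small \<kappa> J" "bij_betw \<phi> J I" using assms by (rule small_embed)
  obtain C \<iota> where "coproduct T J (X \<circ> \<phi>) C \<iota>" using ex_coproduct[OF J(1)] by blast
  from coproduct_reindex[OF this bij_betw_inv_into[OF J(2)]]
  have "coproduct T I X C (\<iota> \<circ> inv_into J \<phi>)"
    by (rule coproduct_cong) (use J in \<open>auto simp: bij_betw_def f_inv_into_f\<close>)
  then show ?thesis using that by blast
qed

subsection \<open>Closure under coproducts\<close>

abbreviation coprods :: "'o set \<Rightarrow> 'o set" where
  "coprods \<equiv> coproducts_of \<kappa> T"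

lemma coprodsI:
  assumes "coproduct T I X C \<iota>" "small \<kappa> I" "\<And>i. i \<in> I \<Longrightarrow> X i \<in> A"
  shows "C \<in> coprods A"
proof -
  obtain J :: "'u set" and \<phi> where J: "small \<kappa> J" "bij_betw \<phi> J I" using assms(2) by (rule small_embed)
  have "\<forall>j\<in>J. (X \<circ> \<phi>) j \<in> A" using J(2) assms(3) by (auto simp: bij_betw_def)
  then show ?thesis using coproduct_reindex[OF assms(1) J(2)] J(1) unfolding coproducts_of_def by blast
qed

lemma coprodsE:
  assumes "C \<in> coprods A"
  obtains I :: "'u set" and X \<iota> where "small \<kappa> I" "\<forall>i\<in>I. X i \<in> A" "coproduct T I X C \<iota>"
  using assms unfolding coproducts_of_def by blast

lemma coprods_mono: "A \<subseteq> B \<Longrightarrow> coprods A \<subseteq> coprods B"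
  unfolding coproducts_of_def by blast

lemma coprods_superset: "A \<subseteq> coprods A"
proof
  fix X assume "X \<in> A"
  then show "X \<in> coprods A"
    using coprodsI[OF coproduct_singleton[of "0 :: nat" "\<lambda>_. X"]] small_countable[of "{0 :: nat}"] by auto
qed

lemma coprods_zero: "zero_object T Z \<Longrightarrow> Z \<in> coprods A"
  using coprodsI[of "{} :: nat set" undefined Z] small_countable[of "{} :: nat set"]
  by (auto simp: coproduct_empty)

lemma coprods_isomorphic: "C \<in> coprods A \<Longrightarrow> isomorphic T C D \<Longrightarrow> D \<in> coprods A"
  by (metis coprodsE coprodsI coproduct_transport)

lemma coprods_coprods: "coprods (coprods A) = coprods A"
proof (intro equalityI coprods_superset subsetI)
  fix C assume "C \<in> coprods (coprods A)"
  then obtain K :: "'u set" and Y \<iota> where K: "small \<kappa> K" "\<forall>k\<in>K. Y k \<in> coprods A" "coproduct T K Y C \<iota>"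
    by (rule coprodsE) 
  have "\<forall>k\<in>K. \<exists>(I :: 'u set) X \<epsilon>. small \<kappa> I \<and> (\<forall>i\<in>I. X i \<in> A) \<and> coproduct T I X (Y k) \<epsilon>"
    using K(2) unfolding coproducts_of_def by blast
  then obtain I :: "_ \<Rightarrow> 'u set" and X \<epsilon> where I: "\<And>k. k \<in> K \<Longrightarrow> small \<kappa> (I k)"
    "\<And>k i. k \<in> K \<Longrightarrow> i \<in> I k \<Longrightarrow> X k i \<in> A" "\<And>k. k \<in> K \<Longrightarrow> coproduct T (I k) (X k) (Y k) (\<epsilon> k)"
    by metis
  show "C \<in> coprods A"
    by (rule coprodsI[OF coproduct_Sigma[OF K(3) I(3)] small_Sigma[OF K(1) I(1)]]) (use I in auto)
qed

lemma coprods_star: "coprods (star T A B) \<subseteq> star T (coprods A) (coprods B)"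
proof
  fix C assume "C \<in> coprods (star T A B)"
  then obtain K :: "'u set" and Y \<iota> where K: "small \<kappa> K" "\<forall>k\<in>K. Y k \<in> star T A B" "coproduct T K Y C \<iota>"
    by (rule coprodsE)
  have "\<forall>k\<in>K. \<exists>a b. a \<in> A \<and> b \<in> B \<and> triangle T a (Y k) b" using K(2) unfolding star_def by blast
  then obtain a b where ab: "\<And>k. k \<in> K \<Longrightarrow> a k \<in> A" "\<And>k. k \<in> K \<Longrightarrow> b k \<in> B"
    "\<And>k. k \<in> K \<Longrightarrow> triangle T (a k) (Y k) (b k)" by metis
  obtain C1 \<iota>1 where 1: "coproduct T K a C1 \<iota>1" using K(1) by (rule coproduct_exists)
  obtain C2 \<iota>2 where 2: "coproduct T K b C2 \<iota>2" using K(1) by (rule coproduct_exists)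
  have "triangle T C1 C C2" by (rule coproduct_triangle[OF 1 K(3) 2 ab(3)])
  then show "C \<in> star T (coprods A) (coprods B)"
    by (rule starI) (use coprodsI[OF 1 K(1) ab(1)] coprodsI[OF 2 K(1) ab(2)] in auto)
qed

lemma coprods_Smd: "coprods (Smd T A) \<subseteq> Smd T (coprods A)"
proof
  fix C assume "C \<in> coprods (Smd T A)"
  then obtain K :: "'u set" and X \<iota> where K: "small \<kappa> K" "\<forall>k\<in>K. X k \<in> Smd T A" "coproduct T K X C \<iota>"
    by (rule coprodsE)
  then obtain Y where Y: "\<And>k. k \<in> K \<Longrightarrow> Y k \<in> A" "\<And>k. k \<in> K \<Longrightarrow> retract (X k) (Y k)"
    unfolding Smd_eq mem_Collect_eq by metis
  obtain D \<delta> where D: "coproduct T K Y D \<delta>" using K(1) by (rule coproduct_exists)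
  have "retract C D" by (rule coproduct_retract[OF K(3) D Y(2)])
  then show "C \<in> Smd T (coprods A)" by (rule SmdI) (rule coprodsI[OF D K(1) Y(1)])
qed

text \<open>The injections are quantified existentially because iterated shifts are defined on
  objects only.\<close>

lemma coproduct_shift:
  "(\<exists>\<iota>. coproduct T I (\<lambda>i. shift T n (X i)) (shift T n C) \<iota>) \<longleftrightarrow> (\<exists>\<iota>. coproduct T I X C \<iota>)"
proof -
  have step: "(\<exists>\<iota>. coproduct T I (\<lambda>i. S (X i)) (S C) \<iota>) \<longleftrightarrow> (\<exists>\<iota>. coproduct T I X C \<iota>)" for X C
  proof
    assume "\<exists>\<iota>. coproduct T I (\<lambda>i. S (X i)) (S C) \<iota>"
    then obtain \<iota>' where \<iota>': "coproduct T I (\<lambda>i. S (X i)) (S C) \<iota>'" by blast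
    have "\<forall>i. \<exists>x. \<iota>' i = SM x" using SM_cases by blast
    then obtain \<iota> where "\<And>i. \<iota>' i = SM (\<iota> i)" by metis
    then have "\<iota>' = (\<lambda>i. SM (\<iota> i))" by blast
    then show "\<exists>\<iota>. coproduct T I X C \<iota>" using \<iota>' coproduct_S by blast
  qed (use coproduct_S in blast)
  show ?thesis
  proof (induction n rule: int_induct[where k = 0])
    case base show ?case by simp
  next
    case (step1 i)
    then show ?case using step[of "\<lambda>j. shift T i (X j)" "shift T i C"] by (simp add: S_shift)
  next
    case (step2 i)
    then show ?case using step[of "\<lambda>j. shift T (i - 1) (X j)" "shift T (i - 1) C"] by (simp add: S_shift)
  qed
qed

lemma coprods_shift: "C \<in> coprods A \<Longrightarrow> shift T n C \<in> coprods (shift T n ` A)"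
  by (elim coprodsE) (metis (no_types, lifting) coprodsI coproduct_shift imageI)

lemma shift_image_shifts: "shift T n ` shifts T G J = shifts T G ((\<lambda>j. j - n) ` J)"
  unfolding shifts_def image_image by (simp add: algebra_simps)

lemma shifts_mono: "J \<subseteq> J' \<Longrightarrow> shifts T G J \<subseteq> shifts T G J'"
  unfolding shifts_def by blast

lemma star_shift: "X \<in> star T A B \<Longrightarrow> shift T n X \<in> star T (shift T n ` A) (shift T n ` B)"
  unfolding star_def using triangle_shift by blast

section \<open>Generation\<close>

subsection \<open>Unbounded number of extensions\<close>

definition ext_closed :: "'o set \<Rightarrow> bool" where
  "ext_closed A \<longleftrightarrow> coprods A \<subseteq> A \<and> star T A A \<subseteq> A"

lemma ext_closedD:
  assumes "ext_closed A"
  shows "coprods A \<subseteq> A" "triangle T X Y Z \<Longrightarrow> X \<in> A \<Longrightarrow> Z \<in> A \<Longrightarrow> Y \<in> A"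
    "zero_object T Z \<Longrightarrow> Z \<in> A" "X \<in> A \<Longrightarrow> isomorphic T X Y \<Longrightarrow> Y \<in> A"
  using assms coprods_zero[of Z A] coprods_isomorphic[of X A Y] coprods_superset[of A]
  unfolding ext_closed_def star_def by blast+

lemma ext_closed_Smd: "ext_closed A \<Longrightarrow> ext_closed (Smd T A)"
  unfolding ext_closed_def using coprods_Smd star_Smd Smd_mono by (meson subset_trans)

lemma ext_closed_shift:
  assumes "ext_closed A" shows "ext_closed {X. shift T n X \<in> A}"
proof -
  let ?B = "{X. shift T n X \<in> A}"
  have B: "shift T n ` ?B \<subseteq> A" by blast
  have "coprods ?B \<subseteq> ?B"
  proof
    fix C assume "C \<in> coprods ?B"
    then have "shift T n C \<in> coprods A" using coprods_shift coprods_mono[OF B] by blast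
    then show "C \<in> ?B" using assms unfolding ext_closed_def by blast
  qed
  moreover have "star T ?B ?B \<subseteq> ?B"
  proof
    fix C assume "C \<in> star T ?B ?B"
    then have "shift T n C \<in> star T A A" using star_shift star_mono[OF B B] by blast
    then show "C \<in> ?B" using assms unfolding ext_closed_def by blast
  qed
  ultimately show ?thesis unfolding ext_closed_def by blast
qed

lemma triangle_orth:
  assumes "triangle T X Y Z" "orth X W" "orth Z W" shows "orth Y W"
  unfolding orth_def
proof (intro allI impI, elim conjE)
  obtain f g h where 1: "tri X Y Z f g h" using assms by (auto simp: triangle_iff_tri)
  note t = tri_types[OF 1]
  fix u assume u: "Dom T u = Y" "Cod T u = W"
  have "u \<bullet> f = Zero T X W" using orthD[OF assms(2)] u t by simp
  from tri_extend[OF 1 u this] obtain v where "Dom T v = Z" "Cod T v = W" "u = v \<bullet> g" by blast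
  then show "u = Zero T Y W" using orthD[OF assms(3), of v] t by simp
qed

text \<open>Left orthogonals are closed under everything that generation uses. This lets
  orthogonality be checked on generators, and through \<open>aisle_eq\<close> it gives aisles their
  closure properties.\<close>

lemma ext_closed_orth: "ext_closed {X. \<forall>Y\<in>B. orth X Y}"
  unfolding ext_closed_def star_def using coproduct_orth triangle_orth
  by (auto elim!: coprodsE) blast

lemma Smd_orth: "Smd T {X. \<forall>Y\<in>B. orth X Y} \<subseteq> {X. \<forall>Y\<in>B. orth X Y}"
  by (auto simp: Smd_eq intro: orth_retract_left)

abbreviation CP :: "'o \<Rightarrow> int set \<Rightarrow> 'o set" where "CP \<equiv> Coprod \<kappa> T"
abbreviation GN :: "'o \<Rightarrow> int set \<Rightarrow> 'o set" where "GN \<equiv> gen \<kappa> T"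

lemma Coprod_eq: "CP G J = \<Inter> {A. ext_closed A \<and> shifts T G J \<subseteq> A}"
  unfolding Coprod_def ext_closed_def by (simp add: conj_assoc)

lemma Coprod_least: "ext_closed A \<Longrightarrow> shifts T G J \<subseteq> A \<Longrightarrow> CP G J \<subseteq> A"
  unfolding Coprod_eq by blast

lemma shifts_Coprod: "shifts T G J \<subseteq> CP G J"
  unfolding Coprod_eq by blast

lemma ext_closed_Coprod: "ext_closed (CP G J)"
  unfolding ext_closed_def
proof
  have "coprods (CP G J) \<subseteq> A" if "ext_closed A" "shifts T G J \<subseteq> A" for A
    using coprods_mono[OF Coprod_least[OF that]] that(1) unfolding ext_closed_def by blast
  then show "coprods (CP G J) \<subseteq> CP G J" by (subst (2) Coprod_eq) blast
  have "star T (CP G J) (CP G J) \<subseteq> A" if "ext_closed A" "shifts T G J \<subseteq> A" for A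
    using star_mono[OF Coprod_least[OF that] Coprod_least[OF that]] that(1) unfolding ext_closed_def by blast
  then show "star T (CP G J) (CP G J) \<subseteq> CP G J" by (subst (3) Coprod_eq) blast
qed

lemma ext_closed_gen: "ext_closed (GN G J)"
  unfolding gen_def by (rule ext_closed_Smd[OF ext_closed_Coprod])

lemma Coprod_gen: "CP G J \<subseteq> GN G J"
  unfolding gen_def by (rule Smd_superset)

lemma Smd_gen: "Smd T (GN G J) = GN G J"
  unfolding gen_def by (rule Smd_Smd)

lemma gen_least: "ext_closed A \<Longrightarrow> Smd T A \<subseteq> A \<Longrightarrow> shifts T G J \<subseteq> A \<Longrightarrow> GN G J \<subseteq> A"
  unfolding gen_def using Smd_mono[OF Coprod_least] by blast

lemma gen_trans: "shifts T G J \<subseteq> GN G' J' \<Longrightarrow> GN G J \<subseteq> GN G' J'"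
  by (rule gen_least) (auto simp: ext_closed_gen Smd_gen)

lemma gen_mono: "J \<subseteq> J' \<Longrightarrow> GN G J \<subseteq> GN G J'"
  by (rule gen_trans) (meson Coprod_gen shifts_Coprod shifts_mono subset_trans)

lemma Coprod_shift:
  assumes "X \<in> CP G J" shows "shift T n X \<in> CP G ((\<lambda>j. j - n) ` J)"
proof -
  have "CP G J \<subseteq> {X. shift T n X \<in> CP G ((\<lambda>j. j - n) ` J)}"
  proof (rule Coprod_least[OF ext_closed_shift[OF ext_closed_Coprod]], rule subsetI)
    fix Y assume "Y \<in> shifts T G J"
    then have "shift T n Y \<in> shifts T G ((\<lambda>j. j - n) ` J)"
      unfolding shift_image_shifts[symmetric] by (rule imageI)
    then show "Y \<in> {X. shift T n X \<in> CP G ((\<lambda>j. j - n) ` J)}" using shifts_Coprod by blast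
  qed
  with assms show ?thesis by auto
qed

lemma gen_shift:
  assumes "X \<in> GN G J" shows "shift T n X \<in> GN G ((\<lambda>j. j - n) ` J)"
proof -
  obtain B where "B \<in> CP G J" "retract X B" using assms by (auto simp: gen_def Smd_eq)
  then show ?thesis unfolding gen_def by (intro SmdI[of _ "shift T n B"]) (auto simp: retract_shift Coprod_shift)
qed

lemma mem_shifts: "j \<in> J \<Longrightarrow> shift T (- j) G \<in> shifts T G J"
  unfolding shifts_def by blast

subsection \<open>Bounded number of extensions\<close>

abbreviation CPn :: "nat \<Rightarrow> 'o \<Rightarrow> int set \<Rightarrow> 'o set" where "CPn \<equiv> Coprod_n \<kappa> T"
abbreviation GNn :: "nat \<Rightarrow> 'o \<Rightarrow> int set \<Rightarrow> 'o set" where "GNn \<equiv> gen_n \<kappa> T"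

lemma coprods_Coprod_n: "coprods (CPn (Suc n) G J) \<subseteq> CPn (Suc n) G J"
proof (induction n)
  case 0 show ?case by (simp add: coprods_coprods)
next
  case (Suc n)
  have "coprods (CPn (Suc (Suc n)) G J) \<subseteq> star T (coprods (CPn (Suc 0) G J)) (coprods (CPn (Suc n) G J))"
    unfolding Coprod_n.simps(3) by (rule coprods_star)
  also have "\<dots> \<subseteq> star T (CPn (Suc 0) G J) (CPn (Suc n) G J)"
    by (rule star_mono[OF _ Suc]) (simp add: coprods_coprods)
  finally show ?case by simp
qed

text \<open>The recursion adds one factor on the left at a time; associativity regroups factors, so
  lengths add up.\<close>

lemma star_Coprod_n: "star T (CPn (Suc m) G J) (CPn (Suc n) G J) = CPn (Suc m + Suc n) G J"
proof (induction m)
  case (Suc m)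
  have "star T (CPn (Suc (Suc m)) G J) (CPn (Suc n) G J) =
      star T (CPn (Suc 0) G J) (star T (CPn (Suc m) G J) (CPn (Suc n) G J))"
    by (simp only: Coprod_n.simps(3) star_assoc)
  then show ?case by (simp add: Suc)
qed simp

lemma Coprod_n_mono: "J \<subseteq> J' \<Longrightarrow> CPn (Suc n) G J \<subseteq> CPn (Suc n) G J'"
  by (induction n) (simp_all add: coprods_mono shifts_mono star_mono)

lemma zero_Coprod_n: "zero_object T Z \<Longrightarrow> Z \<in> CPn (Suc n) G J"
  using coprods_Coprod_n coprods_zero by blast

lemma Coprod_n_Suc_mono: "CPn (Suc n) G J \<subseteq> CPn (Suc (Suc n)) G J"
proof
  fix X assume "X \<in> CPn (Suc n) G J"
  moreover obtain Z where "zero_object T Z" using ex_zero_object by blast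
  ultimately show "X \<in> CPn (Suc (Suc n)) G J"
    unfolding Coprod_n.simps(3) using starI[OF triangle_Ident'] zero_Coprod_n by blast
qed

lemma Coprod_n_le_mono: "m \<le> n \<Longrightarrow> CPn (Suc m) G J \<subseteq> CPn (Suc n) G J"
  using lift_Suc_mono_le[of "\<lambda>n. CPn (Suc n) G J" m n] Coprod_n_Suc_mono by blast

lemma Coprod_n_shift: "X \<in> CPn (Suc m) G J \<Longrightarrow> shift T n X \<in> CPn (Suc m) G ((\<lambda>j. j - n) ` J)"
proof (induction m arbitrary: X)
  case 0
  then show ?case using coprods_shift[of X "shifts T G J" n] by (simp add: shift_image_shifts)
next
  case (Suc m)
  obtain a b where ab: "a \<in> CPn (Suc 0) G J" "b \<in> CPn (Suc m) G J" "triangle T a X b"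
    using Suc.prems unfolding Coprod_n.simps(3) star_def by blast
  have "shift T n a \<in> CPn (Suc 0) G ((\<lambda>j. j - n) ` J)"
    using ab(1) coprods_shift[of a "shifts T G J" n] by (simp add: shift_image_shifts)
  moreover have "triangle T (shift T n a) (shift T n X) (shift T n b)"
    using ab(3) triangle_shift by blast
  ultimately show ?case unfolding Coprod_n.simps(3) using Suc.IH[OF ab(2)] by (blast intro: starI)
qed

lemma Coprod_n_Coprod: "CPn n G J \<subseteq> CP G J"
proof (induction n)
  case (Suc n)
  have 1: "CPn (Suc 0) G J \<subseteq> CP G J"
    using coprods_mono[OF shifts_Coprod] ext_closed_Coprod unfolding ext_closed_def by fastforce
  show ?case
  proof (cases n)
    case 0 then show ?thesis using 1 by simp
  next
    case (Suc m)
    then show ?thesis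
      using star_mono[OF 1 Suc.IH] ext_closed_Coprod unfolding ext_closed_def Suc Coprod_n.simps(3) by blast
  qed
qed simp

lemma gen_n_gen: "GNn n G J \<subseteq> GN G J"
  unfolding gen_n_def gen_def by (rule Smd_mono[OF Coprod_n_Coprod])

lemma gen_n_mono: "m \<le> n \<Longrightarrow> J \<subseteq> J' \<Longrightarrow> GNn (Suc m) G J \<subseteq> GNn (Suc n) G J'"
  unfolding gen_n_def by (meson Smd_mono Coprod_n_mono Coprod_n_le_mono subset_trans)

lemma star_gen_n: "star T (GNn (Suc m) G J) (GNn (Suc n) G J) \<subseteq> GNn (Suc m + Suc n) G J"
  unfolding gen_n_def star_Coprod_n[symmetric] by (rule star_Smd)

lemma coprods_gen_n: "coprods (GNn (Suc n) G J) \<subseteq> GNn (Suc n) G J"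
  unfolding gen_n_def by (meson Smd_mono coprods_Coprod_n coprods_Smd subset_trans)

lemma gen_n_shift:
  assumes "X \<in> GNn (Suc m) G J" shows "shift T n X \<in> GNn (Suc m) G ((\<lambda>j. j - n) ` J)"
proof -
  obtain B where "B \<in> CPn (Suc m) G J" "retract X B"
    using assms unfolding gen_n_def Smd_eq by blast
  then show ?thesis
    unfolding gen_n_def by (intro SmdI[of _ "shift T n B"]) (use retract_shift Coprod_n_shift in blast)+
qed

text \<open>Coproducts do not increase length, so each of the Suc m layers costs Suc k extensions
  and lengths multiply.\<close>

lemma gen_n_trans:
  assumes "shifts T G J \<subseteq> GNn (Suc k) G' J'"
  shows "GNn (Suc m) G J \<subseteq> GNn (Suc m * Suc k) G' J'"
proof -
  have "CPn (Suc m) G J \<subseteq> GNn (Suc m * Suc k) G' J'"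
  proof (induction m)
    case 0
    show ?case using coprods_mono[OF assms] coprods_gen_n[of k G' J'] by simp
  next
    case (Suc m)
    have "CPn (Suc 0) G J \<subseteq> GNn (Suc k) G' J'" using coprods_mono[OF assms] coprods_gen_n[of k G' J'] by simp
    from star_mono[OF this Suc] have "CPn (Suc (Suc m)) G J \<subseteq> star T (GNn (Suc k) G' J') (GNn (Suc m * Suc k) G' J')"
      by simp
    also have "\<dots> \<subseteq> GNn (Suc (Suc m) * Suc k) G' J'"
      using star_gen_n[of k G' J' "m * Suc k + k"] by (simp add: algebra_simps)
    finally show ?case .
  qed
  then have "Smd T (CPn (Suc m) G J) \<subseteq> Smd T (GNn (Suc m * Suc k) G' J')" by (rule Smd_mono)
  then show ?thesis by (simp add: gen_n_def Smd_Smd)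
qed

section \<open>Vanishing homotopy colimits\<close>

lemma small_nat: "small \<kappa> (UNIV :: nat set)"
  by (rule small_countable) simp

lemma supported_mono: "supported X C \<iota> M g \<Longrightarrow> M \<le> N \<Longrightarrow> supported X C \<iota> N g"
  unfolding supported_def using order_less_le_trans by blast

lemma supported_Add:
  assumes "supported X C \<iota> N f" "supported X C \<iota> N g" "Dom T f = Dom T g" "Cod T f = C" "Cod T g = C"
  shows "supported X C \<iota> N (Add T f g)"
  unfolding supported_def
proof (intro allI impI, elim conjE)
  fix u assume u: "Dom T u = C" "\<forall>n<N. u \<bullet> \<iota> n = Zero T (X n) (Cod T u)"
  then have "u \<bullet> f = Zero T (Dom T f) (Cod T u)" "u \<bullet> g = Zero T (Dom T g) (Cod T u)"
    using assms unfolding supported_def by blast+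
  then show "u \<bullet> Add T f g = Zero T (Dom T (Add T f g)) (Cod T u)"
    using assms u by (simp add: Comp_Add)
qed

text \<open>Surjectivity of the comparison map writes g as a finite sum of arrows, each through a
  single injection.\<close>

lemma compact_seq_compact:
  assumes "compact_object \<kappa> T K" shows "seq_compact K"
  unfolding seq_compact_def
proof (intro allI impI, elim conjE)
  fix X C \<iota> g assume C: "coproduct T (UNIV :: nat set) X C \<iota>" and g: "Dom T g = K" "Cod T g = C"
  note c = coproduct_types[OF C UNIV_I]
  obtain J :: "'u set" and \<phi> where J: "small \<kappa> J" "bij_betw \<phi> J (UNIV :: nat set)"
    using small_nat by (rule small_embed)
  interpret comm_group "Hom T K C" by (rule comm_group_Hom)
  let ?F = "\<lambda>x. gfinprod (Hom T K C) (\<lambda>i. (\<iota> \<circ> \<phi>) i \<bullet> x i) J"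
  let ?G = "sum_group J (\<lambda>i. Hom T K ((X \<circ> \<phi>) i))"
  have "?F \<in> iso ?G (Hom T K C)"
    using assms coproduct_reindex[OF C J(2)] J(1) unfolding compact_object_def by blast
  then have "?F ` carrier ?G = carrier (Hom T K C)" by (simp add: iso_def bij_betw_def)
  moreover have "g \<in> carrier (Hom T K C)" using g by (simp add: Hom_def in_Mor)
  ultimately have "g \<in> ?F ` carrier ?G" by metis
  then obtain x where x: "g = ?F x" "x \<in> carrier ?G" by (rule imageE)
  have gr: "group (Hom T K ((X \<circ> \<phi>) i))" for i
    using comm_group_Hom comm_group_def by blast
  have xt: "Dom T (x i) = K" "Cod T (x i) = X (\<phi> i)" if "i \<in> J" for i
    using x(2) that unfolding carrier_sum_group[OF gr] by (auto simp: Hom_def in_Mor PiE_def Pi_def)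
  let ?y = "\<lambda>i. (\<iota> \<circ> \<phi>) i \<bullet> x i"
  have y: "?y i \<in> carrier (Hom T K C)" if "i \<in> J" for i
    using xt[OF that] c by (simp add: Hom_def in_Mor)
  \<comment> \<open>Serves both the empty sum and the default value of \<open>gfinprod\<close> on
    families of infinite support.\<close>
  have zero: "\<exists>N. supported X C \<iota> N (Zero T K C)"
    unfolding supported_def by (intro exI[of _ 0]) auto
  have "finite F \<Longrightarrow> F \<subseteq> J \<Longrightarrow> \<exists>N. supported X C \<iota> N (finprod (Hom T K C) ?y F)" for F
  proof (induction F rule: finite_induct)
    case empty
    have "finprod (Hom T K C) ?y {} = Zero T K C" by (simp only: finprod_empty) (simp add: Hom_def)
    then show ?case using zero by metis
  next
    case (insert i F)
    then obtain N where N: "supported X C \<iota> N (finprod (Hom T K C) ?y F)" by auto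
    \<comment> \<open>Support bounds are strict, so the injection with index \<phi> i needs the
      bound Suc (\<phi> i).\<close>
    let ?N = "max N (Suc (\<phi> i))"
    have yF: "?y \<in> F \<rightarrow> carrier (Hom T K C)" "?y i \<in> carrier (Hom T K C)" using y insert.prems by auto
    have fF: "finprod (Hom T K C) ?y F \<in> Mor T K C"
      using finprod_closed[OF yF(1)] by (simp add: Hom_def)
    have "supported X C \<iota> (Suc (\<phi> i)) (?y i)"
      unfolding supported_def
    proof (intro allI impI, elim conjE)
      fix u assume u: "Dom T u = C" "\<forall>n<Suc (\<phi> i). u \<bullet> \<iota> n = Zero T (X n) (Cod T u)"
      then have "u \<bullet> \<iota> (\<phi> i) = Zero T (X (\<phi> i)) (Cod T u)" by blast
      from assoc_eq[OF this, of "x i"] show "u \<bullet> ?y i = Zero T (Dom T (?y i)) (Cod T u)"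
        using u xt[of i] c insert.prems by simp
    qed
    then have "supported X C \<iota> ?N (Add T (?y i) (finprod (Hom T K C) ?y F))"
      using supported_mono[OF N, of ?N] supported_mono[of X C \<iota> "Suc (\<phi> i)" "?y i" ?N] yF(2) fF
      by (intro supported_Add) (auto simp: Hom_def in_Mor)
    moreover have "finprod (Hom T K C) ?y (insert i F) = Add T (?y i) (finprod (Hom T K C) ?y F)"
      using finprod_insert[OF insert.hyps(1,2) yF] by (simp add: Hom_def)
    ultimately show ?case by metis
  qed
  from this[of "{i \<in> J. ?y i \<noteq> \<one>\<^bsub>Hom T K C\<^esub>}"] show "\<exists>N. supported X C \<iota> N g"
    unfolding x(1) gfinprod_def using zero by (auto simp: Hom_def)
qed

lemma hocolim_exists:
  assumes "\<And>n. Dom T (d n) = X n" "\<And>n. Cod T (d n) = X (Suc n)"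
  obtains C \<iota> s Y \<pi> h where "hocolim X d C \<iota> s Y \<pi> h"
proof -
  obtain C \<iota> where C: "coproduct T (UNIV :: nat set) X C \<iota>"
    using small_nat by (rule coproduct_exists)
  note c = coproduct_types[OF C UNIV_I]
  obtain s where s: "Dom T s = C" "Cod T s = C" "\<And>n. s \<bullet> \<iota> n = \<iota> (Suc n) \<bullet> d n"
    by (rule coproduct_map[OF C, of "\<lambda>n. \<iota> (Suc n) \<bullet> d n" C]) (use assms c in auto)
  obtain Y \<pi> h where "tri (Dom T (sub (Ident T C) s)) (Cod T (sub (Ident T C) s)) Y (sub (Ident T C) s) \<pi> h"
    by (rule tri_cone)
  then have "hocolim X d C \<iota> s Y \<pi> h"
    unfolding hocolim_def using C s assms by simp
  then show ?thesis by (rule that)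
qed

section \<open>Generators and sequences with vanishing homotopy colimit\<close>

definition generates :: "'o \<Rightarrow> bool" where
  "generates G \<longleftrightarrow> seq_compact G \<and> (\<forall>X. (\<forall>n. orth (shift T n G) X) \<longrightarrow> zero_object T X)"

lemma compact_generator_generates: "compact_generator \<kappa> T G \<Longrightarrow> generates G"
  by (simp add: compact_generator_def generates_def orth_iff compact_seq_compact)

text \<open>Formulated with the arrows d n so as to cover both resolutions: with a t-structure the
  arrows from a given shift of G to X n eventually are zero, while the killing resolution only makes
  each of them die at the next stage.\<close>

definition vanishing :: "'o \<Rightarrow> (nat \<Rightarrow> 'o) \<Rightarrow> (nat \<Rightarrow> 'm) \<Rightarrow> bool" where
  "vanishing G X d \<longleftrightarrow> (\<forall>n. Dom T (d n) = X n \<and> Cod T (d n) = X (Suc n)) \<and>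
     (\<forall>i. \<exists>N. \<forall>n\<ge>N. \<forall>f. Dom T f = shift T i G \<and> Cod T f = X n \<longrightarrow>
        d n \<bullet> f = Zero T (shift T i G) (X (Suc n)))"

text \<open>An arrow from a shift of G to Y factors through arbitrarily late stages, and passing to
  the next stage kills it.\<close>

lemma vanishing_hocolim:
  assumes G: "generates G" and v: "vanishing G X d"
  obtains C \<iota> s Y \<pi> h where "hocolim X d C \<iota> s Y \<pi> h" "zero_object T Y"
proof -
  have d: "\<And>n. Dom T (d n) = X n" "\<And>n. Cod T (d n) = X (Suc n)" using v by (auto simp: vanishing_def)
  obtain C \<iota> s Y \<pi> h where H: "hocolim X d C \<iota> s Y \<pi> h"
    by (rule hocolim_exists[of d X]) (use d in auto)
  note t = hocolim_types[OF H]
  have "orth (shift T i G) Y" for i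
    unfolding orth_def
  proof (intro allI impI, elim conjE)
    fix g assume g: "Dom T g = shift T i G" "Cod T g = Y"
    obtain N where N: "\<And>n f. N \<le> n \<Longrightarrow> Dom T f = shift T i G \<Longrightarrow> Cod T f = X n \<Longrightarrow>
        d n \<bullet> f = Zero T (shift T i G) (X (Suc n))"
      using v unfolding vanishing_def by blast
    have "seq_compact (shift T i G)" using G by (simp add: generates_def seq_compact_shift)
    from seq_compact_factor[OF H this g] obtain M where
      M: "\<forall>n\<ge>M. \<exists>k. Dom T k = shift T i G \<and> Cod T k = X n \<and> g = \<pi> \<bullet> (\<iota> n \<bullet> k)" ..
    then have "\<exists>k. Dom T k = shift T i G \<and> Cod T k = X (max M N) \<and> g = \<pi> \<bullet> (\<iota> (max M N) \<bullet> k)"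
      by (rule allE[of _ "max M N"]) simp
    then obtain k where k: "Dom T k = shift T i G" "Cod T k = X (max M N)" "g = \<pi> \<bullet> (\<iota> (max M N) \<bullet> k)"
      by blast
    have "d (max M N) \<bullet> k = Zero T (shift T i G) (X (Suc (max M N)))"
      by (rule N) (use k in auto)
    moreover have "g = (\<pi> \<bullet> \<iota> (max M N)) \<bullet> k" unfolding k(3) using k(1,2) t by (simp add: assoc)
    moreover have "(\<pi> \<bullet> \<iota> (max M N)) \<bullet> k = \<pi> \<bullet> (\<iota> (Suc (max M N)) \<bullet> (d (max M N) \<bullet> k))"
      unfolding hocolim_stage[OF H] using k(1,2) t by (simp add: assoc)
    ultimately show "g = Zero T (shift T i G) Y" using t by simp
  qed
  then have "zero_object T Y" using G by (simp add: generates_def)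
  with H show ?thesis by (rule that)
qed

lemma vanishing_compatible:
  assumes "generates G" "vanishing G X d"
    and \<phi>: "\<And>n. Dom T (\<phi> n) = X n" "\<And>n. Cod T (\<phi> n) = Z" "\<And>n. \<phi> (Suc n) \<bullet> d n = \<phi> n"
  shows "\<phi> n = Zero T (X n) Z"
proof -
  obtain C \<iota> s Y \<pi> h where H: "hocolim X d C \<iota> s Y \<pi> h" and Y: "zero_object T Y"
    by (rule vanishing_hocolim[OF assms(1,2)])
  note t = hocolim_types[OF H]
  obtain \<Phi> where \<Phi>: "Dom T \<Phi> = Y" "Cod T \<Phi> = Z" "\<forall>n. \<Phi> \<bullet> (\<pi> \<bullet> \<iota> n) = \<phi> n"
    by (rule hocolim_map[OF H, of \<phi> Z]) (use \<phi> in auto)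
  have "\<phi> n = \<Phi> \<bullet> Zero T (X n) Y"
    using \<Phi>(3)[rule_format, of n] zero_object_to[OF Y, of "\<pi> \<bullet> \<iota> n"] t by simp
  then show ?thesis using \<Phi>(1,2) by simp
qed

primrec chain :: "(nat \<Rightarrow> 'm) \<Rightarrow> nat \<Rightarrow> 'm" where
  "chain d 0 = Ident T (Dom T (d 0))"
| "chain d (Suc n) = d n \<bullet> chain d n"

text \<open>If the identity of a compact \<open>X 0\<close> dies in some \<open>X n\<close>, then \<open>X 0\<close> is a retract of the fibre of
  \<open>X 0 \<rightarrow> X n\<close>, which is an iterated extension of the fibres \<open>E k\<close> with \<open>k < n\<close>.\<close>

lemma vanishing_devissage:
  assumes G: "generates G" and v: "vanishing G X d" and K: "seq_compact (X 0)"
    and E: "\<And>n. fib (E n) (d n)"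
    and F: "\<And>Z. zero_object T Z \<Longrightarrow> Z \<in> \<F> 0" "\<And>n. star T (\<F> n) {E n} \<subseteq> \<F> (Suc n)"
  shows "\<exists>n. X 0 \<in> Smd T (\<F> n)"
proof -
  have d: "\<And>n. Dom T (d n) = X n" "\<And>n. Cod T (d n) = X (Suc n)" using v by (auto simp: vanishing_def)
  have ct: "Dom T (chain d n) = X 0 \<and> Cod T (chain d n) = X n" for n
    by (induction n) (auto simp: d)
  have "\<exists>F. F \<in> \<F> n \<and> fib F (chain d n)" for n
  proof (induction n)
    case 0
    obtain Z where Z: "zero_object T Z" using ex_zero_object by blast
    then have "fib Z (chain d 0)" unfolding fib_def using tri_Ident'[OF Z, of "X 0"] by (auto simp: d)
    then show ?case using F(1)[OF Z] by blast
  next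
    case (Suc n)
    then obtain F' where F': "F' \<in> \<F> n" "fib F' (chain d n)" by blast
    obtain F'' where "fib F'' (d n \<bullet> chain d n)" "triangle T F' F'' (E n)"
      by (rule fib_Comp[OF F'(2) E[of n]]) (use ct d in auto)
    then show ?case using F' F(2)[of n] by (intro exI[of _ F'']) (auto intro: starI)
  qed
  then obtain F' where F': "\<And>n. F' n \<in> \<F> n" "\<And>n. fib (F' n) (chain d n)" by metis
  obtain C \<iota> s Y \<pi> h where H: "hocolim X d C \<iota> s Y \<pi> h" and Y: "zero_object T Y"
    by (rule vanishing_hocolim[OF G v])
  obtain n where "chain d n \<bullet> Ident T (X 0) = Zero T (X 0) (X n)"
    using seq_compact_dies[OF H Y K, of "Ident T (X 0)" "chain d"] ct by (auto simp: d)
  then have "chain d n = Zero T (X 0) (X n)" using ct by simp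
  then have "retract (X 0) (F' n)" using F'(2)[of n] fib_Zero_retract by simp
  then have "X 0 \<in> Smd T (\<F> n)" using F'(1) by (rule SmdI)
  then show ?thesis by blast
qed

lemma small_arrows_from_shifts: "small \<kappa> {f. Dom T f \<in> shifts T G J \<and> Cod T f = Y \<and> P f}"
proof -
  have "small \<kappa> (\<Union>D\<in>shifts T G J. Mor T D Y)"
    by (intro small_UN small_countable small_Mor) (simp add: shifts_def)
  moreover have "{f. Dom T f \<in> shifts T G J \<and> Cod T f = Y \<and> P f} \<subseteq> (\<Union>D\<in>shifts T G J. Mor T D Y)"
    by (auto simp: in_Mor)
  ultimately show ?thesis by (rule small_mono[rotated])
qed

text \<open>E is the coproduct of the sources over all arrows in M, whence the demand that M be
  small. The last clause says that killing w amounts to killing every member of M.\<close>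

lemma cover:
  assumes "small \<kappa> M" "\<And>f. f \<in> M \<Longrightarrow> Dom T f \<in> A" "\<And>f. f \<in> M \<Longrightarrow> Cod T f = Y"
  obtains E w where "E \<in> coprods A" "Dom T w = E" "Cod T w = Y"
    "\<And>f. f \<in> M \<Longrightarrow> \<exists>j. Dom T j = Dom T f \<and> Cod T j = E \<and> f = w \<bullet> j"
    "\<And>u. Dom T u = Y \<Longrightarrow> (\<And>f. f \<in> M \<Longrightarrow> u \<bullet> f = Zero T (Dom T f) (Cod T u)) \<Longrightarrow>
      u \<bullet> w = Zero T E (Cod T u)"
proof -
  obtain E \<iota> where E: "coproduct T M (Dom T) E \<iota>" using assms(1) by (rule coproduct_exists)
  note e = coproduct_types[OF E]
  obtain w where w: "Dom T w = E" "Cod T w = Y" "\<And>f. f \<in> M \<Longrightarrow> w \<bullet> \<iota> f = f"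
    using coproduct_map[OF E, of "\<lambda>f. f" Y] assms(3) by auto
  have 1: "E \<in> coprods A" by (rule coprodsI[OF E assms(1,2)])
  have 2: "\<exists>j. Dom T j = Dom T f \<and> Cod T j = E \<and> f = w \<bullet> j" if "f \<in> M" for f
    using e[OF that] w(3)[OF that] by metis
  have 3: "u \<bullet> w = Zero T E (Cod T u)"
    if "Dom T u = Y" "\<And>f. f \<in> M \<Longrightarrow> u \<bullet> f = Zero T (Dom T f) (Cod T u)" for u
    by (rule coproduct_eqI[OF E]) (use that w e in \<open>auto simp: assoc\<close>)
  show ?thesis by (rule that[OF 1 w(1,2) 2 3])
qed

section \<open>The t-structure generated by a compact object\<close>

lemma Coprod_mono: "J \<subseteq> J' \<Longrightarrow> CP G J \<subseteq> CP G J'"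
  by (rule Coprod_least[OF ext_closed_Coprod]) (meson shifts_Coprod shifts_mono subset_trans)

lemma gen_orth:
  assumes "\<And>W. W \<in> shifts T G J \<Longrightarrow> orth W Y" "X \<in> GN G J" shows "orth X Y"
proof -
  have "GN G J \<subseteq> {X. \<forall>Y\<in>{Y}. orth X Y}"
    by (rule gen_least[OF ext_closed_orth Smd_orth]) (use assms(1) in blast)
  with assms(2) show ?thesis by blast
qed

lemma shift_atMost: "(\<lambda>j. j - n) ` {..m} = {..m - n :: int}"
  by (auto simp: image_iff intro!: bexI[of _ "_ + n"])

lemma gen_shift_atMost: "shift T n X \<in> GN G {..m} \<longleftrightarrow> X \<in> GN G {..m + n}"
proof
  assume "shift T n X \<in> GN G {..m}"
  from gen_shift[OF this, of "- n"] show "X \<in> GN G {..m + n}" by (simp only: shift_atMost shift_shift) simp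
next
  assume "X \<in> GN G {..m + n}"
  from gen_shift[OF this, of n] show "shift T n X \<in> GN G {..m}" by (simp only: shift_atMost) simp
qed

lemma trunc_iff: "X \<in> trunc T L n \<longleftrightarrow> shift T n X \<in> L"
proof
  assume "X \<in> trunc T L n" then show "shift T n X \<in> L" by (auto simp: trunc_def)
next
  assume "shift T n X \<in> L"
  moreover have "X = shift T (- n) (shift T n X)" by simp
  ultimately show "X \<in> trunc T L n" unfolding trunc_def by blast
qed

text \<open>Cells are attached along arrows from \<open>\<Sigma>\<^sup>i H\<close> for \<open>i \<ge> -1\<close> and not only \<open>i \<ge> 0\<close>: in the limit
  \<open>Y \<rightarrow> X\<close>, injectivity of \<open>Hom(\<Sigma>\<^sup>-\<^sup>1 H, Y) \<rightarrow> Hom(\<Sigma>\<^sup>-\<^sup>1 H, X)\<close> is needed to make \<open>Hom(H, -)\<close> vanish on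
  the cone.\<close>

lemma cell_step:
  assumes "Dom T a \<in> CP H {..0}"
  obtains d b where "Dom T b \<in> CP H {..0}" "Cod T b = Cod T a" "Dom T d = Dom T a" "Cod T d = Dom T b"
    "b \<bullet> d = a"
    "\<And>f. Dom T f \<in> shifts T H {..1} \<Longrightarrow> Cod T f = Dom T a \<Longrightarrow> a \<bullet> f = Zero T (Dom T f) (Cod T a) \<Longrightarrow>
       d \<bullet> f = Zero T (Dom T f) (Dom T b)"
proof -
  let ?M = "{f. Dom T f \<in> shifts T H {..1} \<and> Cod T f = Dom T a \<and> a \<bullet> f = Zero T (Dom T f) (Cod T a)}"
  obtain E w where E: "E \<in> coprods (shifts T H {..1})" and w: "Dom T w = E" "Cod T w = Dom T a"
    and 1: "\<And>f. f \<in> ?M \<Longrightarrow> \<exists>j. Dom T j = Dom T f \<and> Cod T j = E \<and> f = w \<bullet> j"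
    and 2: "\<And>u. Dom T u = Dom T a \<Longrightarrow> (\<And>f. f \<in> ?M \<Longrightarrow> u \<bullet> f = Zero T (Dom T f) (Cod T u)) \<Longrightarrow>
      u \<bullet> w = Zero T E (Cod T u)"
    by (rule cover[OF small_arrows_from_shifts[of H "{..1}" "Dom T a" "\<lambda>f. a \<bullet> f = Zero T (Dom T f) (Cod T a)"],
          of "shifts T H {..1}" "Dom T a"]) blast+
  obtain B d h where t: "tri E (Dom T a) B w d h" using tri_cone[of w] w by metis
  note tt = tri_types[OF t]
  have "a \<bullet> w = Zero T E (Cod T a)" by (rule 2) auto
  from tri_extend[OF t refl refl this] obtain b where b: "Dom T b = B" "Cod T b = Cod T a" "a = b \<bullet> d" by blast
  have "E \<in> CP H {..1}"
    using E coprods_mono[OF shifts_Coprod] ext_closed_Coprod unfolding ext_closed_def by blast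
  then have "S E \<in> CP H {..0}" using Coprod_shift[of E H "{..1}" 1] by (simp only: shift_atMost) simp
  moreover have "triangle T (Dom T a) B (S E)" using tri_rotate[OF t] by (auto simp: triangle_iff_tri)
  ultimately have B: "B \<in> CP H {..0}" using ext_closedD(2)[OF ext_closed_Coprod] assms by blast
  have "d \<bullet> f = Zero T (Dom T f) (Dom T b)" if "Dom T f \<in> shifts T H {..1}" "Cod T f = Dom T a"
    "a \<bullet> f = Zero T (Dom T f) (Cod T a)" for f
  proof -
    have "f \<in> ?M" using that by simp
    from 1[OF this] obtain j where j: "Dom T j = Dom T f" "Cod T j = E" "f = w \<bullet> j" by blast
    show ?thesis unfolding j(3) using j(1,2) tt b(1) assoc_eq[OF tri_comp[OF t], of j] by simp
  qed
  then show ?thesis by (intro that[of b d]) (use B b(1,2) b(3)[symmetric] tt in \<open>simp_all only:\<close>)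
qed

text \<open>A is the homotopy colimit Y of the stages. Stage 0 makes Hom(W, Y) \<rightarrow> Hom(W,
  X) onto for W in \<open>shifts H {..0}\<close>, the later stages make it injective for W in
  \<open>shifts H {..1}\<close>, and the long exact sequence annihilates Hom(W, B).\<close>

lemma cellular_approximation:
  assumes H: "seq_compact H"
  shows "\<exists>A B. A \<in> CP H {..0} \<and> (\<forall>W\<in>shifts T H {..0}. orth W B) \<and> triangle T A X B"
proof -
  \<comment> \<open>Surjectivity is recorded at stage 0 only: a lift found there maps on to the
    colimit.\<close>
  let ?P = "\<lambda>n a. Dom T a \<in> CP H {..0} \<and> Cod T a = X \<and>
    (n = (0::nat) \<longrightarrow> (\<forall>f. Dom T f \<in> shifts T H {..0} \<and> Cod T f = X \<longrightarrow>
      (\<exists>j. Dom T j = Dom T f \<and> Cod T j = Dom T a \<and> f = a \<bullet> j)))"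
  let ?Q = "\<lambda>(n::nat) a b. \<exists>d. Dom T d = Dom T a \<and> Cod T d = Dom T b \<and> b \<bullet> d = a \<and>
    (\<forall>f. Dom T f \<in> shifts T H {..1} \<and> Cod T f = Dom T a \<and> a \<bullet> f = Zero T (Dom T f) X \<longrightarrow>
       d \<bullet> f = Zero T (Dom T f) (Dom T b))"
  have base: "\<exists>a. ?P 0 a"
  proof -
    let ?M = "{f. Dom T f \<in> shifts T H {..0} \<and> Cod T f = X \<and> True}"
    obtain E w where "E \<in> coprods (shifts T H {..0})" "Dom T w = E" "Cod T w = X"
      "\<And>f. f \<in> ?M \<Longrightarrow> \<exists>j. Dom T j = Dom T f \<and> Cod T j = E \<and> f = w \<bullet> j"
      by (rule cover[OF small_arrows_from_shifts[of H "{..0}" X "\<lambda>_. True"], of "shifts T H {..0}" X]) blast+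
    moreover from this(1) have "E \<in> CP H {..0}"
      using coprods_mono[OF shifts_Coprod] ext_closed_Coprod unfolding ext_closed_def by blast
    ultimately show ?thesis by (intro exI[of _ w]) blast
  qed
  have step: "\<exists>b. ?P (Suc n) b \<and> ?Q n a b" if "?P n a" for a n
  proof -
    have a: "Dom T a \<in> CP H {..0}" "Cod T a = X" using that by blast+
    show ?thesis by (rule cell_step[OF a(1)]) (use a in \<open>simp, blast\<close>)
  qed
  from dependent_nat_choice[of ?P ?Q, OF base step]
  obtain a where aa: "\<forall>n. ?P n (a n) \<and> ?Q n (a n) (a (Suc n))" ..
  have a: "?P n (a n)" for n using aa[THEN spec, of n] by (rule conjunct1)
  have "\<forall>n. ?Q n (a n) (a (Suc n))" using aa by (intro allI) (drule spec, erule conjunct2)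
  then obtain d where d: "\<And>n. Dom T (d n) = Dom T (a n)" "\<And>n. Cod T (d n) = Dom T (a (Suc n))"
    "\<And>n. a (Suc n) \<bullet> d n = a n"
    "\<And>n f. Dom T f \<in> shifts T H {..1} \<Longrightarrow> Cod T f = Dom T (a n) \<Longrightarrow> a n \<bullet> f = Zero T (Dom T f) X \<Longrightarrow>
       d n \<bullet> f = Zero T (Dom T f) (Dom T (a (Suc n)))"
    by metis
  have at: "Cod T (a n) = X" "Dom T (a n) \<in> CP H {..0}" for n using a by blast+
  obtain C \<iota> s Y \<pi> h where hc: "hocolim (\<lambda>n. Dom T (a n)) d C \<iota> s Y \<pi> h"
    by (rule hocolim_exists[of d "\<lambda>n. Dom T (a n)"]) (use d in auto)
  note t = hocolim_types[OF hc]
  obtain \<Phi> where \<Phi>: "Dom T \<Phi> = Y" "Cod T \<Phi> = X" and \<Phi>': "\<forall>n. \<Phi> \<bullet> (\<pi> \<bullet> \<iota> n) = a n"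
    by (rule hocolim_map[OF hc, of a X]) (use d at in auto)
  \<comment> \<open>Y is an extension of \<Sigma>C by C, and suspending moves the index range {..0}
    into itself.\<close>
  have "C \<in> coprods (CP H {..0})" by (rule coprodsI[OF hocolim_coproduct[OF hc] small_nat]) (rule at)
  then have C: "C \<in> CP H {..0}" using ext_closed_Coprod unfolding ext_closed_def by blast
  then have "S C \<in> CP H {..-1}" using Coprod_shift[of C H "{..0}" 1] by (simp only: shift_atMost) simp
  then have "S C \<in> CP H {..0}" using Coprod_mono[of "{..-1}" "{..0}" H] by auto
  moreover have "triangle T C Y (S C)" using tri_rotate[OF hocolim_tri[OF hc]] by (auto simp: triangle_iff_tri)
  ultimately have Y: "Y \<in> CP H {..0}" using ext_closedD(2)[OF ext_closed_Coprod] C by blast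
  obtain B g k where tr: "tri Y X B \<Phi> g k" using tri_cone[of \<Phi>] \<Phi> by metis
  note tt = tri_types[OF tr]
  have "orth W B" if W: "W \<in> shifts T H {..0}" for W
    unfolding orth_def
  proof (intro allI impI, elim conjE)
    fix f assume f: "Dom T f = W" "Cod T f = B"
    obtain j where j: "j \<le> 0" "W = shift T (- j) H" using W by (auto simp: shifts_def)
    \<comment> \<open>The boundary k f lands in \<Sigma>Y, so it is tested on the desuspension of W,
      whose index j + 1 can reach 1.\<close>
    let ?W = "shift T (- (j + 1)) H"
    have W': "W = S ?W" unfolding j(2) by (simp add: S_shift)
    have shW: "?W \<in> shifts T H {..1}" using j(1) by (intro mem_shifts) simp
    obtain q where q: "k \<bullet> f = SM q" by (rule SM_cases)
    have "Dom T (k \<bullet> f) = S ?W" "Cod T (k \<bullet> f) = S Y" using f tt W' by auto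
    then have qt: "Dom T q = ?W" "Cod T q = Y" unfolding q by (simp_all only: Dom_SM Cod_SM S_eq_iff)
    have "SM \<Phi> \<bullet> (k \<bullet> f) = Zero T W (S X)" using assoc_eq[OF tri_comp3[OF tr], of f] f tt by simp
    then have "SM (\<Phi> \<bullet> q) = SM (Zero T ?W X)" using q qt \<Phi> unfolding W' by simp
    then have \<Phi>q: "\<Phi> \<bullet> q = Zero T ?W X" by (simp only: SM_eq_iff)
    have "seq_compact ?W" using H by (simp only: seq_compact_shift)
    from seq_compact_factor[OF hc this qt] obtain n where
      "\<forall>i\<ge>n. \<exists>m. Dom T m = ?W \<and> Cod T m = Dom T (a i) \<and> q = \<pi> \<bullet> (\<iota> i \<bullet> m)" ..
    then have "\<exists>m. Dom T m = ?W \<and> Cod T m = Dom T (a n) \<and> q = \<pi> \<bullet> (\<iota> n \<bullet> m)"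
      by (rule allE[of _ n]) simp
    then obtain m where m: "Dom T m = ?W" "Cod T m = Dom T (a n)" "q = \<pi> \<bullet> (\<iota> n \<bullet> m)" by blast
    have "a n \<bullet> m = (\<Phi> \<bullet> (\<pi> \<bullet> \<iota> n)) \<bullet> m" by (simp only: \<Phi>'[rule_format])
    also have "\<dots> = \<Phi> \<bullet> q" unfolding m(3) using m(1,2) t \<Phi> by (simp add: assoc)
    finally have "a n \<bullet> m = Zero T (Dom T m) X" using \<Phi>q m(1) by simp
    then have dm: "d n \<bullet> m = Zero T (Dom T m) (Dom T (a (Suc n)))"
      by (intro d(4)) (use m shW in auto)
    have "q = (\<pi> \<bullet> \<iota> n) \<bullet> m" unfolding m(3) using m(1,2) t by (simp add: assoc)
    also have "\<dots> = \<pi> \<bullet> (\<iota> (Suc n) \<bullet> (d n \<bullet> m))"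
      unfolding hocolim_stage[OF hc] using m(1,2) t by (simp add: assoc)
    also have "\<dots> = Zero T ?W Y" using dm m(1,2) t by simp
    finally have "k \<bullet> f = Zero T W (S Y)" using q W' by simp
    from tri_lift2[OF tr f this] obtain v where v: "Dom T v = W" "Cod T v = X" "f = g \<bullet> v" by blast
    \<comment> \<open>With zero boundary f lifts to X, and by surjectivity further to stage 0; hence
      f contains the composite g \<Phi> = 0.\<close>
    obtain l where l: "Dom T l = W" "Cod T l = Dom T (a 0)" "v = a 0 \<bullet> l"
      using a[of 0] v W by metis
    have "v = (\<Phi> \<bullet> (\<pi> \<bullet> \<iota> 0)) \<bullet> l" by (simp only: \<Phi>'[rule_format] l(3))
    also have "\<dots> = \<Phi> \<bullet> (\<pi> \<bullet> (\<iota> 0 \<bullet> l))" using l(1,2) t \<Phi> by (simp add: assoc)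
    finally have v': "v = \<Phi> \<bullet> (\<pi> \<bullet> (\<iota> 0 \<bullet> l))" .
    then show "f = Zero T W B"
      unfolding v(3) v' using assoc_eq[OF tri_comp[OF tr], of "\<pi> \<bullet> (\<iota> 0 \<bullet> l)"] l(1,2) t tt by simp
  qed
  moreover have "triangle T Y X B" using tr by (auto simp: triangle_iff_tri)
  ultimately show ?thesis using Y by blast
qed

text \<open>The aisle and the right orthogonal of the generators are mutually orthogonal by checking
  generators; the triangles come from \<open>cellular_approximation\<close>.\<close>

lemma generated_t_structure:
  assumes H: "seq_compact H"
  obtains \<tau> where "t_structure T \<tau>" "fst \<tau> = GN H {..0}"
    "trunc T (snd \<tau>) 1 = {Y. \<forall>W\<in>shifts T H {..0}. orth W Y}"
proof -
  let ?R1 = "{Y. \<forall>W\<in>shifts T H {..0}. orth W Y}"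
  \<comment> \<open>Orthogonality in a t-structure concerns \<open>trunc T R 1\<close>, so R is the
    right orthogonal shifted back by one.\<close>
  define R where "R = {Y. shift T (- 1) Y \<in> ?R1}"
  have R1: "trunc T R 1 = ?R1" unfolding set_eq_iff trunc_iff R_def by simp
  have "\<forall>X\<in>GN H {..0}. \<forall>Y. isomorphic T X Y \<longrightarrow> Y \<in> GN H {..0}"
    using ext_closedD(4)[OF ext_closed_gen] by blast
  moreover have "Y \<in> R" if "X \<in> R" "isomorphic T X Y" for X Y
    using that orth_retract_right[OF isomorphic_retract[OF that(2)]]
    by (simp add: R_def flip: orth_shift_left[of 1, simplified])
  moreover have "trunc T (GN H {..0}) (- 1) \<subseteq> GN H {..0}"
    using gen_mono[of "{..-1}" "{..0}" H] by (auto simp: trunc_iff gen_shift_atMost)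
  moreover have "trunc T R 1 \<subseteq> R"
  proof
    fix Y assume "Y \<in> trunc T R 1"
    then have Y: "\<forall>W\<in>shifts T H {..0}. orth W Y" unfolding R1 by simp
    have "orth W (shift T (- 1) Y)" if W: "W \<in> shifts T H {..0}" for W
    proof -
      obtain j where j: "j \<le> 0" "W = shift T (- j) H" using W by (auto simp: shifts_def)
      have "shift T (- (j - 1)) H \<in> shifts T H {..0}" using j(1) by (intro mem_shifts) simp
      moreover have "shift T (- (j - 1)) H = shift T 1 W" unfolding j(2) by (simp add: algebra_simps S_shift)
      ultimately show ?thesis using Y orth_shift_left[of 1 W Y] by simp
    qed
    then show "Y \<in> R" by (simp add: R_def)
  qed
  moreover have "Mor T X Y = {Zero T X Y}" if "X \<in> GN H {..0}" "Y \<in> trunc T R 1" for X Y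
    using gen_orth[OF _ that(1), of Y] that(2) unfolding R1 orth_iff by blast
  moreover have "\<exists>A\<in>GN H {..0}. \<exists>B\<in>trunc T R 1. triangle T A X B" for X
    using cellular_approximation[OF H, of X] Coprod_gen unfolding R1 by blast
  ultimately have "t_structure T (GN H {..0}, R)"
    unfolding t_structure_def prod.case by blast
  then show ?thesis using that R1 by simp
qed

section \<open>Aisles\<close>

lemma t_structureD:
  assumes "t_structure T \<tau>"
  shows "X \<in> fst \<tau> \<Longrightarrow> isomorphic T X Y \<Longrightarrow> Y \<in> fst \<tau>"
    "X \<in> fst \<tau> \<Longrightarrow> S X \<in> fst \<tau>"
    "X \<in> fst \<tau> \<Longrightarrow> Y \<in> trunc T (snd \<tau>) 1 \<Longrightarrow> orth X Y"
    "\<exists>A\<in>fst \<tau>. \<exists>B\<in>trunc T (snd \<tau>) 1. triangle T A X B"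
proof -
  obtain L R where \<tau>: "\<tau> = (L, R)" by (cases \<tau>)
  have *: "\<forall>X\<in>L. \<forall>Y. isomorphic T X Y \<longrightarrow> Y \<in> L" "trunc T L (-1) \<subseteq> L"
    "\<forall>X\<in>L. \<forall>Y\<in>trunc T R 1. Mor T X Y = {Zero T X Y}" "\<forall>X. \<exists>A\<in>L. \<exists>B\<in>trunc T R 1. triangle T A X B"
    using assms unfolding t_structure_def \<tau> prod.case by blast+
  show "X \<in> fst \<tau> \<Longrightarrow> isomorphic T X Y \<Longrightarrow> Y \<in> fst \<tau>" using *(1) \<tau> by auto
  show "X \<in> fst \<tau> \<Longrightarrow> S X \<in> fst \<tau>" using *(2) \<tau> by (auto simp: trunc_def)
  show "X \<in> fst \<tau> \<Longrightarrow> Y \<in> trunc T (snd \<tau>) 1 \<Longrightarrow> orth X Y" using *(3) \<tau> by (simp add: orth_iff)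
  show "\<exists>A\<in>fst \<tau>. \<exists>B\<in>trunc T (snd \<tau>) 1. triangle T A X B" using *(4) \<tau> by simp
qed

text \<open>If X has no arrow to the coaisle, then g = 0 in its truncation triangle, so the identity
  of B factors through \<Sigma>A. That object is still in the aisle, hence B = 0.\<close>

lemma aisle_eq:
  assumes t: "t_structure T \<tau>"
  shows "fst \<tau> = {X. \<forall>Y\<in>trunc T (snd \<tau>) 1. orth X Y}"
proof (intro equalityI subsetI CollectI ballI)
  fix X Y assume "X \<in> fst \<tau>" "Y \<in> trunc T (snd \<tau>) 1"
  then show "orth X Y" by (rule t_structureD(3)[OF t])
next
  fix X assume X: "X \<in> {X. \<forall>Y\<in>trunc T (snd \<tau>) 1. orth X Y}"
  obtain A B where AB: "A \<in> fst \<tau>" "B \<in> trunc T (snd \<tau>) 1" "triangle T A X B"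
    using t_structureD(4)[OF t] by blast
  then obtain f g h where 1: "tri A X B f g h" by (auto simp: triangle_iff_tri)
  note tt = tri_types[OF 1]
  have "g = Zero T X B" using X AB(2) orthD[of X B g] tt by simp
  then have "Ident T B \<bullet> g = Zero T X B" by simp
  from tri_extend2[OF 1 _ _ this] obtain v where v: "Dom T v = S A" "Cod T v = B" "Ident T B = v \<bullet> h" by auto
  have "v = Zero T (S A) B"
    using t_structureD(3)[OF t t_structureD(2)[OF t AB(1)] AB(2)] v by (intro orthD) auto
  then have "Ident T B = Zero T B B" using v(3) tt by simp
  then have "iso_arrow T f" by (intro tri_zero_iso[OF 1] zero_objectI)
  then have "isomorphic T A X" using tt by (auto simp: isomorphic_def in_Mor)
  then show "X \<in> fst \<tau>" by (rule t_structureD(1)[OF t AB(1)])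
qed

lemma trunc_eq: "trunc T L n = {X. shift T n X \<in> L}"
  by (auto simp: trunc_iff)

lemma trunc_0 [simp]: "trunc T L 0 = L"
  by (simp add: trunc_eq)

lemma shift_trunc: "shift T k X \<in> trunc T L n \<longleftrightarrow> X \<in> trunc T L (n + k)"
  by (simp add: trunc_iff)

text \<open>The closure properties shared by all \<open>trunc T (fst \<tau>) n\<close>; truncation
  triangles are deliberately not included.\<close>

definition aisle :: "'o set \<Rightarrow> bool" where
  "aisle L \<longleftrightarrow> ext_closed L \<and> Smd T L \<subseteq> L \<and> (\<forall>X\<in>L. S X \<in> L)"

lemma t_structure_aisle:
  assumes t: "t_structure T \<tau>" shows "aisle (fst \<tau>)"
  unfolding aisle_def
proof (intro conjI ballI)
  show "ext_closed (fst \<tau>)" "Smd T (fst \<tau>) \<subseteq> fst \<tau>"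
    unfolding aisle_eq[OF t] by (rule ext_closed_orth, rule Smd_orth)
qed (rule t_structureD(2)[OF t])

lemma aisle_trunc: assumes "aisle L" shows "aisle (trunc T L n)"
  unfolding aisle_def
proof (intro conjI ballI)
  show "ext_closed (trunc T L n)" using assms unfolding aisle_def trunc_eq by (intro ext_closed_shift) blast
  show "Smd T (trunc T L n) \<subseteq> trunc T L n"
  proof
    fix X assume "X \<in> Smd T (trunc T L n)"
    then obtain B where "shift T n B \<in> L" "retract X B" by (auto simp: Smd_eq trunc_iff)
    then have "shift T n X \<in> Smd T L" by (intro SmdI[of _ "shift T n B"]) (auto simp: retract_shift)
    then show "X \<in> trunc T L n" using assms unfolding aisle_def trunc_iff by blast
  qed
  fix X assume "X \<in> trunc T L n"
  then have "S (shift T n X) \<in> L" using assms unfolding aisle_def trunc_iff by blast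
  then show "S X \<in> trunc T L n" by (simp add: trunc_iff S_shift)
qed

lemma aisle_shift:
  assumes "aisle L" "X \<in> L" "0 \<le> n" shows "shift T n X \<in> L"
  using assms(3)
proof (induction n rule: int_ge_induct)
  case base then show ?case using assms(2) by simp
next
  case (step i)
  then have "S (shift T i X) \<in> L" using assms(1) unfolding aisle_def by blast
  then show ?case by (simp add: S_shift)
qed

lemma trunc_mono:
  assumes "aisle L" "m \<le> n" shows "trunc T L m \<subseteq> trunc T L n"
proof
  fix X assume "X \<in> trunc T L m"
  have "shift T (n - m) (shift T m X) \<in> L" by (rule aisle_shift[OF assms(1)]) (use \<open>X \<in> _\<close> assms(2) in \<open>simp_all add: trunc_iff\<close>)
  then show "X \<in> trunc T L n" by (simp add: trunc_iff)
qed

lemma trunc_subset: "L \<subseteq> L' \<Longrightarrow> trunc T L n \<subseteq> trunc T L' n"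
  by (auto simp: trunc_iff)

lemma trunc_trunc: "trunc T (trunc T L m) n = trunc T L (m + n)"
  by (auto simp: trunc_iff)

lemma trunc_gen: "trunc T (GN G {..m}) n = GN G {..m + n}"
  by (auto simp: trunc_iff gen_shift_atMost)

lemma truncation_triangle:
  assumes t: "t_structure T \<tau>"
  shows "\<exists>A\<in>trunc T (fst \<tau>) n. \<exists>B\<in>trunc T (snd \<tau>) (n + 1). triangle T A X B"
proof -
  obtain A B where AB: "A \<in> fst \<tau>" "B \<in> trunc T (snd \<tau>) 1" "triangle T A (shift T n X) B"
    using t_structureD(4)[OF t] by blast
  have "shift T (- n) A \<in> trunc T (fst \<tau>) n" "shift T (- n) B \<in> trunc T (snd \<tau>) (n + 1)"
    using AB by (simp_all add: trunc_iff)
  moreover have "triangle T (shift T (- n) A) X (shift T (- n) B)"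
    using AB(3) triangle_shift[of "- n" A "shift T n X" B] by simp
  ultimately show ?thesis by blast
qed

lemma trunc_orth:
  assumes t: "t_structure T \<tau>" and "X \<in> trunc T (fst \<tau>) n" "Y \<in> trunc T (snd \<tau>) (n + 1)"
  shows "orth X Y"
proof -
  have "orth (shift T n X) (shift T n Y)"
    by (rule t_structureD(3)[OF t]) (use assms in \<open>simp_all add: trunc_iff add.commute\<close>)
  then show ?thesis by (simp only: orth_shift)
qed

text \<open>The two halves of condition (a), with \<open>L\<close> in the role of \<open>T\<^sup>\<le>\<^sup>0\<close>.\<close>

definition bounded_above :: "'o set \<Rightarrow> 'o \<Rightarrow> int \<Rightarrow> bool" where
  "bounded_above L K N \<longleftrightarrow> shift T N K \<in> L"

definition bounded_below :: "'o set \<Rightarrow> 'o \<Rightarrow> int \<Rightarrow> bool" where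
  "bounded_below L K N \<longleftrightarrow> (\<forall>X\<in>L. orth (shift T (- N) K) X)"

lemma bounded_above_trunc:
  assumes "aisle L" "bounded_above L K N" "N \<le> i + n" shows "shift T i K \<in> trunc T L n"
proof -
  have "shift T (i + n - N) (shift T N K) \<in> L"
    by (rule aisle_shift[OF assms(1)]) (use assms(2,3) in \<open>simp_all add: bounded_above_def\<close>)
  then show ?thesis by (simp add: trunc_iff add.commute)
qed

lemma bounded_below_orth:
  assumes "aisle L" "bounded_below L K N" "Y \<in> trunc T L n" "i + n + N \<le> 0" shows "orth (shift T i K) Y"
proof -
  have "shift T (- N - i) Y = shift T (- N - i - n) (shift T n Y)" by simp
  moreover have "shift T (- N - i - n) (shift T n Y) \<in> L"
    by (rule aisle_shift[OF assms(1)]) (use assms(3,4) in \<open>auto simp: trunc_iff\<close>)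
  ultimately have "orth (shift T (- N) K) (shift T (- N - i) Y)"
    using assms(2) unfolding bounded_below_def by metis
  then have "orth (shift T (- N - i) (shift T i K)) (shift T (- N - i) Y)" by simp
  then show ?thesis by (simp only: orth_shift)
qed

section \<open>Resolutions by successive approximation\<close>

text \<open>Dependent choice for resolutions: P n constrains the object at stage n, Q n the fibre
  and arrow leaving it.\<close>

lemma resolution:
  assumes "P 0 K"
    and "\<And>n X. P n X \<Longrightarrow> \<exists>E d. Q n E d \<and> fib E d \<and> Dom T d = X \<and> P (Suc n) (Cod T d)"
  obtains X d E where "X 0 = K" "\<forall>n::nat. P n (X n)" "\<forall>n. Dom T (d n) = X n \<and> Cod T (d n) = X (Suc n)"
    "\<forall>n. Q n (E n) (d n)" "\<forall>n. fib (E n) (d n)"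
proof -
  \<comment> \<open>The clause for n = 0 fixes the start, which \<open>dependent_nat_choice\<close>
    would leave free.\<close>
  have "\<exists>X. \<forall>n. (P n (X n) \<and> (n = 0 \<longrightarrow> X n = K)) \<and>
    (\<exists>E d. Q n E d \<and> fib E d \<and> Dom T d = X n \<and> Cod T d = X (Suc n))"
  proof (rule dependent_nat_choice)
    show "\<exists>X. P 0 X \<and> (0 = (0::nat) \<longrightarrow> X = K)" using assms(1) by blast
    fix X n assume X: "P n X \<and> (n = 0 \<longrightarrow> X = K)"
    then obtain E d where "Q n E d" "fib E d" "Dom T d = X" "P (Suc n) (Cod T d)"
      using assms(2) by blast
    then show "\<exists>Y. (P (Suc n) Y \<and> (Suc n = 0 \<longrightarrow> Y = K)) \<and>
        (\<exists>E d. Q n E d \<and> fib E d \<and> Dom T d = X \<and> Cod T d = Y)"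
      by (intro exI[of _ "Cod T d"]) blast
  qed
  then obtain X where X: "\<And>n. P n (X n)" "X 0 = K"
    and "\<forall>n. \<exists>E d. Q n E d \<and> fib E d \<and> Dom T d = X n \<and> Cod T d = X (Suc n)" by blast
  then obtain E d where "\<forall>n. Q n (E n) (d n) \<and> fib (E n) (d n) \<and> Dom T (d n) = X n \<and> Cod T (d n) = X (Suc n)"
    by metis
  with X show ?thesis by (intro that[of X d E]) auto
qed

lemma vanishingI:
  assumes "\<forall>n. Dom T (d n) = X n \<and> Cod T (d n) = X (Suc n)"
    and "\<And>i. \<exists>N. \<forall>n\<ge>N. orth (shift T i G) (X n)"
  shows "vanishing G X d"
  unfolding vanishing_def
proof (intro conjI allI)
  fix i
  obtain N where N: "\<forall>n\<ge>N. orth (shift T i G) (X n)" using assms(2) by blast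
  have "d n \<bullet> f = Zero T (shift T i G) (X (Suc n))"
    if "N \<le> n" "Dom T f = shift T i G" "Cod T f = X n" for n f
    using orthD[of "shift T i G" "X n" f] N that assms(1) by simp
  then show "\<exists>N. \<forall>n\<ge>N. \<forall>f. Dom T f = shift T i G \<and> Cod T f = X n \<longrightarrow>
      d n \<bullet> f = Zero T (shift T i G) (X (Suc n))" by blast
qed (use assms(1) in auto)

lemma vanishing_trunc:
  assumes L: "aisle L" and b: "bounded_below L G N"
    and d: "\<forall>n. Dom T (d n) = X n \<and> Cod T (d n) = X (Suc n)" and X: "\<forall>n. X n \<in> trunc T L (m - int n)"
  shows "vanishing G X d"
proof (rule vanishingI[OF d])
  fix i
  have "orth (shift T i G) (X n)" if "nat (i + m + N) \<le> n" for n
    by (rule bounded_below_orth[OF L b X[rule_format]]) (use that in auto)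
  then show "\<exists>N. \<forall>n\<ge>N. orth (shift T i G) (X n)" by blast
qed

text \<open>Truncating \<open>K\<close> further and further from below has a vanishing homotopy colimit, so a compact
  \<open>K\<close> is a retract of an object of some \<open>T\<^sup>\<le>\<^sup>n\<close>.\<close>

lemma compact_bounded_above:
  assumes G: "generates G" and t: "t_structure T \<tau>" and a: "bounded_above (fst \<tau>) G N" and K: "seq_compact K"
  shows "\<exists>n. bounded_above (fst \<tau>) K n"
proof -
  note L = t_structure_aisle[OF t]
  \<comment> \<open>Nothing is asked at stage 0, where K has not been truncated yet.\<close>
  define P where "P n X \<longleftrightarrow> (0 < n \<longrightarrow> X \<in> trunc T (snd \<tau>) (int n))" for n :: nat and X
  have step: "\<exists>E d. E \<in> trunc T (fst \<tau>) (int n) \<and> fib E d \<and> Dom T d = X \<and> P (Suc n) (Cod T d)" for n X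
  proof -
    obtain A B where AB: "A \<in> trunc T (fst \<tau>) (int n)" "B \<in> trunc T (snd \<tau>) (int n + 1)" "triangle T A X B"
      using truncation_triangle[OF t] by blast
    then obtain d where "fib A d" "Dom T d = X" "Cod T d = B" by (auto simp: triangle_iff_fib)
    with AB show ?thesis by (intro exI[of _ A] exI[of _ d]) (simp add: P_def add.commute)
  qed
  have "P 0 K" by (simp add: P_def)
  then obtain X d E where X: "X 0 = K" "\<forall>n. P n (X n)" "\<forall>n. Dom T (d n) = X n \<and> Cod T (d n) = X (Suc n)"
    and E: "\<forall>n. E n \<in> trunc T (fst \<tau>) (int n)" "\<forall>n. fib (E n) (d n)"
    using step by (rule resolution[of P K "\<lambda>n E _. E \<in> trunc T (fst \<tau>) (int n)"])
  have v: "vanishing G X d"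
  proof (rule vanishingI[OF X(3)])
    fix i
    have "orth (shift T i G) (X n)" if "nat (N - i) + 1 \<le> n" for n
    proof (rule trunc_orth[OF t])
      \<comment> \<open>X n starts in degree n, so G shifted by i has to lie in level n - 1; that
        holds once n - 1 reaches N - i.\<close>
      show "shift T i G \<in> trunc T (fst \<tau>) (int n - 1)" by (rule bounded_above_trunc[OF L a]) (use that in auto)
      show "X n \<in> trunc T (snd \<tau>) (int n - 1 + 1)" using X(2) that unfolding P_def by auto
    qed
    then show "\<exists>N. \<forall>n\<ge>N. orth (shift T i G) (X n)" by blast
  qed
  have "\<exists>n. X 0 \<in> Smd T (trunc T (fst \<tau>) (int n))"
  proof (rule vanishing_devissage[OF G v, of E])
    show "seq_compact (X 0)" using X(1) K by simp
    show "fib (E n) (d n)" for n using E(2) by blast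
    show "Z \<in> trunc T (fst \<tau>) (int 0)" if "zero_object T Z" for Z
      using ext_closedD(3) that L by (simp add: aisle_def)
    fix n
    have "star T (trunc T (fst \<tau>) (int n)) {E n} \<subseteq> star T (trunc T (fst \<tau>) (int n)) (trunc T (fst \<tau>) (int n))"
      using E by (intro star_mono) auto
    also have "\<dots> \<subseteq> trunc T (fst \<tau>) (int n)"
      using aisle_trunc[OF L, of "int n"] unfolding aisle_def ext_closed_def by blast
    also have "\<dots> \<subseteq> trunc T (fst \<tau>) (int (Suc n))" by (rule trunc_mono[OF L]) simp
    finally show "star T (trunc T (fst \<tau>) (int n)) {E n} \<subseteq> trunc T (fst \<tau>) (int (Suc n))" .
  qed
  then obtain n where "K \<in> trunc T (fst \<tau>) (int n)"
    using aisle_trunc[OF L] X(1) unfolding aisle_def by blast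
  then show ?thesis unfolding bounded_above_def trunc_iff by blast
qed

text \<open>The common form of (b) and (c), with the set of admissible first vertices as a
  parameter, so that one argument transfers both.\<close>

definition approximates :: "'o set \<Rightarrow> 'o set \<Rightarrow> bool" where
  "approximates \<E> L \<longleftrightarrow> (\<forall>F\<in>L. \<exists>E\<in>\<E>. \<exists>D\<in>trunc T L (-1). triangle T E F D)"

lemma approximates_trunc:
  assumes "approximates \<E> L" "F \<in> trunc T L m"
  obtains E D where "E \<in> \<E>" "D \<in> trunc T L (m - 1)" "triangle T (shift T (- m) E) F D"
proof -
  obtain E D where ED: "E \<in> \<E>" "D \<in> trunc T L (-1)" "triangle T E (shift T m F) D"
    using assms unfolding approximates_def trunc_iff[of F] by blast
  have "shift T (- m) D \<in> trunc T L (m - 1)" using ED(2) by (simp add: shift_trunc)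
  moreover have "triangle T (shift T (- m) E) F (shift T (- m) D)"
    using ED(3) triangle_shift[of "- m" E "shift T m F" D] by simp
  ultimately show ?thesis using that ED(1) by blast
qed

text \<open>X n lies in level m - n, so it is moved to level 0, approximated there and moved back;
  this is the shift by n - m.\<close>

lemma approximation_resolution:
  assumes "approximates \<E> L" "K \<in> trunc T L m"
  obtains X d E where "X 0 = K" "\<forall>n. X n \<in> trunc T L (m - int n)"
    "\<forall>n. Dom T (d n) = X n \<and> Cod T (d n) = X (Suc n)"
    "\<forall>n. E n \<in> shift T (int n - m) ` \<E>" "\<forall>n. fib (E n) (d n)"
proof (rule resolution[of "\<lambda>n X. X \<in> trunc T L (m - int n)" K "\<lambda>n E _. E \<in> shift T (int n - m) ` \<E>"])
  show "K \<in> trunc T L (m - int 0)" using assms(2) by simp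
  fix n X assume "X \<in> trunc T L (m - int n)"
  then obtain E D where ED: "E \<in> \<E>" "D \<in> trunc T L (m - int n - 1)" "triangle T (shift T (- (m - int n)) E) X D"
    by (rule approximates_trunc[OF assms(1)])
  then obtain d where "fib (shift T (int n - m) E) d" "Dom T d = X" "Cod T d = D"
    by (auto simp: triangle_iff_fib)
  then show "\<exists>E d. E \<in> shift T (int n - m) ` \<E> \<and> fib E d \<and> Dom T d = X \<and> Cod T d \<in> trunc T L (m - int (Suc n))"
    using ED by (intro exI[of _ "shift T (int n - m) E"] exI[of _ d]) (simp add: algebra_simps)
qed (rule that; assumption)

lemma shift_atLeastAtMost: "(\<lambda>j. j - n) ` {a..b} = {a - n..b - n :: int}"
  by (auto simp: image_iff intro!: bexI[of _ "_ + n"])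

lemma compact_in_bounded_gen:
  assumes G: "generates G" and L: "aisle L" and b: "bounded_below L G N"
    and E: "approximates (GN G {- A..A}) L" and K: "seq_compact K" "bounded_above L K m"
  shows "\<exists>B. K \<in> GN G {- B..B}"
proof -
  have "K \<in> trunc T L m" using K(2) by (simp add: trunc_iff bounded_above_def)
  then obtain X d E where X: "X 0 = K" "\<forall>n. X n \<in> trunc T L (m - int n)"
    "\<forall>n. Dom T (d n) = X n \<and> Cod T (d n) = X (Suc n)"
    and E: "\<forall>n. E n \<in> shift T (int n - m) ` GN G {- A..A}" "\<forall>n. fib (E n) (d n)"
    by (rule approximation_resolution[OF E])
  have v: "vanishing G X d" by (rule vanishing_trunc[OF L b X(3,2)])
  \<comment> \<open>The shift by n - m moves the window of stage n by at most |m| + n; the bound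
    increases in n so as to contain all earlier windows.\<close>
  let ?B = "\<lambda>n. \<bar>A\<bar> + \<bar>m\<bar> + int n"
  have En: "E n \<in> GN G {- ?B n..?B n}" for n
  proof -
    obtain E' where "E' \<in> GN G {- A..A}" "E n = shift T (int n - m) E'" using E(1) by blast
    then have "E n \<in> GN G {- A - (int n - m)..A - (int n - m)}"
      using gen_shift[of E' G "{- A..A}" "int n - m"] by (simp only: shift_atLeastAtMost)
    moreover have "{- A - (int n - m)..A - (int n - m)} \<subseteq> {- ?B n..?B n}" by auto
    ultimately show ?thesis using gen_mono by blast
  qed
  have "\<exists>n. X 0 \<in> Smd T (GN G {- ?B n..?B n})"
  proof (rule vanishing_devissage[OF G v, of E])
    show "seq_compact (X 0)" using X(1) K by simp
    show "fib (E n) (d n)" for n using E(2) by blast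
    show "Z \<in> GN G {- ?B 0..?B 0}" if "zero_object T Z" for Z
      using ext_closedD(3) that ext_closed_gen by blast
    fix n
    have "star T (GN G {- ?B n..?B n}) {E n} \<subseteq> star T (GN G {- ?B n..?B n}) (GN G {- ?B n..?B n})"
      using En by (intro star_mono) auto
    also have "\<dots> \<subseteq> GN G {- ?B n..?B n}" using ext_closed_gen unfolding ext_closed_def by blast
    also have "\<dots> \<subseteq> GN G {- ?B (Suc n)..?B (Suc n)}" by (rule gen_mono) auto
    finally show "star T (GN G {- ?B n..?B n}) {E n} \<subseteq> GN G {- ?B (Suc n)..?B (Suc n)}" .
  qed
  then show ?thesis unfolding Smd_gen X(1) by blast
qed

text \<open>The means of carrying the vanishing half of (a) from G to another compact object: it is
  tested on the shifts of G, the worst of which costs B.\<close>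

lemma gen_bounded_below:
  assumes L: "aisle L" and b: "bounded_below L G N" and K: "K \<in> GN G {- B..B}"
  shows "bounded_below L K (N + B)"
proof -
  have "orth K Y" if "Y \<in> trunc T L (- N - B)" for Y
  proof (rule gen_orth[OF _ K])
    fix W assume "W \<in> shifts T G {- B..B}"
    then obtain j where j: "- B \<le> j" "W = shift T (- j) G" by (auto simp: shifts_def)
    show "orth W Y" unfolding j(2) by (rule bounded_below_orth[OF L b that]) (use j(1) in simp)
  qed
  moreover have "shift T (N + B) X \<in> trunc T L (- N - B)" if "X \<in> L" for X
    using that by (simp add: shift_trunc)
  ultimately show ?thesis unfolding bounded_below_def orth_shift_left minus_minus by blast
qed

text \<open>Membership in the generated aisle is tested by orthogonality through
  \<open>aisle_eq\<close>, which avoids presenting F as a colimit of extensions.\<close>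

lemma aisle_in_gen:
  assumes G: "generates G" and L: "aisle L" and b: "bounded_below L G N"
    and E: "approximates (GN G {- A..A}) L"
  shows "L \<subseteq> GN G {..A}"
proof
  fix F assume F: "F \<in> L"
  have sc: "seq_compact G" using G by (simp add: generates_def)
  obtain \<tau> where \<tau>: "t_structure T \<tau>" "fst \<tau> = GN G {..0}"
    "trunc T (snd \<tau>) 1 = {Y. \<forall>W\<in>shifts T G {..0}. orth W Y}"
    using generated_t_structure[OF sc] by blast
  have F0: "F \<in> trunc T L 0" using F by simp
  obtain X d E where X: "X 0 = F" "\<forall>n. X n \<in> trunc T L (0 - int n)"
    "\<forall>n. Dom T (d n) = X n \<and> Cod T (d n) = X (Suc n)"
    and E: "\<forall>n. E n \<in> shift T (int n - 0) ` GN G {- A..A}" "\<forall>n. fib (E n) (d n)"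
    by (rule approximation_resolution[OF E F0])
  have v: "vanishing G X d" by (rule vanishing_trunc[OF L b X(3,2)])
  \<comment> \<open>Suspending n times moves the window down to {- A - n..A - n}, so its upper end
    never exceeds A.\<close>
  have En: "shift T A (E n) \<in> GN G {..0}" for n
  proof -
    obtain E' where E': "E' \<in> GN G {- A..A}" "E n = shift T (int n) E'" using E(1) by auto
    then have "E' \<in> GN G {..0 + (A + int n)}" using gen_mono[of "{- A..A}" "{..0 + (A + int n)}" G] by auto
    then show ?thesis using E'(2) gen_shift_atMost[of "A + int n" E' G 0] by simp
  qed
  have "orth (shift T A F) Y" if Y: "\<forall>W\<in>shifts T G {..0}. orth W Y" for Y
  proof -
    let ?Z = "shift T (- A) Y"
    have EZ: "orth (E n) ?Z" for n
    proof -
      have "orth (shift T A (E n)) Y" by (rule gen_orth[OF _ En]) (use Y in blast)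
      then show ?thesis by (simp only: orth_shift_left)
    qed
    have "f = Zero T F ?Z" if f: "Dom T f = F" "Cod T f = ?Z" for f
    proof -
      \<comment> \<open>An arrow on X n extends along d n because the fibre E n has no arrows to
        ?Z.\<close>
      have "\<exists>\<phi>. \<forall>n. (Dom T (\<phi> n) = X n \<and> Cod T (\<phi> n) = ?Z \<and> (n = 0 \<longrightarrow> \<phi> n = f)) \<and> \<phi> (Suc n) \<bullet> d n = \<phi> n"
      proof (rule dependent_nat_choice)
        show "\<exists>\<phi>. Dom T \<phi> = X 0 \<and> Cod T \<phi> = ?Z \<and> (0 = (0::nat) \<longrightarrow> \<phi> = f)" using f X(1) by auto
        fix \<phi> n assume \<phi>: "Dom T \<phi> = X n \<and> Cod T \<phi> = ?Z \<and> (n = 0 \<longrightarrow> \<phi> = f)"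
        obtain u where "Dom T u = Cod T (d n)" "Cod T u = ?Z" "\<phi> = u \<bullet> d n"
          by (rule fib_extend[of "E n" "d n" \<phi> ?Z]) (use \<phi> X(3) E(2) EZ in auto)
        then show "\<exists>u. (Dom T u = X (Suc n) \<and> Cod T u = ?Z \<and> (Suc n = 0 \<longrightarrow> u = f)) \<and> u \<bullet> d n = \<phi>"
          using X(3) by (intro exI[of _ u]) simp
      qed
      then obtain \<phi> where \<phi>: "\<forall>n. (Dom T (\<phi> n) = X n \<and> Cod T (\<phi> n) = ?Z \<and> (n = 0 \<longrightarrow> \<phi> n = f)) \<and>
          \<phi> (Suc n) \<bullet> d n = \<phi> n" ..
      have "\<phi> 0 = Zero T (X 0) ?Z"
        by (rule vanishing_compatible[OF G v, of \<phi>]) (use \<phi> in blast)+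
      then show ?thesis using \<phi> X(1) by simp
    qed
    then have "orth F ?Z" by (simp add: orth_def)
    then show ?thesis by (simp only: orth_shift_left)
  qed
  then have "shift T A F \<in> fst \<tau>" unfolding aisle_eq[OF \<tau>(1)] \<tau>(3) by blast
  then show "F \<in> GN G {..A}" unfolding \<tau>(2) gen_shift_atMost by simp
qed

section \<open>Comparing two compact generators\<close>

lemma triangle_zero_isomorphic:
  assumes "triangle T X N Y" "zero_object T N" shows "isomorphic T Y (S X)"
proof -
  obtain f g h where "tri X N Y f g h" using assms(1) by (auto simp: triangle_iff_tri)
  note t = tri_rotate[OF tri_rotate[OF this]]
  have "iso_arrow T h" by (rule tri_zero_iso[OF t zero_object_S[OF assms(2)]])
  then show ?thesis using tri_types[OF t] by (auto simp: isomorphic_def in_Mor)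
qed

text \<open>The connecting arrow vanishes, so g has a section j; the octahedral axiom for g j = 1
  identifies the cone of j with R.\<close>

lemma triangle_swap:
  assumes "triangle T R Y Q" "orth Q (S R)" shows "triangle T Q Y R"
proof -
  obtain f g h where 1: "tri R Y Q f g h" using assms(1) by (auto simp: triangle_iff_tri)
  note t = tri_types[OF 1]
  have h: "h = Zero T Q (S R)" using orthD[OF assms(2)] t by simp
  have "\<exists>j. Dom T j = Q \<and> Cod T j = Y \<and> Ident T Q = g \<bullet> j"
    by (rule tri_lift2[OF 1]) (auto simp: h)
  then obtain j where j: "Dom T j = Q" "Cod T j = Y" "Ident T Q = g \<bullet> j" by blast
  obtain Z where Z: "fib Z j" by (rule fib_ex)
  have g: "fib R g" using 1 t by (auto simp: fib_def)
  \<comment> \<open>N is the fibre of an identity, hence zero, and the triangle on Z, N, R then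
    makes R the suspension of the fibre Z of j.\<close>
  obtain N where N: "fib N (g \<bullet> j)" "triangle T Z N R" by (rule fib_Comp[OF Z g]) (use j t in auto)
  obtain e k where ek: "tri N Q Q e (Ident T Q) k" using N(1) unfolding j(3)[symmetric] by (auto simp: fib_def)
  note te = tri_types[OF ek]
  have e: "e = Zero T N Q" and k: "k = Zero T Q (S N)" using tri_comp[OF ek] tri_comp2[OF ek] te by simp_all
  have "\<exists>v. Dom T v = S N \<and> Cod T v = Q \<and> Ident T (S N) = k \<bullet> v"
    by (rule tri_lift3[OF ek]) (use e in auto)
  then have "SM (Ident T N) = SM (Zero T N N)" using k by auto
  then have "Ident T N = Zero T N N" by (simp only: SM_eq_iff)
  then have "zero_object T N" by (rule zero_objectI)
  then have iso: "isomorphic T R (S Z)" by (rule triangle_zero_isomorphic[OF N(2)])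
  have "triangle T Z Q Y" unfolding triangle_iff_fib using Z j by blast
  then have "triangle T Q Y (S Z)" by (rule triangle_rotate)
  then show ?thesis
    using isomorphic_sym[OF iso] isomorphic_refl triangle_isomorphic by blast
qed

lemma star_swap:
  assumes "\<And>r q. r \<in> R \<Longrightarrow> q \<in> Q \<Longrightarrow> orth q (S r)" shows "star T R Q \<subseteq> star T Q R"
proof
  fix y assume "y \<in> star T R Q"
  then obtain r q where *: "r \<in> R" "q \<in> Q" "triangle T r y q" unfolding star_def by blast
  have "triangle T q y r" by (rule triangle_swap[OF *(3) assms[OF *(1,2)]])
  then show "y \<in> star T Q R" using *(2,1) by (rule starI)
qed

text \<open>The upper half of (a) puts every summand of index at most M - N into level M, so only
  finitely many degrees are kept.\<close>

lemma coprods_shifts_split: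
  assumes L: "aisle L" and a: "bounded_above L G N" and F: "F \<in> coprods (shifts T G {..B})"
  shows "F \<in> star T (coprods (shifts T G {M - N + 1..B})) (trunc T L M)"
proof -
  obtain I :: "'u set" and X \<iota> where I: "small \<kappa> I" "\<forall>i\<in>I. X i \<in> shifts T G {..B}" "coproduct T I X F \<iota>"
    using F by (rule coprodsE)
  define I1 where "I1 = {i \<in> I. X i \<in> shifts T G {M - N + 1..B}}"
  define I2 where "I2 = I - I1"
  have I12: "I1 \<union> I2 = I" "I1 \<inter> I2 = {}" "I1 \<subseteq> I" "I2 \<subseteq> I" by (auto simp: I1_def I2_def)
  have s: "small \<kappa> I1" "small \<kappa> I2" using I12 I(1) small_mono by blast+
  obtain C1 \<iota>1 where C1: "coproduct T I1 X C1 \<iota>1" using s(1) by (rule coproduct_exists)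
  obtain C2 \<iota>2 where C2: "coproduct T I2 X C2 \<iota>2" using s(2) by (rule coproduct_exists)
  have "triangle T C1 F C2"
    by (rule coproduct_split[OF _ C1 C2 I12(2), of F \<iota>]) (use I(3) I12(1) in simp)
  moreover have "C1 \<in> coprods (shifts T G {M - N + 1..B})"
    by (rule coprodsI[OF C1 s(1)]) (simp add: I1_def)
  moreover have "C2 \<in> coprods (trunc T L M)"
  proof (rule coprodsI[OF C2 s(2)])
    fix i assume i: "i \<in> I2"
    then obtain j where j: "j \<le> B" "X i = shift T (- j) G" using I(2) I12(4) by (force simp: shifts_def)
    have "\<not> M - N + 1 \<le> j" using i j by (auto simp: I2_def I1_def intro: mem_shifts)
    then show "X i \<in> trunc T L M" unfolding j(2) by (intro bounded_above_trunc[OF L a]) simp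
  qed
  then have "C2 \<in> trunc T L M" using aisle_trunc[OF L] unfolding aisle_def ext_closed_def by blast
  ultimately show ?thesis by (rule starI)
qed

lemma Coprod_n_orth:
  assumes "\<And>W. W \<in> shifts T G J \<Longrightarrow> orth W Y" "X \<in> CPn n G J" shows "orth X Y"
  using gen_orth[OF assms(1)] assms(2) Coprod_n_Coprod Coprod_gen by blast

text \<open>The two middle factors of \<open>(Q\<^sub>1 * R\<^sub>1) * (Q\<^sub>2 * R\<^sub>2)\<close> may be exchanged if \<open>R\<^sub>1\<close> is chosen after
  \<open>Q\<^sub>2\<close>.\<close>

lemma Coprod_n_split:
  assumes L: "aisle L" and a: "bounded_above L G N" and b: "bounded_below L G N"
  shows "\<exists>C. CPn (Suc n) G {..B} \<subseteq> star T (CPn (Suc n) G {C..B}) (trunc T L M)"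
proof (induction n arbitrary: M)
  case 0
  then show ?case using coprods_shifts_split[OF L a, of _ B M] by (intro exI[of _ "M - N + 1"]) auto
next
  case (Suc n)
  obtain C2 where C2: "CPn (Suc n) G {..B} \<subseteq> star T (CPn (Suc n) G {C2..B}) (trunc T L M)"
    using Suc.IH by blast
  \<comment> \<open>M' \<le> C2 - N annihilates arrows from ?Q2 to suspensions of ?R1, as the
    exchange requires; M' \<le> M places ?R1 inside ?R2.\<close>
  define M' where "M' = min M (C2 - N)"
  define C where "C = min (M' - N + 1) C2"
  let ?Q1 = "CPn (Suc 0) G {M' - N + 1..B}" and ?Q2 = "CPn (Suc n) G {C2..B}"
    and ?R1 = "trunc T L M'" and ?R2 = "trunc T L M"
  have "CPn (Suc 0) G {..B} \<subseteq> star T ?Q1 ?R1" using coprods_shifts_split[OF L a, of _ B M'] by auto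
  from star_mono[OF this C2] have "CPn (Suc (Suc n)) G {..B} \<subseteq> star T (star T ?Q1 ?R1) (star T ?Q2 ?R2)"
    by simp
  also have "\<dots> = star T ?Q1 (star T (star T ?R1 ?Q2) ?R2)" by (simp only: star_assoc)
  also have "\<dots> \<subseteq> star T ?Q1 (star T (star T ?Q2 ?R1) ?R2)"
  proof (rule star_mono[OF order_refl star_mono[OF star_swap order_refl]])
    fix r q assume r: "r \<in> ?R1" and q: "q \<in> ?Q2"
    have "S r \<in> trunc T L M'" using aisle_trunc[OF L] r unfolding aisle_def by blast
    then have r': "S r \<in> trunc T L (C2 - N)" using trunc_mono[OF L, of M' "C2 - N"] unfolding M'_def by auto
    show "orth q (S r)"
    proof (rule Coprod_n_orth[OF _ q])
      fix W assume "W \<in> shifts T G {C2..B}"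
      then obtain j where j: "C2 \<le> j" "W = shift T (- j) G" by (auto simp: shifts_def)
      show "orth W (S r)" unfolding j(2) by (rule bounded_below_orth[OF L b r']) (use j(1) in simp)
    qed
  qed
  also have "\<dots> = star T (star T ?Q1 ?Q2) (star T ?R1 ?R2)" by (simp only: star_assoc)
  also have "\<dots> \<subseteq> star T (CPn (Suc (Suc n)) G {C..B}) ?R2"
  proof (rule star_mono)
    show "star T ?Q1 ?Q2 \<subseteq> CPn (Suc (Suc n)) G {C..B}"
      unfolding Coprod_n.simps(3)[of \<kappa> T n]
      by (intro star_mono Coprod_n_mono) (auto simp: C_def)
    have "star T ?R1 ?R2 \<subseteq> star T ?R2 ?R2"
      by (intro star_mono trunc_mono[OF L]) (auto simp: M'_def)
    also have "\<dots> \<subseteq> ?R2" using aisle_trunc[OF L] unfolding aisle_def ext_closed_def by blast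
    finally show "star T ?R1 ?R2 \<subseteq> ?R2" .
  qed
  finally show ?case by blast
qed

text \<open>Since \<open>X\<close> is bounded above, \<open>\<Sigma>\<^sup>-\<^sup>i G\<close> has no arrows to \<open>X\<close> for large \<open>i\<close>, so the cone of the
  coproduct of all remaining arrows is bounded above as well.\<close>

lemma killing_step:
  assumes L: "aisle L" and a: "bounded_above L G N" and b: "bounded_below L G N" and X: "X \<in> trunc T L m"
  shows "\<exists>E d. ((\<exists>M. E \<in> CPn (Suc 0) G {..M}) \<and>
      (\<forall>i f. Dom T f = shift T i G \<and> Cod T f = X \<longrightarrow> d \<bullet> f = Zero T (shift T i G) (Cod T d))) \<and>
     fib E d \<and> Dom T d = X \<and> (\<exists>m. Cod T d \<in> trunc T L m)"
proof -
  \<comment> \<open>Arrows to X from shifts of index above m + N vanish by the lower half of (a), so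
    this truncated family still accounts for all of them.\<close>
  let ?M = "{f. Dom T f \<in> shifts T G {..m + N} \<and> Cod T f = X \<and> True}"
  obtain E w where E: "E \<in> coprods (shifts T G {..m + N})" and w: "Dom T w = E" "Cod T w = X"
    and 1: "\<And>f. f \<in> ?M \<Longrightarrow> \<exists>j. Dom T j = Dom T f \<and> Cod T j = E \<and> f = w \<bullet> j"
    by (rule cover[OF small_arrows_from_shifts[of G "{..m + N}" X "\<lambda>_. True"], of "shifts T G {..m + N}" X]) blast+
  obtain D d h where t: "tri E X D w d h" using tri_cone[of w] w by metis
  note tt = tri_types[OF t]
  have "d \<bullet> f = Zero T (shift T i G) D" if f: "Dom T f = shift T i G" "Cod T f = X" for i f
  proof (cases "- i \<le> m + N")
    case True
    then have "f \<in> ?M" using f mem_shifts[of "- i" "{..m + N}" G] by simp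
    from 1[OF this] obtain j where j: "Dom T j = Dom T f" "Cod T j = E" "f = w \<bullet> j" by blast
    have "d \<bullet> f = (d \<bullet> w) \<bullet> j" unfolding j(3) using j(1,2) tt by (simp add: assoc)
    then show ?thesis using tri_comp[OF t] j(1,2) f by simp
  next
    case False
    then have "f = Zero T (shift T i G) X"
      by (intro orthD[OF bounded_below_orth[OF L b X]]) (use f in auto)
    then show ?thesis using tt by simp
  qed
  moreover have "E \<in> CPn (Suc 0) G {..m + N}" using E by simp
  moreover have "fib E d" using t tt by (auto simp: fib_def)
  moreover have "D \<in> trunc T L (max m (m + N + N))"
  proof -
    let ?L = "trunc T L (max m (m + N + N))"
    have "shifts T G {..m + N} \<subseteq> ?L"
    proof
      fix W assume "W \<in> shifts T G {..m + N}"
      then obtain j where j: "j \<le> m + N" "W = shift T (- j) G" by (auto simp: shifts_def)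
      show "W \<in> ?L" unfolding j(2) by (rule bounded_above_trunc[OF L a]) (use j(1) in simp)
    qed
    then have "E \<in> ?L" using E coprods_mono aisle_trunc[OF L] unfolding aisle_def ext_closed_def by blast
    then have "S E \<in> ?L" using aisle_trunc[OF L] unfolding aisle_def by blast
    moreover have "X \<in> ?L" using X trunc_mono[OF L, of m "max m (m + N + N)"] by auto
    moreover have "triangle T X D (S E)" using tri_rotate[OF t] by (auto simp: triangle_iff_tri)
    ultimately show ?thesis using ext_closedD(2) aisle_trunc[OF L] unfolding aisle_def by blast
  qed
  ultimately show ?thesis
    using tt by (intro exI[of _ E] exI[of _ d]) blast
qed

text \<open>The stage at which the identity of K dies bounds the number of extensions. At that point
  indices are bounded above only; the missing lower bound comes from K having no arrows to objects
  deep in L.\<close>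

lemma compact_in_gen_n:
  assumes G: "generates G" and L: "aisle L" and a: "bounded_above L G N" and b: "bounded_below L G N"
    and K: "seq_compact K" "bounded_above L K m" "bounded_below L K m'"
  shows "\<exists>n B. K \<in> GNn (Suc n) G {- B..B}"
proof -
  have "K \<in> trunc T L m" using K(2) by (simp add: trunc_iff bounded_above_def)
  then have K0: "\<exists>m. K \<in> trunc T L m" by blast
  obtain X d E where X: "X 0 = K" "\<forall>n. \<exists>m. X n \<in> trunc T L m"
    "\<forall>n. Dom T (d n) = X n \<and> Cod T (d n) = X (Suc n)"
    and E: "\<forall>n. (\<exists>M. E n \<in> CPn (Suc 0) G {..M}) \<and>
      (\<forall>i f. Dom T f = shift T i G \<and> Cod T f = Dom T (d n) \<longrightarrow> d n \<bullet> f = Zero T (shift T i G) (Cod T (d n)))"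
      "\<forall>n. fib (E n) (d n)"
  \<comment> \<open>The index bound M may change with the stage and is therefore quantified inside;
    X is recovered as Dom T d, since Q does not see it.\<close>
  proof (rule resolution[of "\<lambda>n X. \<exists>m. X \<in> trunc T L m" K "\<lambda>n E d. (\<exists>M. E \<in> CPn (Suc 0) G {..M}) \<and>
      (\<forall>i f. Dom T f = shift T i G \<and> Cod T f = Dom T d \<longrightarrow> d \<bullet> f = Zero T (shift T i G) (Cod T d))"])
    show "\<exists>m. K \<in> trunc T L m" by (rule K0)
    fix n :: nat and X assume "\<exists>m. X \<in> trunc T L m"
    then obtain m where "X \<in> trunc T L m" by blast
    from killing_step[OF L a b this] show "\<exists>E d. ((\<exists>M. E \<in> CPn (Suc 0) G {..M}) \<and>
      (\<forall>i f. Dom T f = shift T i G \<and> Cod T f = Dom T d \<longrightarrow> d \<bullet> f = Zero T (shift T i G) (Cod T d))) \<and>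
      fib E d \<and> Dom T d = X \<and> (\<exists>m. Cod T d \<in> trunc T L m)" by (elim exE conjE) (intro exI conjI; simp)
  qed (rule that; assumption)
  have v: "vanishing G X d" unfolding vanishing_def using X(3) E(1) by simp
  have "\<exists>n. X 0 \<in> Smd T (\<Union>M. CPn (Suc n) G {..M})"
  proof (rule vanishing_devissage[OF G v, of E])
    show "seq_compact (X 0)" using X(1) K by simp
    show "fib (E n) (d n)" for n using E(2) by blast
    show "Z \<in> (\<Union>M. CPn (Suc 0) G {..M})" if "zero_object T Z" for Z
      using zero_Coprod_n[OF that] by blast
    fix n
    show "star T (\<Union>M. CPn (Suc n) G {..M}) {E n} \<subseteq> (\<Union>M. CPn (Suc (Suc n)) G {..M})"
    proof
      fix Y assume "Y \<in> star T (\<Union>M. CPn (Suc n) G {..M}) {E n}"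
      then obtain F M where F: "F \<in> CPn (Suc n) G {..M}" "triangle T F Y (E n)" unfolding star_def by blast
      obtain M' where M': "E n \<in> CPn (Suc 0) G {..M'}" using E(1) by blast
      have "F \<in> CPn (Suc n) G {..max M M'}" "E n \<in> CPn (Suc 0) G {..max M M'}"
        using F(1) M' Coprod_n_mono[of "{..M}" "{..max M M'}" n G] Coprod_n_mono[of "{..M'}" "{..max M M'}" 0 G]
        by auto
      then have "Y \<in> star T (CPn (Suc n) G {..max M M'}) (CPn (Suc 0) G {..max M M'})"
        using F(2) by (intro starI)
      then have "Y \<in> CPn (Suc n + Suc 0) G {..max M M'}" unfolding star_Coprod_n .
      then show "Y \<in> (\<Union>M. CPn (Suc (Suc n)) G {..M})" by auto
    qed
  qed
  then obtain n B F where F: "F \<in> CPn (Suc n) G {..B}" "retract K F" unfolding X(1) Smd_eq by blast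
  \<comment> \<open>At level - m' arrows from K vanish, so the section K \<rightarrow> F has no
    component in R and factors through Q.\<close>
  obtain C where "CPn (Suc n) G {..B} \<subseteq> star T (CPn (Suc n) G {C..B}) (trunc T L (- m'))"
    using Coprod_n_split[OF L a b] by blast
  then obtain Q R where QR: "Q \<in> CPn (Suc n) G {C..B}" "R \<in> trunc T L (- m')" "triangle T Q F R"
    using F(1) unfolding star_def by blast
  obtain f g h where t: "tri Q F R f g h" using QR(3) by (auto simp: triangle_iff_tri)
  note tt = tri_types[OF t]
  obtain i p where ip: "Dom T i = K" "Cod T i = F" "Dom T p = F" "Cod T p = K" "p \<bullet> i = Ident T K"
    using F(2) by (rule retractE)
  have "orth (shift T 0 K) R" by (rule bounded_below_orth[OF L K(3) QR(2)]) simp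
  then have "g \<bullet> i = Zero T K R" using ip tt by (intro orthD) auto
  from tri_lift[OF t ip(1,2) this] obtain v where v: "Dom T v = K" "Cod T v = Q" "i = f \<bullet> v" by blast
  have "retract K Q" by (rule retractI[of v _ _ "p \<bullet> f"]) (use v ip tt in \<open>auto simp: assoc\<close>)
  moreover have "{C..B} \<subseteq> {- (\<bar>B\<bar> + \<bar>C\<bar>)..\<bar>B\<bar> + \<bar>C\<bar>}" by auto
  from Coprod_n_mono[OF this] QR(1) have "Q \<in> CPn (Suc n) G {- (\<bar>B\<bar> + \<bar>C\<bar>)..\<bar>B\<bar> + \<bar>C\<bar>}" by blast
  ultimately show ?thesis unfolding gen_n_def by (blast intro: SmdI)
qed

section \<open>Changing the generator and the t-structure\<close>

lemma cond_a_iff: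
  "cond_a T G \<tau> A \<longleftrightarrow> bounded_above (fst \<tau>) G (int A) \<and> bounded_below (fst \<tau>) G (int A)"
  unfolding cond_a_def bounded_above_def bounded_below_def orth_iff ..

lemma cond_b_iff: "cond_b \<kappa> T G \<tau> A \<longleftrightarrow> approximates (GN G {- int A..int A}) (fst \<tau>)"
  unfolding cond_b_def approximates_def ..

lemma cond_c_iff: "cond_c \<kappa> T G \<tau> A \<longleftrightarrow> approximates (GNn A G {- int A..int A}) (fst \<tau>)"
  unfolding cond_c_def approximates_def ..

lemma approximates_mono: "approximates \<E> L \<Longrightarrow> \<E> \<subseteq> \<E>' \<Longrightarrow> approximates \<E>' L"
  unfolding approximates_def by blast

section \<open>Transfer of the conditions between nearby aisles\<close>

lemma bounded_above_mono: "aisle L \<Longrightarrow> bounded_above L K M \<Longrightarrow> M \<le> N \<Longrightarrow> bounded_above L K N"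
  using bounded_above_trunc[of L K M N 0] by (simp add: bounded_above_def)

lemma bounded_below_mono: "aisle L \<Longrightarrow> bounded_below L K M \<Longrightarrow> M \<le> N \<Longrightarrow> bounded_below L K N"
  using bounded_below_orth[of L K M _ 0 "- N"] by (simp add: bounded_below_def)

lemma bounded_above_transfer:
  assumes "aisle L" "bounded_above L K N" "trunc T L (- M) \<subseteq> L'" shows "bounded_above L' K (N + M)"
  unfolding bounded_above_def using bounded_above_trunc[OF assms(1,2), of "N + M" "- M"] assms(3) by auto

lemma bounded_below_transfer:
  assumes "aisle L" "bounded_below L K N" "L' \<subseteq> trunc T L M" shows "bounded_below L' K (N + M)"
  unfolding bounded_below_def
proof
  fix X assume "X \<in> L'"
  then have X: "X \<in> trunc T L M" using assms(3) by blast
  show "orth (shift T (- (N + M)) K) X" by (rule bounded_below_orth[OF assms(1,2) X]) simp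
qed

text \<open>\<open>Bd\<close> will be \<open>gen_bounded G'\<close> for (b) and
  \<open>gen_n_bounded G'\<close> for (c). The first vertex after n + 1 approximations is an
  extension of n + 1 shifted members of \<E>.\<close>

lemma iterated_approximation:
  assumes E: "approximates \<E> L" "Bd \<E>"
    and Bd: "\<And>A B. Bd A \<Longrightarrow> Bd B \<Longrightarrow> Bd (star T A B)" "\<And>A k. Bd A \<Longrightarrow> Bd (shift T k ` A)"
  shows "\<exists>\<E>'. Bd \<E>' \<and> (\<forall>F\<in>trunc T L m. \<exists>E\<in>\<E>'. \<exists>D\<in>trunc T L (m - 1 - int n). triangle T E F D)"
proof (induction n)
  case 0
  have "\<exists>E\<in>shift T (- m) ` \<E>. \<exists>D\<in>trunc T L (m - 1). triangle T E F D" if "F \<in> trunc T L m" for F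
    by (rule approximates_trunc[OF E(1) that]) blast
  moreover have "Bd (shift T (- m) ` \<E>)" by (rule Bd(2)[OF E(2)])
  ultimately show ?case by (intro exI[of _ "shift T (- m) ` \<E>"] conjI ballI) simp_all
next
  case (Suc n)
  then obtain \<E>1 where \<E>1: "Bd \<E>1"
    "\<forall>F\<in>trunc T L m. \<exists>E\<in>\<E>1. \<exists>D\<in>trunc T L (m - 1 - int n). triangle T E F D" by blast
  let ?\<E>2 = "shift T (- (m - 1 - int n)) ` \<E>"
  have "\<exists>E\<in>star T \<E>1 ?\<E>2. \<exists>D\<in>trunc T L (m - 1 - int (Suc n)). triangle T E F D" if F: "F \<in> trunc T L m" for F
  proof -
    obtain E1 D1 where 1: "E1 \<in> \<E>1" "D1 \<in> trunc T L (m - 1 - int n)" "triangle T E1 F D1"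
      using \<E>1(2) F by blast
    obtain E2 D2 where 2: "E2 \<in> \<E>" "D2 \<in> trunc T L (m - 1 - int n - 1)"
      "triangle T (shift T (- (m - 1 - int n)) E2) D1 D2"
      by (rule approximates_trunc[OF E(1) 1(2)])
    obtain Y where Y: "triangle T Y F D2" "triangle T E1 Y (shift T (- (m - 1 - int n)) E2)"
      by (rule triangle_assoc[OF 1(3) 2(3)])
    have "Y \<in> star T \<E>1 ?\<E>2" using Y(2) 1(1) 2(1) by (intro starI) auto
    moreover have "D2 \<in> trunc T L (m - 1 - int (Suc n))" using 2(2) by (simp add: algebra_simps)
    ultimately show ?thesis using Y(1) by blast
  qed
  moreover have "Bd (star T \<E>1 ?\<E>2)" using Bd \<E>1(1) E(2) by blast
  ultimately show ?case by blast
qed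

text \<open>An object of L' starts in level M and has to reach level - M - 1, which lies in the
  suspension of L'. That takes 2 M + 1 approximations, the index n = 2 M being counted from
  0.\<close>

lemma approximates_transfer:
  assumes E: "approximates \<E> L" "Bd \<E>"
    and Bd: "\<And>A B. Bd A \<Longrightarrow> Bd B \<Longrightarrow> Bd (star T A B)" "\<And>A k. Bd A \<Longrightarrow> Bd (shift T k ` A)"
    and L': "L' \<subseteq> trunc T L (int M)" "trunc T L (- int M) \<subseteq> L'"
  shows "\<exists>\<E>'. Bd \<E>' \<and> approximates \<E>' L'"
proof -
  obtain \<E>' where \<E>': "Bd \<E>'"
    "\<forall>F\<in>trunc T L (int M). \<exists>E\<in>\<E>'. \<exists>D\<in>trunc T L (int M - 1 - int (2 * M)). triangle T E F D"
    using iterated_approximation[of \<E> L Bd "int M" "2 * M"] E Bd by blast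
  have "trunc T L (int M - 1 - int (2 * M)) = trunc T (trunc T L (- int M)) (- 1)"
    by (simp add: trunc_trunc)
  also have "\<dots> \<subseteq> trunc T L' (- 1)" by (rule trunc_subset[OF L'(2)])
  finally have "approximates \<E>' L'" unfolding approximates_def using \<E>'(2) L'(1) by blast
  with \<E>'(1) show ?thesis by blast
qed

section \<open>Bounded sets of generated objects\<close>

definition gen_bounded :: "'o \<Rightarrow> 'o set \<Rightarrow> bool" where
  "gen_bounded G A \<longleftrightarrow> (\<exists>a. A \<subseteq> GN G {- a..a})"

definition gen_n_bounded :: "'o \<Rightarrow> 'o set \<Rightarrow> bool" where
  "gen_n_bounded G A \<longleftrightarrow> (\<exists>n a. A \<subseteq> GNn (Suc n) G {- a..a})"

lemma gen_bounded_star: assumes "gen_bounded G A" "gen_bounded G B" shows "gen_bounded G (star T A B)"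
proof -
  obtain a b where ab: "A \<subseteq> GN G {- a..a}" "B \<subseteq> GN G {- b..b}" using assms by (auto simp: gen_bounded_def)
  let ?c = "max a b"
  have 1: "A \<subseteq> GN G {- ?c..?c}" using ab(1) gen_mono[of "{- a..a}" "{- ?c..?c}" G] by fastforce
  have 2: "B \<subseteq> GN G {- ?c..?c}" using ab(2) gen_mono[of "{- b..b}" "{- ?c..?c}" G] by fastforce
  have "star T A B \<subseteq> GN G {- ?c..?c}"
    using star_mono[OF 1 2] ext_closed_gen[of G "{- ?c..?c}"] unfolding ext_closed_def by blast
  then show ?thesis by (auto simp: gen_bounded_def)
qed

lemma gen_bounded_shift: assumes "gen_bounded G A" shows "gen_bounded G (shift T k ` A)"
proof -
  obtain a where a: "A \<subseteq> GN G {- a..a}" using assms by (auto simp: gen_bounded_def)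
  have "shift T k X \<in> GN G {- (a + \<bar>k\<bar>)..a + \<bar>k\<bar>}" if "X \<in> A" for X
  proof -
    have "shift T k X \<in> GN G {- a - k..a - k}"
      using gen_shift[of X G "{- a..a}" k] a that by (auto simp only: shift_atLeastAtMost)
    moreover have "{- a - k..a - k} \<subseteq> {- (a + \<bar>k\<bar>)..a + \<bar>k\<bar>}" by auto
    ultimately show ?thesis using gen_mono by blast
  qed
  then show ?thesis unfolding gen_bounded_def by blast
qed

lemma gen_n_bounded_star: assumes "gen_n_bounded G A" "gen_n_bounded G B" shows "gen_n_bounded G (star T A B)"
proof -
  obtain m n a b where ab: "A \<subseteq> GNn (Suc m) G {- a..a}" "B \<subseteq> GNn (Suc n) G {- b..b}"
    using assms unfolding gen_n_bounded_def by blast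
  let ?c = "max a b"
  have 1: "A \<subseteq> GNn (Suc m) G {- ?c..?c}" using ab(1) gen_n_mono[of m m "{- a..a}" "{- ?c..?c}" G] by fastforce
  have 2: "B \<subseteq> GNn (Suc n) G {- ?c..?c}" using ab(2) gen_n_mono[of n n "{- b..b}" "{- ?c..?c}" G] by fastforce
  have "star T A B \<subseteq> GNn (Suc m + Suc n) G {- ?c..?c}"
    by (rule subset_trans[OF star_mono[OF 1 2] star_gen_n])
  then have "star T A B \<subseteq> GNn (Suc (Suc (m + n))) G {- ?c..?c}" by simp
  then show ?thesis unfolding gen_n_bounded_def by blast
qed

lemma gen_n_bounded_shift: assumes "gen_n_bounded G A" shows "gen_n_bounded G (shift T k ` A)"
proof -
  obtain n a where a: "A \<subseteq> GNn (Suc n) G {- a..a}" using assms unfolding gen_n_bounded_def by blast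
  have "shift T k X \<in> GNn (Suc n) G {- (a + \<bar>k\<bar>)..a + \<bar>k\<bar>}" if "X \<in> A" for X
  proof -
    have "shift T k X \<in> GNn (Suc n) G {- a - k..a - k}"
      using gen_n_shift[of X n G "{- a..a}" k] a that by (auto simp only: shift_atLeastAtMost)
    moreover have "{- a - k..a - k} \<subseteq> {- (a + \<bar>k\<bar>)..a + \<bar>k\<bar>}" by auto
    ultimately show ?thesis using gen_n_mono[of n n] by blast
  qed
  then show ?thesis unfolding gen_n_bounded_def by blast
qed

lemma shifts_gen_n_bounded:
  assumes "G \<in> GNn (Suc k) G' {- B..B}"
  shows "shifts T G {- A..A} \<subseteq> GNn (Suc k) G' {- (A + B)..A + B}"
proof
  fix X assume "X \<in> shifts T G {- A..A}"
  then obtain j where j: "- A \<le> j" "j \<le> A" "X = shift T (- j) G" by (auto simp: shifts_def)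
  have "X \<in> GNn (Suc k) G' {- B + j..B + j}"
    using gen_n_shift[OF assms, of "- j"] unfolding j(3) shift_atLeastAtMost by simp
  moreover have "{- B + j..B + j} \<subseteq> {- (A + B)..A + B}" using j by auto
  ultimately show "X \<in> GNn (Suc k) G' {- (A + B)..A + B}" using gen_n_mono[of k k] by blast
qed

lemma compare_generators:
  assumes G: "generates G" and \<tau>: "t_structure T \<tau>" and a: "cond_a T G \<tau> A" and b: "cond_b \<kappa> T G \<tau> A"
    and G': "generates G'"
  obtains N k B where "bounded_above (fst \<tau>) G' (int N)" "bounded_below (fst \<tau>) G' (int N)"
    "G \<in> GNn (Suc k) G' {- B..B}"
    "GN G' {..0} \<subseteq> trunc T (fst \<tau>) (int N)" "fst \<tau> \<subseteq> trunc T (GN G' {..0}) (int N)"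
proof -
  let ?L = "fst \<tau>"
  note L = t_structure_aisle[OF \<tau>]
  have sc: "seq_compact G" "seq_compact G'" using G G' by (simp_all add: generates_def)
  have aG: "bounded_above ?L G (int A)" "bounded_below ?L G (int A)" using a by (simp_all add: cond_a_iff)
  have E: "approximates (GN G {- int A..int A}) ?L" using b by (simp add: cond_b_iff)
  obtain n where n: "bounded_above ?L G' n" using compact_bounded_above[OF G \<tau> aG(1) sc(2)] by blast
  obtain C where "G' \<in> GN G {- C..C}" using compact_in_bounded_gen[OF G L aG(2) E sc(2) n] by blast
  then have m: "bounded_below ?L G' (int A + C)" by (rule gen_bounded_below[OF L aG(2)])
  define M where "M = max n (int A + C)"
  have M: "bounded_above ?L G' M" "bounded_below ?L G' M"
    unfolding M_def by (rule bounded_above_mono[OF L n], simp, rule bounded_below_mono[OF L m], simp)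
  \<comment> \<open>The roles are exchanged here: G is resolved by G', for which both halves of (a)
    are now known.\<close>
  obtain k B where kB: "G \<in> GNn (Suc k) G' {- B..B}"
    using compact_in_gen_n[OF G' L M sc(1) aG] by blast
  \<comment> \<open>M bounds G'. The other term arises since L lies in GN G {..A} and rewriting G in
    terms of G' costs B more degrees.\<close>
  define N where "N = nat (max M (int A + B))"
  have N: "M \<le> int N" "int A + B \<le> int N" by (auto simp: N_def)
  have "GN G' {..0} \<subseteq> trunc T ?L (int N)"
  proof (rule gen_least)
    show "ext_closed (trunc T ?L (int N))" "Smd T (trunc T ?L (int N)) \<subseteq> trunc T ?L (int N)"
      using aisle_trunc[OF L] unfolding aisle_def by blast+
    show "shifts T G' {..0} \<subseteq> trunc T ?L (int N)"
      using N(1) by (auto simp: shifts_def intro!: bounded_above_trunc[OF L M(1)])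
  qed
  moreover have "?L \<subseteq> trunc T (GN G' {..0}) (int N)"
  proof -
    have "?L \<subseteq> GN G {..int A}" by (rule aisle_in_gen[OF G L aG(2) E])
    also have "\<dots> \<subseteq> GN G' {..int A + B}"
    proof (rule gen_trans, rule subsetI)
      fix X assume "X \<in> shifts T G {..int A}"
      then obtain j where j: "j \<le> int A" "X = shift T (- j) G" by (auto simp: shifts_def)
      have "G \<in> GN G' {- B..B}" using kB gen_n_gen by blast
      then have "X \<in> GN G' {- B + j..B + j}"
        using gen_shift[of G G' "{- B..B}" "- j"] unfolding j(2) shift_atLeastAtMost by simp
      moreover have "{- B + j..B + j} \<subseteq> {..int A + B}" using j by auto
      ultimately show "X \<in> GN G' {..int A + B}" using gen_mono by blast
    qed
    also have "\<dots> \<subseteq> GN G' {..int N}" using N(2) by (intro gen_mono) auto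
    finally show ?thesis by (simp add: trunc_gen)
  qed
  moreover have "bounded_above ?L G' (int N)" "bounded_below ?L G' (int N)"
    using bounded_above_mono[OF L M(1) N(1)] bounded_below_mono[OF L M(2) N(1)] by blast+
  ultimately show ?thesis using kB by (intro that)
qed

lemma preferred_classI:
  assumes H: "generates H" and \<tau>: "t_structure T \<tau>"
    and N: "GN H {..0} \<subseteq> trunc T (fst \<tau>) (int N)" "fst \<tau> \<subseteq> trunc T (GN H {..0}) (int N)"
  shows "\<tau> \<in> preferred_class \<kappa> T H"
proof -
  have "seq_compact H" using H by (simp add: generates_def)
  then obtain \<tau>\<^sub>H where \<tau>\<^sub>H: "t_structure T \<tau>\<^sub>H" "fst \<tau>\<^sub>H = GN H {..0}"
    by (rule generated_t_structure)
  have "trunc T (GN H {..0}) (- int N) \<subseteq> fst \<tau>"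
    using trunc_subset[OF N(1), of "- int N"] by (simp add: trunc_trunc)
  \<comment> \<open>Equivalence requires a positive constant, whereas N may be 0.\<close>
  moreover have "trunc T (fst \<tau>\<^sub>H) (- int (Suc N)) \<subseteq> trunc T (fst \<tau>\<^sub>H) (- int N)"
    "trunc T (fst \<tau>\<^sub>H) (int N) \<subseteq> trunc T (fst \<tau>\<^sub>H) (int (Suc N))"
    by (rule trunc_mono[OF t_structure_aisle[OF \<tau>\<^sub>H(1)]], simp)+
  ultimately have "t_equivalent T \<tau>\<^sub>H \<tau>"
    unfolding t_equivalent_def using N(2) \<tau>\<^sub>H(2) by (intro exI[of _ "int (Suc N)"]) auto
  then show ?thesis using \<tau> \<tau>\<^sub>H unfolding preferred_class_def by blast
qed

lemma preferred_class_sandwich: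
  assumes "\<tau> \<in> preferred_class \<kappa> T H"
    and N: "GN H {..0} \<subseteq> trunc T L (int N)" "L \<subseteq> trunc T (GN H {..0}) (int N)"
  obtains M where "fst \<tau> \<subseteq> trunc T L (int M)" "trunc T L (- int M) \<subseteq> fst \<tau>"
proof -
  obtain \<tau>\<^sub>H :: "'o set \<times> 'o set" and a where a: "fst \<tau>\<^sub>H = GN H {..0}" "0 < a"
    "trunc T (fst \<tau>\<^sub>H) (- a) \<subseteq> fst \<tau>" "fst \<tau> \<subseteq> trunc T (fst \<tau>\<^sub>H) a"
    using assms(1) unfolding preferred_class_def t_equivalent_def by blast
  let ?M = "nat a + N"
  have "fst \<tau> \<subseteq> trunc T (trunc T L (int N)) a" using a(1,4) trunc_subset[OF N(1), of a] by auto
  then have "fst \<tau> \<subseteq> trunc T L (int ?M)" using a(2) by (simp add: trunc_trunc add.commute)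
  moreover have "trunc T L (- int ?M) \<subseteq> trunc T (trunc T (GN H {..0}) (int N)) (- int ?M)"
    by (rule trunc_subset[OF N(2)])
  then have "trunc T L (- int ?M) \<subseteq> fst \<tau>" using a by (auto simp: trunc_trunc)
  ultimately show ?thesis by (rule that)
qed

text \<open>The generator is replaced first, so the transfer to the aisle of \<tau>' already works
  with sets bounded in terms of G'.\<close>

lemma change_of_generator:
  assumes G: "generates G" and \<tau>: "t_structure T \<tau>" and a: "cond_a T G \<tau> A" and b: "cond_b \<kappa> T G \<tau> A"
    and H: "generates H" and G': "generates G'" and \<tau>': "\<tau>' \<in> preferred_class \<kappa> T H"
  shows "\<exists>A>0. cond_a T G' \<tau>' A \<and> cond_b \<kappa> T G' \<tau>' A" (is ?b)
    and "0 < A \<Longrightarrow> cond_c \<kappa> T G \<tau> A \<Longrightarrow> \<exists>A>0. cond_a T G' \<tau>' A \<and> cond_b \<kappa> T G' \<tau>' A \<and> cond_c \<kappa> T G' \<tau>' A"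
      (is "_ \<Longrightarrow> _ \<Longrightarrow> ?c")
proof -
  note L = t_structure_aisle[OF \<tau>]
  have t': "t_structure T \<tau>'" using \<tau>' by (simp add: preferred_class_def)
  note L' = t_structure_aisle[OF t']
  \<comment> \<open>The distance between the two aisles is measured through H, on which the
    preferred class is based.\<close>
  obtain M where M: "fst \<tau>' \<subseteq> trunc T (fst \<tau>) (int M)" "trunc T (fst \<tau>) (- int M) \<subseteq> fst \<tau>'"
    using compare_generators[OF G \<tau> a b H] preferred_class_sandwich[OF \<tau>'] by metis
  obtain N k B where N: "bounded_above (fst \<tau>) G' (int N)" "bounded_below (fst \<tau>) G' (int N)"
    and kB: "G \<in> GNn (Suc k) G' {- B..B}"
    by (rule compare_generators[OF G \<tau> a b G'])
  have a': "cond_a T G' \<tau>' n" if "N + M \<le> n" for n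
    using bounded_above_mono[OF L' bounded_above_transfer[OF L N(1) M(2)], of "int n"]
      bounded_below_mono[OF L' bounded_below_transfer[OF L N(2) M(1)], of "int n"] that
    by (simp add: cond_a_iff)
  note sh = shifts_gen_n_bounded[OF kB, of "int A"]
  have "gen_bounded G' (GN G {- int A..int A})"
    unfolding gen_bounded_def using gen_trans[OF subset_trans[OF sh gen_n_gen]] by blast
  then obtain \<E> where "gen_bounded G' \<E>" "approximates \<E> (fst \<tau>')"
    using approximates_transfer[of _ "fst \<tau>" "gen_bounded G'" "fst \<tau>'" M]
      b M gen_bounded_star gen_bounded_shift unfolding cond_b_iff by metis
  then obtain e where e: "approximates (GN G' {- e..e}) (fst \<tau>')"
    unfolding gen_bounded_def using approximates_mono by blast
  let ?n = "Suc (N + M + nat e)"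
  have "{- e..e} \<subseteq> {- int ?n..int ?n}" by auto
  then have "cond_b \<kappa> T G' \<tau>' ?n" unfolding cond_b_iff using approximates_mono[OF e gen_mono] by blast
  moreover have "cond_a T G' \<tau>' ?n" by (rule a') simp
  ultimately show ?b by blast
  assume A: "0 < A" and c: "cond_c \<kappa> T G \<tau> A"
  obtain A' where A': "A = Suc A'" using A by (cases A) auto
  have "gen_n_bounded G' (GNn A G {- int A..int A})"
  proof -
    \<comment> \<open>The length A * Suc k, rewritten as a successor, the form in which
      \<open>gen_n_bounded\<close> states lengths.\<close>
    have "GNn (Suc A') G {- int A..int A} \<subseteq> GNn (Suc (A' * Suc k + k)) G' {- (int A + B)..int A + B}"
      using gen_n_trans[OF sh, of A'] by (simp add: algebra_simps)
    then show ?thesis unfolding gen_n_bounded_def A' by blast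
  qed
  then obtain \<E>' where "gen_n_bounded G' \<E>'" "approximates \<E>' (fst \<tau>')"
    using approximates_transfer[of _ "fst \<tau>" "gen_n_bounded G'" "fst \<tau>'" M]
      c M gen_n_bounded_star gen_n_bounded_shift unfolding cond_c_iff by metis
  then obtain l f where f: "approximates (GNn (Suc l) G' {- f..f}) (fst \<tau>')"
    unfolding gen_n_bounded_def using approximates_mono by blast
  \<comment> \<open>One number has to serve (a), the window and the length in (c), so all bounds are
    added.\<close>
  let ?m = "N + M + nat f + l"
  have "{- f..f} \<subseteq> {- int (Suc ?m)..int (Suc ?m)}" by auto
  then have "GNn (Suc l) G' {- f..f} \<subseteq> GNn (Suc ?m) G' {- int (Suc ?m)..int (Suc ?m)}"
    by (intro gen_n_mono) auto
  then have "cond_c \<kappa> T G' \<tau>' (Suc ?m)" unfolding cond_c_iff by (rule approximates_mono[OF f])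
  \<comment> \<open>Deriving (b) from the new (c) gives all three conditions with the same
    constant.\<close>
  moreover from this have "cond_b \<kappa> T G' \<tau>' (Suc ?m)"
    unfolding cond_b_iff cond_c_iff by (rule approximates_mono[OF _ gen_n_gen])
  moreover have "cond_a T G' \<tau>' (Suc ?m)" by (rule a') simp
  ultimately show ?c by blast
qed

end

theorem mainTheorem5:
  fixes \<kappa> :: "'u rel" and T :: "('o, 'm) tricat" and H :: 'o
  assumes "triangulated_with_coproducts \<kappa> T"
    and "weakly_approximable \<kappa> T"
    and "compact_generator \<kappa> T H"
  shows "(\<forall>G \<tau> A. compact_generator \<kappa> T G \<and> t_structure T \<tau> \<and> 0 < A \<and>
             cond_a T G \<tau> A \<and> cond_b \<kappa> T G \<tau> A \<longrightarrow> \<tau> \<in> preferred_class \<kappa> T H) \<and>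
         (\<forall>G \<tau>. compact_generator \<kappa> T G \<and> \<tau> \<in> preferred_class \<kappa> T H \<longrightarrow>
             (\<exists>A>0. cond_a T G \<tau> A \<and> cond_b \<kappa> T G \<tau> A) \<and>
             (approximable \<kappa> T \<longrightarrow>
               (\<exists>A>0. cond_a T G \<tau> A \<and> cond_b \<kappa> T G \<tau> A \<and> cond_c \<kappa> T G \<tau> A)))"
proof -
  interpret triangulated_with_coproducts \<kappa> T by (rule assms(1))
  note gen = compact_generator_generates
  note H = gen[OF assms(3)]
  show ?thesis
  proof (intro conjI allI impI; elim conjE)
    fix G \<tau> and A :: nat
    assume G: "compact_generator \<kappa> T G" and \<tau>: "t_structure T \<tau>" "cond_a T G \<tau> A" "cond_b \<kappa> T G \<tau> A"
    show "\<tau> \<in> preferred_class \<kappa> T H"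
      by (rule compare_generators[OF gen[OF G] \<tau> H]) (rule preferred_classI[OF H \<tau>(1)])
  next
    fix G \<tau>
    assume *: "compact_generator \<kappa> T G" "\<tau> \<in> preferred_class \<kappa> T H"
    \<comment> \<open>The witness comes with its own generator and t-structure; both are exchanged
      for the given ones in a single step.\<close>
    obtain G\<^sub>0 \<tau>\<^sub>0 A\<^sub>0 where 0: "compact_generator \<kappa> T G\<^sub>0" "t_structure T \<tau>\<^sub>0"
      "cond_a T G\<^sub>0 \<tau>\<^sub>0 A\<^sub>0" "cond_b \<kappa> T G\<^sub>0 \<tau>\<^sub>0 A\<^sub>0"
      using assms(2) unfolding weakly_approximable_def by blast
    show "\<exists>A>0. cond_a T G \<tau> A \<and> cond_b \<kappa> T G \<tau> A"
      by (rule change_of_generator(1)[OF gen[OF 0(1)] 0(2-4) H gen[OF *(1)] *(2)])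
  next
    fix G \<tau>
    assume *: "compact_generator \<kappa> T G" "\<tau> \<in> preferred_class \<kappa> T H" and "approximable \<kappa> T"
    then obtain G\<^sub>0 \<tau>\<^sub>0 A\<^sub>0 where 0: "compact_generator \<kappa> T G\<^sub>0" "t_structure T \<tau>\<^sub>0"
      "cond_a T G\<^sub>0 \<tau>\<^sub>0 A\<^sub>0" "cond_b \<kappa> T G\<^sub>0 \<tau>\<^sub>0 A\<^sub>0" and c: "0 < A\<^sub>0" "cond_c \<kappa> T G\<^sub>0 \<tau>\<^sub>0 A\<^sub>0"
      unfolding approximable_def by blast
    show "\<exists>A>0. cond_a T G \<tau> A \<and> cond_b \<kappa> T G \<tau> A \<and> cond_c \<kappa> T G \<tau> A"
      by (rule change_of_generator(2)[OF gen[OF 0(1)] 0(2-4) H gen[OF *(1)] *(2) c])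
  qed
qed

end
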